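(* Let $g\ge 1$ be an integer. 1) $U_{h,h'}(\mathfrak{sl}_2,g)$ is a trivial formal deformation of $U(\mathfrak{sl}_2)$ along $h,h'$. 2) $U_{h,h'}(\mathfrak{sl}_2,g)$ is a trivial formal deformation of $U_h(\mathfrak{sl}_2)$ along $h'$. 3) $U_{h,h'}(\mathfrak{sl}_2,g)$ is a trivial formal deformation of $U_{h'}(\mathfrak{sl}_2)$ along $h$.
   Context: $\mathbb N=\{0,1,2,\dots\}$. Algebras are associative and unital. For a $\Bbbk$-module $V$ ($\Bbbk$ a commutative ring) and parameters $\bar h=(h_1,\dots,h_s)$, $V[[\bar h]]$ is the $\Bbbk[[\bar h]]$-module of formal power series with coefficients in $V$. For a set $X$, the $\mathbb C[[\bar h]]$-algebra topologically generated by $X$ and defined by relations $\mathcal R$ is the quotient of $\mathbb C\langle X\rangle[[\bar h]]$ ($\mathbb C\langle X\rangle$ the free algebra) by the closure, for the $\bar h$-adic topology, of the two-sided ideal generated by $\mathcal R$. Definition of $U_{h,h'}(\mathfrak{sl}_2,g)$. Let $\varepsilon=\exp(i\pi/g)$, $Q=\exp(h)$, $T=\exp(h')$, $$P(u)=\tfrac12\left(u^{g-1}+u^{1-g}\right)\prod_{k=1}^{g-1}\frac{\varepsilon^k u-\varepsilon^{-k}u^{-1}}{\varepsilon^k-\varepsilon^{-k}}.$$ $U_{h,h'}(\mathfrak{sl}_2,g)$ is the $\mathbb C[[h,h']]$-algebra topologically generated by $X^+,X^-,H,C$ with relations $[C,X^\pm]=[C,H]=0$, $[H,X^\pm]=\pm2X^\pm$,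 $$X^\pm X^\mp=\prod_{e=1,-1}\frac{\left(Q\,T^{\{H_e^\pm\}_Q}\right)^{H_e^\pm}-\left(Q\,T^{\{H_e^\pm\}_Q}\right)^{-H_e^\pm}}{Q\,T^{\{H_e^\pm\}_Q}-Q^{-1}T^{-\{H_e^\pm\}_Q}},$$ where $H_e^\pm=\frac12(\sqrt C+eH\mp e)$ and $\{H_e^\pm\}_Q=P(Q^{H_e^\pm})$. Here numerator and denominator are the series $2\sinh\big((h+h'\{H_e^\pm\}_Q)H_e^\pm\big)$ and $2\sinh(h+h'\{H_e^\pm\}_Q)$ in $\mathbb C[H,\sqrt C][[h,h']]$ ($H,\sqrt C$ polynomial variables), each is divided by $h+h'\{H_e^\pm\}_Q$ and then the quotient is taken; the product over $e$ is invariant under $\sqrt C\mapsto-\sqrt C$, so lies in $\mathbb C[H,(\sqrt C)^2][[h,h']]$, and $(\sqrt C)^2$ is replaced by $C$. $U(\mathfrak{sl}_2)$ is the enveloping algebra, with generators $\bar X^\pm,\bar H$ and relations $[\bar H,\bar X^\pm]=\pm2\bar X^\pm$, $[\bar X^+,\bar X^-]=\bar H$. $U_h(\mathfrak{sl}_2)$ is the $\mathbb C[[h]]$-algebra topologically generated by $\tilde X^\pm,\tilde H$ with relations $[\tilde H,\tilde X^\pm]=\pm2\tilde X^\pm$, $[\tilde X^+,\tilde X^-]=\sinh(h\tilde H)/\sinh(h)$; $U_{h'}(\mathfrak{sl}_2)$ is the same with $h$ replaced by $h'$. Formal deformations. A formal deformation of a $\Bbbk$-algebra $A$ along $\bar h$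 is a $\Bbbk[[\bar h]]$-algebra structure on the $\Bbbk[[\bar h]]$-module $A[[\bar h]]$ with unit $1\in A$ such that the canonical isomorphism $A[[\bar h]]/(\bar h=0)\simeq A$ is an algebra isomorphism. It is constant if its product is the $\Bbbk[[\bar h]]$-bilinear power series extension of that of $A$. Two are equivalent if there is a $\Bbbk[[\bar h]]$-algebra isomorphism between them inducing the identity modulo $\bar h$. It is trivial if it is equivalent to the constant one. Identifications of underlying modules: the topological bases $(X^-)^aH^b(X^+)^c$ of $U_{h,h'}(\mathfrak{sl}_2,g)$ and $(\tilde X^-)^a\tilde H^b(\tilde X^+)^c$ of $U_h(\mathfrak{sl}_2)$ (resp. $U_{h'}(\mathfrak{sl}_2)$), $a,b,c\in\mathbb N$, are identified with the basis $(\bar X^-)^a\bar H^b(\bar X^+)^c$ of $U(\mathfrak{sl}_2)$. This gives $U_{h,h'}(\mathfrak{sl}_2,g)=U(\mathfrak{sl}_2)[[h,h']]$, $U_h(\mathfrak{sl}_2)=U(\mathfrak{sl}_2)[[h]]$, $U_{h'}(\mathfrak{sl}_2)=U(\mathfrak{sl}_2)[[h']]$ as modules, hence $U_{h,h'}(\mathfrak{sl}_2,g)=U_h(\mathfrak{sl}_2)[[h']]=U_{h'}(\mathfrak{sl}_2)[[h]]$ as modules. In 1), $\Bbbk=\mathbb C$; in 2), $\Bbbk=\mathbb C[[h]]$ with parameter $h'$; in 3), $\Bbbk=\mathbb C[[h']]$ with parameter $h$. *)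

theory Defs
  imports
    Complex_Main
    "HOL-Library.Poly_Mapping"
    "HOL-Computational_Algebra.Formal_Power_Series"
    "HOL-Algebra.QuotRing"
    "HOL-Algebra.Algebraic_Closure_Type"
begin

section \<open>Free algebras\<close>

text \<open>Words form a monoid under concatenation, so that \<open>'x list \<Rightarrow>\<^sub>0 complex\<close> with
  the convolution product of \<^theory>\<open>HOL-Library.Poly_Mapping\<close> is the free algebra on \<open>'x\<close>.\<close>

instantiation list :: (type) monoid_add
begin
definition zero_list :: "'a list" where "zero_list = []"
definition plus_list :: "'a list \<Rightarrow> 'a list \<Rightarrow> 'a list" where "plus_list xs ys = xs @ ys"
instance by standard (simp_all add: zero_list_def plus_list_def)
end

type_synonym 'x free_alg = "'x list \<Rightarrow>\<^sub>0 complex"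

definition free_gen :: "'x \<Rightarrow> 'x free_alg"
  where "free_gen x = Poly_Mapping.single [x] 1"

definition free_scale :: "complex \<Rightarrow> 'x free_alg \<Rightarrow> 'x free_alg"
  where "free_scale c p = Poly_Mapping.single 0 c * p"

definition commutator :: "'a::ring_1 \<Rightarrow> 'a \<Rightarrow> 'a"
  where "commutator x y = x * y - y * x"

lemma ring_ring_of_type_algebra: "ring (ring_of_type_algebra :: 'a::ring_1 ring)"
proof -
  have "\<exists>y. x + y = 0" for x :: 'a
    using add.right_inverse by blast
  thus ?thesis
    unfolding ring_of_type_algebra_def using add.right_inverse
    by unfold_locales (auto simp: algebra_simps Units_def)
qed

definition gen_ideal :: "'a::ring_1 set \<Rightarrow> 'a set"
  where "gen_ideal S = genideal (ring_of_type_algebra :: 'a ring) S"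

lemma ideal_gen_ideal: "ideal (gen_ideal S) (ring_of_type_algebra :: 'a::ring_1 ring)"
  unfolding gen_ideal_def
  by (rule ring.genideal_ideal[OF ring_ring_of_type_algebra])
     (simp add: ring_of_type_algebra_def)

lemma gen_ideal_add: "x \<in> gen_ideal S \<Longrightarrow> y \<in> gen_ideal S \<Longrightarrow> x + y \<in> gen_ideal S"
  using additive_subgroup.a_closed[OF ideal.axioms(1)[OF ideal_gen_ideal[of S]]]
  by (simp add: ring_of_type_algebra_def)

lemma gen_ideal_0: "0 \<in> gen_ideal S"
  using additive_subgroup.zero_closed[OF ideal.axioms(1)[OF ideal_gen_ideal[of S]]]
  by (simp add: ring_of_type_algebra_def)

lemma gen_ideal_mult_left: "x \<in> gen_ideal S \<Longrightarrow> a * x \<in> gen_ideal S"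
  using ideal.I_l_closed[OF ideal_gen_ideal[of S], of x a]
  by (simp add: ring_of_type_algebra_def)

lemma gen_ideal_mult_right: "x \<in> gen_ideal S \<Longrightarrow> x * a \<in> gen_ideal S"
  using ideal.I_r_closed[OF ideal_gen_ideal[of S], of x a]
  by (simp add: ring_of_type_algebra_def)

lemma gen_ideal_uminus: "x \<in> gen_ideal S \<Longrightarrow> - x \<in> gen_ideal S"
  using gen_ideal_mult_left[of x S "-1"] by simp

lemma gen_ideal_diff: "x \<in> gen_ideal S \<Longrightarrow> y \<in> gen_ideal S \<Longrightarrow> x - y \<in> gen_ideal S"
  using gen_ideal_add[of x S "- y"] gen_ideal_uminus[of y S] by simp


section \<open>The enveloping algebra of \<open>sl\<^sub>2\<close>\<close>

datatype sl2_gen = Xp | Xm | Hg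

definition usl2_relators :: "sl2_gen free_alg set" where
  "usl2_relators =
    {commutator (free_gen Hg) (free_gen Xp) - 2 * free_gen Xp,
     commutator (free_gen Hg) (free_gen Xm) + 2 * free_gen Xm,
     commutator (free_gen Xp) (free_gen Xm) - free_gen Hg}"

definition usl2_eq :: "sl2_gen free_alg \<Rightarrow> sl2_gen free_alg \<Rightarrow> bool"
  where "usl2_eq p q \<longleftrightarrow> p - q \<in> gen_ideal usl2_relators"

lemma usl2_eq_refl: "usl2_eq p p"
  by (simp add: usl2_eq_def gen_ideal_0)

lemma equivp_usl2_eq: "equivp usl2_eq"
proof (rule equivpI)
  show "reflp usl2_eq"
    by (simp add: reflp_def usl2_eq_refl)
  show "symp usl2_eq"
    by (rule sympI, unfold usl2_eq_def) (metis gen_ideal_uminus minus_diff_eq)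
  show "transp usl2_eq"
  proof (rule transpI, unfold usl2_eq_def)
    fix x y z :: "sl2_gen free_alg"
    assume "x - y \<in> gen_ideal usl2_relators" "y - z \<in> gen_ideal usl2_relators"
    from gen_ideal_add[OF this] show "x - z \<in> gen_ideal usl2_relators" by simp
  qed
qed

lemma usl2_eq_add:
  assumes "usl2_eq p p'" "usl2_eq q q'"
  shows "usl2_eq (p + q) (p' + q')"
  using gen_ideal_add[OF assms[unfolded usl2_eq_def]]
  by (simp add: usl2_eq_def algebra_simps)

lemma usl2_eq_uminus: "usl2_eq p p' \<Longrightarrow> usl2_eq (- p) (- p')"
  using gen_ideal_uminus[of "p - p'"] by (simp add: usl2_eq_def)

lemma usl2_eq_mult:
  assumes "usl2_eq p p'" "usl2_eq q q'"
  shows "usl2_eq (p * q) (p' * q')"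
proof -
  have "(p - p') * q + p' * (q - q') \<in> gen_ideal usl2_relators"
    using assms unfolding usl2_eq_def
    by (intro gen_ideal_add gen_ideal_mult_left gen_ideal_mult_right)
  moreover have "(p - p') * q + p' * (q - q') = p * q - p' * q'"
    by (simp add: algebra_simps)
  ultimately show ?thesis by (simp add: usl2_eq_def)
qed

quotient_type usl2 = "sl2_gen free_alg" / usl2_eq
  by (rule equivp_usl2_eq)

text \<open>The augmentation (coefficient of the empty word) shows that the quotient is nonzero,
  which the class \<^class>\<open>ring_1\<close> requires.\<close>

lemma lookup_mult_0:
  fixes p q :: "'x free_alg"
  shows "Poly_Mapping.lookup (p * q) 0 = Poly_Mapping.lookup p 0 * Poly_Mapping.lookup q 0"
proof -
  have *: "0 = l + r \<longleftrightarrow> l = 0 \<and> r = 0" for l r :: "'x list"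
    by (auto simp: zero_list_def plus_list_def)
  have "(\<Sum>r. Poly_Mapping.lookup q r when 0 = l + r) = (Poly_Mapping.lookup q 0 when l = 0)" for l
    by (cases "l = 0") (simp_all add: * when_def)
  thus ?thesis
    by (simp add: lookup_mult mult_when)
qed

lemma lookup_free_gen_0: "Poly_Mapping.lookup (free_gen x) 0 = 0"
  by (simp add: free_gen_def lookup_single zero_list_def when_def)

lemma one_notin_usl2_ideal: "1 \<notin> gen_ideal usl2_relators"
proof -
  let ?R = "ring_of_type_algebra :: sl2_gen free_alg ring"
  let ?J = "{p :: sl2_gen free_alg. Poly_Mapping.lookup p 0 = 0}"
  interpret R: ring ?R by (rule ring_ring_of_type_algebra)
  have a_inv: "a_inv ?R x = - x" for x
    by (rule R.minus_equality) (simp_all add: ring_of_type_algebra_def)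
  have "subgroup ?J (add_monoid ?R)"
  proof (rule group.subgroupI[OF R.a_group])
    fix x assume "x \<in> ?J"
    thus "inv\<^bsub>add_monoid ?R\<^esub> x \<in> ?J"
      using a_inv[of x] by (simp add: a_inv_def)
  qed (auto simp: ring_of_type_algebra_def lookup_add intro!: exI[of _ 0])
  hence "additive_subgroup ?J ?R"
    by (rule additive_subgroup.intro)
  hence "ideal ?J ?R"
    by (intro idealI ring_ring_of_type_algebra)
       (auto simp: additive_subgroup_def, auto simp: ring_of_type_algebra_def lookup_mult_0)
  moreover have "usl2_relators \<subseteq> ?J"
    by (auto simp: usl2_relators_def commutator_def lookup_add lookup_minus lookup_mult_0
          lookup_free_gen_0)
  ultimately have "gen_ideal usl2_relators \<subseteq> ?J"
    unfolding gen_ideal_def by (rule R.genideal_minimal)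
  thus ?thesis by (auto simp: lookup_one)
qed

instantiation usl2 :: ring_1
begin
lift_definition zero_usl2 :: usl2 is 0 .
lift_definition one_usl2 :: usl2 is 1 .
lift_definition plus_usl2 :: "usl2 \<Rightarrow> usl2 \<Rightarrow> usl2" is "(+)" by (rule usl2_eq_add)
lift_definition uminus_usl2 :: "usl2 \<Rightarrow> usl2" is uminus by (rule usl2_eq_uminus)
lift_definition times_usl2 :: "usl2 \<Rightarrow> usl2 \<Rightarrow> usl2" is "(*)" by (rule usl2_eq_mult)
definition minus_usl2 :: "usl2 \<Rightarrow> usl2 \<Rightarrow> usl2" where "minus_usl2 x y = x + - y"
instance
proof
  fix a b c :: usl2
  show "a * b * c = a * (b * c)" by transfer (simp add: mult.assoc usl2_eq_refl)
  show "1 * a = a" by transfer (simp add: usl2_eq_refl)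
  show "a * 1 = a" by transfer (simp add: usl2_eq_refl)
  show "a + b + c = a + (b + c)" by transfer (simp add: add.assoc usl2_eq_refl)
  show "a + b = b + a" by transfer (simp add: add.commute usl2_eq_refl)
  show "0 + a = a" by transfer (simp add: usl2_eq_refl)
  show "- a + a = 0" by transfer (simp add: usl2_eq_refl)
  show "a - b = a + - b" by (simp add: minus_usl2_def)
  show "(a + b) * c = a * c + b * c" by transfer (simp add: distrib_right usl2_eq_refl)
  show "a * (b + c) = a * b + a * c" by transfer (simp add: distrib_left usl2_eq_refl)
  show "(0::usl2) \<noteq> 1"
    using gen_ideal_uminus[of "-1" usl2_relators] one_notin_usl2_ideal
    by transfer (auto simp: usl2_eq_def)
qed
end

lift_definition usl2_gen :: "sl2_gen \<Rightarrow> usl2" is free_gen .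

lift_definition usl2_scale :: "complex \<Rightarrow> usl2 \<Rightarrow> usl2" is free_scale
  unfolding free_scale_def by (rule usl2_eq_mult[OF usl2_eq_refl])


section \<open>Formal power series in one and two parameters\<close>

text \<open>\<open>V[[h]]\<close> is \<open>'v fps\<close>. \<open>V[[h,h']]\<close> is \<open>'v fps fps\<close>, read as \<open>V[[h]][[h']]\<close>: the coefficient of
  \<open>h\<^sup>i h'\<^sup>j\<close> in \<open>x\<close> is \<open>x $ j $ i\<close>.\<close>

definition par_h :: "'a::ring_1 fps fps" where "par_h = fps_const fps_X"
definition par_h' :: "'a::ring_1 fps fps" where "par_h' = fps_X"

definition fps_swap :: "'a fps fps \<Rightarrow> 'a fps fps"
  where "fps_swap x = Abs_fps (\<lambda>i. Abs_fps (\<lambda>j. x $ j $ i))"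

definition map_fps :: "('a \<Rightarrow> 'b) \<Rightarrow> 'a fps \<Rightarrow> 'b fps"
  where "map_fps f x = Abs_fps (\<lambda>n. f (x $ n))"

text \<open>Power series extension of a biadditive map; it is used for products and for scalar actions.\<close>

definition fps_bilin :: "('a \<Rightarrow> 'b \<Rightarrow> 'c::comm_monoid_add) \<Rightarrow> 'a fps \<Rightarrow> 'b fps \<Rightarrow> 'c fps"
  where "fps_bilin f x y = Abs_fps (\<lambda>n. \<Sum>i=0..n. f (x $ i) (y $ (n - i)))"

definition adic_closure1 :: "'a fps set \<Rightarrow> 'a fps set"
  where "adic_closure1 S = {x. \<forall>n. \<exists>y\<in>S. \<forall>i<n. x $ i = y $ i}"

definition adic_closure2 :: "'a fps fps set \<Rightarrow> 'a fps fps set"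
  where "adic_closure2 S = {x. \<forall>n. \<exists>y\<in>S. \<forall>i j. i + j < n \<longrightarrow> x $ j $ i = y $ j $ i}"

text \<open>The topological algebras \<open>\<complex>\<langle>X\<rangle>[[h]] / closure(R)\<close> and \<open>\<complex>\<langle>X\<rangle>[[h,h']] / closure(R)\<close>.\<close>

definition top_presented1 :: "'x free_alg fps set \<Rightarrow> 'x free_alg fps set ring"
  where "top_presented1 R = ring_of_type_algebra Quot adic_closure1 (gen_ideal R)"

definition top_presented2 :: "'x free_alg fps fps set \<Rightarrow> 'x free_alg fps fps set ring"
  where "top_presented2 R = ring_of_type_algebra Quot adic_closure2 (gen_ideal R)"

text \<open>In an integral domain, the quotient \<open>p / q\<close> when it exists and \<open>q \<noteq> 0\<close>.\<close>

definition exact_quot :: "'a::idom \<Rightarrow> 'a \<Rightarrow> 'a"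
  where "exact_quot p q = (THE r. r * q = p)"


section \<open>The algebra \<open>U\<^sub>h(sl\<^sub>2)\<close>\<close>

text \<open>The parameter is the variable of \<open>fps\<close>, so the algebra also serves as \<open>U\<^sub>h\<^sub>'(sl\<^sub>2)\<close>.\<close>

definition sinh_hH :: "complex poly fps"
  where "sinh_hH = Abs_fps (\<lambda>n. if odd n then Polynomial.monom (1 / fact n) n else 0)"

definition sinh_h :: "complex poly fps"
  where "sinh_h = Abs_fps (\<lambda>n. if odd n then [:1 / fact n:] else 0)"

definition poly_at_Hg :: "complex poly \<Rightarrow> sl2_gen free_alg"
  where "poly_at_Hg p =
    (\<Sum>k\<le>Polynomial.degree p. free_scale (Polynomial.coeff p k) (free_gen Hg ^ k))"

definition Uh_relators :: "sl2_gen free_alg fps set" where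
  "Uh_relators = (let gen = (\<lambda>x. fps_const (free_gen x)) in
    {commutator (gen Hg) (gen Xp) - 2 * gen Xp,
     commutator (gen Hg) (gen Xm) + 2 * gen Xm,
     commutator (gen Xp) (gen Xm) - map_fps poly_at_Hg (exact_quot sinh_hH sinh_h)})"

definition Uh :: "sl2_gen free_alg fps set ring"
  where "Uh = top_presented1 Uh_relators"


section \<open>The algebra \<open>U\<^sub>h\<^sub>,\<^sub>h\<^sub>'(sl\<^sub>2, g)\<close>\<close>

text \<open>\<open>\<complex>[H, \<surd>C]\<close> is \<open>complex poly poly\<close>; the outer variable is \<open>\<surd>C\<close>, the inner one \<open>H\<close>.\<close>

type_synonym HC_series = "complex poly poly fps fps"

definition cst :: "complex \<Rightarrow> HC_series"
  where "cst c = fps_const (fps_const [:[:c:]:])"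

definition var_H :: HC_series
  where "var_H = fps_const (fps_const [:[:0, 1:]:])"

definition var_sqrtC :: HC_series
  where "var_sqrtC = fps_const (fps_const [:0, 1:])"

text \<open>Exponential of a series \<open>a\<close> with \<open>a $ 0 $ 0 = 0\<close>: the terms \<open>a\<^sup>k / k!\<close> with \<open>k > i + j\<close> do not
  contribute to the coefficient of \<open>h\<^sup>i h'\<^sup>j\<close>.\<close>

definition ser_exp :: "HC_series \<Rightarrow> HC_series"
  where "ser_exp a = Abs_fps (\<lambda>j. Abs_fps (\<lambda>i. \<Sum>k\<le>i + j. (cst (1 / fact k) * a ^ k) $ j $ i))"

definition two_sinh :: "HC_series \<Rightarrow> HC_series"
  where "two_sinh a = ser_exp a - ser_exp (- a)"

definition eps :: "nat \<Rightarrow> complex"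
  where "eps g = exp (\<i> * of_real pi / of_nat g)"

text \<open>\<open>P(u)\<close> for an invertible \<open>u\<close> with inverse \<open>v\<close>.\<close>

definition P_fun :: "nat \<Rightarrow> HC_series \<Rightarrow> HC_series \<Rightarrow> HC_series" where
  "P_fun g u v = cst (1 / 2) * (u ^ (g - 1) + v ^ (g - 1)) *
     (\<Prod>k=1..g-1. (cst (eps g ^ k) * u - cst (inverse (eps g ^ k)) * v) *
                  cst (1 / (eps g ^ k - inverse (eps g ^ k))))"

text \<open>\<open>{x}\<^sub>Q = P(Q\<^sup>x)\<close> with \<open>Q = exp(h)\<close>.\<close>

definition bracket_Q :: "nat \<Rightarrow> HC_series \<Rightarrow> HC_series"
  where "bracket_Q g x = P_fun g (ser_exp (par_h * x)) (ser_exp (- (par_h * x)))"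

text \<open>\<open>H\<^sub>e\<^sup>\<plusminus>\<close>, with the sign \<open>\<plusminus>\<close> given by \<open>\<sigma> = \<plusminus>1\<close>.\<close>

definition H_e :: "complex \<Rightarrow> complex \<Rightarrow> HC_series"
  where "H_e \<sigma> e = cst (1 / 2) * (var_sqrtC + cst e * var_H - cst (\<sigma> * e))"

definition rel_factor :: "nat \<Rightarrow> HC_series \<Rightarrow> HC_series" where
  "rel_factor g x = (let a = par_h + par_h' * bracket_Q g x in
     exact_quot (exact_quot (two_sinh (a * x)) a) (exact_quot (two_sinh a) a))"

definition rel_rhs :: "nat \<Rightarrow> complex \<Rightarrow> HC_series"
  where "rel_rhs g \<sigma> = (\<Prod>e\<in>{1, -1}. rel_factor g (H_e \<sigma> e))"

datatype sl2C_gen = XXp | XXm | HH | CC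

text \<open>Substitution of \<open>H\<close> and \<open>C\<close> for \<open>H\<close> and \<open>(\<surd>C)\<^sup>2\<close> in a polynomial that is even in \<open>\<surd>C\<close>. The order
  of \<open>H\<close> and \<open>C\<close> in the free algebra is immaterial, since \<open>[C,H] = 0\<close> is among the relations.\<close>

definition subst_HC :: "complex poly poly \<Rightarrow> sl2C_gen free_alg" where
  "subst_HC r = (\<Sum>b\<le>Polynomial.degree r. \<Sum>a\<le>Polynomial.degree (Polynomial.coeff r (2 * b)).
     free_scale (Polynomial.coeff (Polynomial.coeff r (2 * b)) a) (free_gen HH ^ a * free_gen CC ^ b))"

definition Uhh'_relators :: "nat \<Rightarrow> sl2C_gen free_alg fps fps set" where
  "Uhh'_relators g =
    (let gen = (\<lambda>x. fps_const (fps_const (free_gen x)));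
         rhs = (\<lambda>\<sigma>. map_fps (map_fps subst_HC) (rel_rhs g \<sigma>)) in
    {commutator (gen CC) (gen XXp),
     commutator (gen CC) (gen XXm),
     commutator (gen CC) (gen HH),
     commutator (gen HH) (gen XXp) - 2 * gen XXp,
     commutator (gen HH) (gen XXm) + 2 * gen XXm,
     gen XXp * gen XXm - rhs 1,
     gen XXm * gen XXp - rhs (-1)})"

definition Uhh' :: "nat \<Rightarrow> sl2C_gen free_alg fps fps set ring"
  where "Uhh' g = top_presented2 (Uhh'_relators g)"


section \<open>Identification of the underlying modules\<close>

text \<open>\<open>\<Sum> f(a,b,c) y\<^sup>a z\<^sup>b x\<^sup>c\<close> for a finitely supported family \<open>f\<close>.\<close>

definition pbw_comb :: "(complex \<Rightarrow> 'a \<Rightarrow> 'a) \<Rightarrow> 'a \<Rightarrow> 'a \<Rightarrow> 'a \<Rightarrow>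
    (nat \<times> nat \<times> nat \<Rightarrow>\<^sub>0 complex) \<Rightarrow> 'a::ring_1" where
  "pbw_comb sc y z x f =
    (\<Sum>(a, b, c)\<in>Poly_Mapping.keys f. sc (Poly_Mapping.lookup f (a, b, c)) (y ^ a * z ^ b * x ^ c))"

definition usl2_pbw :: "(nat \<times> nat \<times> nat \<Rightarrow>\<^sub>0 complex) \<Rightarrow> usl2"
  where "usl2_pbw = pbw_comb usl2_scale (usl2_gen Xm) (usl2_gen Hg) (usl2_gen Xp)"

text \<open>The linear lift of \<open>U(sl\<^sub>2)\<close> to a free algebra which sends the basis element
  \<open>(X\<^sup>-)\<^sup>a H\<^sup>b (X\<^sup>+)\<^sup>c\<close> to the corresponding word in the letters \<open>y\<close>, \<open>z\<close>, \<open>x\<close>.\<close>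

definition pbw_lift :: "'x \<Rightarrow> 'x \<Rightarrow> 'x \<Rightarrow> usl2 \<Rightarrow> 'x free_alg"
  where "pbw_lift y z x u =
    pbw_comb free_scale (free_gen y) (free_gen z) (free_gen x) (inv_into UNIV usl2_pbw u)"

definition ident_Uh :: "usl2 fps \<Rightarrow> sl2_gen free_alg fps set" where
  "ident_Uh u = a_r_coset ring_of_type_algebra (adic_closure1 (gen_ideal Uh_relators))
     (map_fps (pbw_lift Xm Hg Xp) u)"

definition ident_Uhh' :: "nat \<Rightarrow> usl2 fps fps \<Rightarrow> sl2C_gen free_alg fps fps set" where
  "ident_Uhh' g u = a_r_coset ring_of_type_algebra (adic_closure2 (gen_ideal (Uhh'_relators g)))
     (map_fps (map_fps (pbw_lift XXm HH XXp)) u)"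

definition transport_mult :: "('m \<Rightarrow> 'b) \<Rightarrow> 'b ring \<Rightarrow> 'm \<Rightarrow> 'm \<Rightarrow> 'm"
  where "transport_mult \<psi> B x y = inv_into UNIV \<psi> (\<psi> x \<otimes>\<^bsub>B\<^esub> \<psi> y)"

text \<open>The products of \<open>U\<^sub>h(sl\<^sub>2)\<close> and \<open>U\<^sub>h\<^sub>,\<^sub>h\<^sub>'(sl\<^sub>2, g)\<close> seen on \<open>U(sl\<^sub>2)[[h]]\<close> and \<open>U(sl\<^sub>2)[[h,h']]\<close>.\<close>

definition mult_Uh :: "usl2 fps \<Rightarrow> usl2 fps \<Rightarrow> usl2 fps"
  where "mult_Uh = transport_mult ident_Uh Uh"

definition mult_Uhh' :: "nat \<Rightarrow> usl2 fps fps \<Rightarrow> usl2 fps fps \<Rightarrow> usl2 fps fps"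
  where "mult_Uhh' g = transport_mult (ident_Uhh' g) (Uhh' g)"


section \<open>Formal deformations\<close>

definition algebra_structure ::
  "('r \<Rightarrow> 'm \<Rightarrow> 'm) \<Rightarrow> ('m \<Rightarrow> 'm \<Rightarrow> 'm) \<Rightarrow> 'm::ab_group_add \<Rightarrow> bool" where
  "algebra_structure sc mul e \<longleftrightarrow>
    (\<forall>x y z. mul (x + y) z = mul x z + mul y z) \<and>
    (\<forall>x y z. mul x (y + z) = mul x y + mul x z) \<and>
    (\<forall>c x y. mul (sc c x) y = sc c (mul x y)) \<and>
    (\<forall>c x y. mul x (sc c y) = sc c (mul x y)) \<and>
    (\<forall>x y z. mul (mul x y) z = mul x (mul y z)) \<and>
    (\<forall>x. mul e x = x \<and> mul x e = x)"

text \<open>In the next two definitions, \<open>sc\<close> is the action of the power series ring on the module of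
  power series, \<open>ct\<close> is the reduction modulo the parameters and \<open>e\<close> is the unit.\<close>

definition formal_deformation ::
  "('r \<Rightarrow> 'm \<Rightarrow> 'm) \<Rightarrow> ('m \<Rightarrow> 'a) \<Rightarrow> 'm::ab_group_add \<Rightarrow> ('a \<Rightarrow> 'a \<Rightarrow> 'a) \<Rightarrow> ('m \<Rightarrow> 'm \<Rightarrow> 'm) \<Rightarrow> bool"
  where "formal_deformation sc ct e mulA mul \<longleftrightarrow>
    algebra_structure sc mul e \<and> (\<forall>x y. ct (mul x y) = mulA (ct x) (ct y))"

definition equivalent_deformations ::
  "('r \<Rightarrow> 'm \<Rightarrow> 'm) \<Rightarrow> ('m \<Rightarrow> 'a) \<Rightarrow> 'm::ab_group_add \<Rightarrow> ('m \<Rightarrow> 'm \<Rightarrow> 'm) \<Rightarrow> ('m \<Rightarrow> 'm \<Rightarrow> 'm) \<Rightarrow> bool"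
  where "equivalent_deformations sc ct e mul mul' \<longleftrightarrow>
    (\<exists>\<phi>. bij \<phi> \<and>
         (\<forall>x y. \<phi> (x + y) = \<phi> x + \<phi> y) \<and>
         (\<forall>c x. \<phi> (sc c x) = sc c (\<phi> x)) \<and>
         (\<forall>x y. \<phi> (mul x y) = mul' (\<phi> x) (\<phi> y)) \<and>
         \<phi> e = e \<and>
         (\<forall>x. ct (\<phi> x) = ct x))"

text \<open>Trivial formal deformations, along one and two parameters, of an algebra with scalar action
  \<open>sc\<close>, product \<open>mulA\<close> and unit \<open>1\<close>. The constant deformation is the power series extension of \<open>mulA\<close>.\<close>

definition trivial_formal_deformation1 ::
  "('k \<Rightarrow> 'a \<Rightarrow> 'a) \<Rightarrow> ('a \<Rightarrow> 'a \<Rightarrow> 'a) \<Rightarrow> 'a::ab_group_add \<Rightarrow> ('a fps \<Rightarrow> 'a fps \<Rightarrow> 'a fps) \<Rightarrow> bool"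
  where "trivial_formal_deformation1 sc mulA oneA mul \<longleftrightarrow>
    (let sc' = fps_bilin sc; ct = (\<lambda>x. x $ 0); e = fps_const oneA in
      formal_deformation sc' ct e mulA mul \<and>
      equivalent_deformations sc' ct e mul (fps_bilin mulA))"

definition trivial_formal_deformation2 ::
  "('k \<Rightarrow> 'a \<Rightarrow> 'a) \<Rightarrow> ('a \<Rightarrow> 'a \<Rightarrow> 'a) \<Rightarrow> 'a::ab_group_add \<Rightarrow>
     ('a fps fps \<Rightarrow> 'a fps fps \<Rightarrow> 'a fps fps) \<Rightarrow> bool"
  where "trivial_formal_deformation2 sc mulA oneA mul \<longleftrightarrow>
    (let sc' = fps_bilin (fps_bilin sc); ct = (\<lambda>x. x $ 0 $ 0); e = fps_const (fps_const oneA) in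
      formal_deformation sc' ct e mulA mul \<and>
      equivalent_deformations sc' ct e mul (fps_bilin (fps_bilin mulA)))"

end

theory Submission
  imports Defs
begin

text \<open>Both \<open>U(sl\<^sub>2)\<close> and its deformations are generalised Weyl algebras: over the polynomials, or
  series of polynomials, in \<open>H\<close> and a central \<open>C\<close>, with \<open>\<sigma>(H) = H + 2\<close>, they are given by generators
  \<open>X\<^sup>\<plusminus>\<close> and relations \<open>X\<^sup>- r = \<sigma>(r) X\<^sup>-\<close>, \<open>r X\<^sup>+ = X\<^sup>+ \<sigma>(r)\<close>, \<open>X\<^sup>+ X\<^sup>- = f\<close>, \<open>X\<^sup>- X\<^sup>+ = \<sigma>(f)\<close>.
  Such an algebra only depends on \<open>f\<close> up to a unit: if \<open>f = w f\<^sub>0\<close>, then \<open>X\<^sup>- \<mapsto> x\<^sup>-\<close>, \<open>X\<^sup>+ \<mapsto> w x\<^sup>+\<close>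
  turns the relations for \<open>f\<close> into those for \<open>f\<^sub>0\<close>.

  For \<open>U(sl\<^sub>2)\<close> and the Casimir element \<open>C\<close> one has \<open>f\<^sub>0 = x\<^sub>1 x\<^sub>2\<close> with
  \<open>x\<^sub>1, x\<^sub>2 = (\<surd>C \<plusminus> (H - 1)) / 2\<close>. For \<open>U\<^sub>h\<^sub>,\<^sub>h\<^sub>'(sl\<^sub>2, g)\<close> the factor \<open>x\<close> becomes \<open>sinh(a x) / sinh(a)\<close> with
  \<open>a = h + h' {x}\<close>. This is \<open>x\<close> times a quotient of two values of the even series \<open>sinh(b) / b\<close>, so that
  \<open>f = w f\<^sub>0\<close> with \<open>w\<close> equal to \<open>1\<close> modulo the parameters (\<open>rel_rhs_eq\<close>, \<open>rel_unit_0\<close>). The bracket is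
  symmetric, \<open>{- x} = {x}\<close>; hence \<open>w\<close> is even in \<open>\<surd>C\<close> (\<open>rel_unit_even\<close>) and can be evaluated in
  \<open>U(sl\<^sub>2)[[h,h']]\<close>. This gives a homomorphism from \<open>U\<^sub>h\<^sub>,\<^sub>h\<^sub>'(sl\<^sub>2, g)\<close> to the constant deformation
  (\<open>Uhh'_relators_kernel\<close>).

  On the ordered monomials this homomorphism is the identity modulo the parameters, hence bijective after
  extension to power series (\<open>fps_extend2_bij\<close>). So the ordered monomials are topologically independent,
  and they span by successive approximation starting from \<open>U(sl\<^sub>2)\<close> (\<open>Uhh'_span\<close>). This
  shows that the underlying module is as asserted and that the deformation is trivial. For \<open>U(sl\<^sub>2)\<close>
  itself the independence of the ordered monomials comes from the Verma modules (\<open>usl2_pbw_kernel\<close>).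

  At \<open>h' = 0\<close> one has \<open>a = h\<close>, and at \<open>h = 0\<close> one has \<open>a = h'\<close> since \<open>P(1) = 1\<close>. Therefore \<open>w\<close> specialises
  in both cases to the same series in the remaining parameter (\<open>rel_unit_swap_at_0\<close>), and the product
  formula for \<open>sinh\<close> shows that the specialised homomorphism trivialises \<open>U\<^sub>h(sl\<^sub>2)\<close>
  (\<open>rel_rhs_at_0_diff\<close>, \<open>Uh_relators_kernel\<close>). Composing the trivialisation over both parameters with the
  inverse of the specialised one gives an equivalence which is the identity modulo one parameter only
  (\<open>trivial_formal_deformation1_transport\<close>).\<close>

section \<open>Ring homomorphisms and ideals\<close>

definition ring_hom1 :: "('a::ring_1 \<Rightarrow> 'b::ring_1) \<Rightarrow> bool" where
  "ring_hom1 f \<longleftrightarrow> (\<forall>x y. f (x + y) = f x + f y) \<and> (\<forall>x y. f (x * y) = f x * f y) \<and> f 1 = 1"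

lemma ring_hom1I:
  assumes "\<And>x y. f (x + y) = f x + f y" "\<And>x y. f (x * y) = f x * f y" "f 1 = 1"
  shows "ring_hom1 f"
  using assms by (simp add: ring_hom1_def)

lemma ring_hom1_additive: "ring_hom1 f \<Longrightarrow> additive f"
  by (simp add: ring_hom1_def additive_def)

lemma
  assumes "ring_hom1 f"
  shows ring_hom1_add: "f (x + y) = f x + f y"
    and ring_hom1_mult: "f (x * y) = f x * f y"
    and ring_hom1_1: "f 1 = 1"
    and ring_hom1_0: "f 0 = 0"
    and ring_hom1_minus: "f (- x) = - f x"
    and ring_hom1_diff: "f (x - y) = f x - f y"
    and ring_hom1_sum: "f (sum h A) = (\<Sum>a\<in>A. f (h a))"
    and ring_hom1_power: "f (x ^ n) = f x ^ n"
proof -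
  interpret additive f using assms by (rule ring_hom1_additive)
  show "f (x + y) = f x + f y" "f 0 = 0" "f (- x) = - f x" "f (x - y) = f x - f y"
    "f (sum h A) = (\<Sum>a\<in>A. f (h a))"
    by (simp_all add: add zero minus diff sum)
  show m: "f (x * y) = f x * f y" "f 1 = 1" for x y
    using assms by (simp_all add: ring_hom1_def)
  show "f (x ^ n) = f x ^ n"
    by (induction n) (simp_all add: m)
qed

lemmas ring_hom1_simps = ring_hom1_add ring_hom1_mult ring_hom1_1 ring_hom1_0 ring_hom1_minus
  ring_hom1_diff ring_hom1_power

lemma ring_hom1_prod:
  fixes f :: "'a::comm_ring_1 \<Rightarrow> 'b::comm_ring_1"
  assumes "ring_hom1 f"
  shows "f (prod h A) = (\<Prod>a\<in>A. f (h a))"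
  by (induction A rule: infinite_finite_induct) (simp_all add: ring_hom1_simps[OF assms])

lemma ring_hom1_comp: "ring_hom1 f \<Longrightarrow> ring_hom1 g \<Longrightarrow> ring_hom1 (\<lambda>x. f (g x))"
  by (simp add: ring_hom1_def)

lemma ring_hom1_numeral: "ring_hom1 f \<Longrightarrow> f (numeral k) = numeral k"
proof -
  assume f: "ring_hom1 f"
  have "f (of_nat n) = of_nat n" for n
    by (induction n) (simp_all add: ring_hom1_simps[OF f])
  from this[of "numeral k"] show ?thesis by simp
qed

lemma ring_hom1_commutator: "ring_hom1 f \<Longrightarrow> f (commutator x y) = commutator (f x) (f y)"
  by (simp add: commutator_def ring_hom1_simps)

lemma gen_ideal_induct [consumes 1, case_names gen zero add left right]:
  fixes x :: "'a::ring_1"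
  assumes x: "x \<in> gen_ideal S"
    and gen: "\<And>x. x \<in> S \<Longrightarrow> P x" and zero: "P 0"
    and add: "\<And>x y. P x \<Longrightarrow> P y \<Longrightarrow> P (x + y)"
    and left: "\<And>a x. P x \<Longrightarrow> P (a * x)" and right: "\<And>a x. P x \<Longrightarrow> P (x * a)"
  shows "P x"
proof -
  let ?R = "ring_of_type_algebra :: 'a ring"
  interpret R: ring ?R by (rule ring_ring_of_type_algebra)
  have a_inv: "a_inv ?R x = - x" for x
    by (rule R.minus_equality) (simp_all add: ring_of_type_algebra_def)
  have uminus: "P (- x)" if "P x" for x
    using left[of x "- 1"] that by simp
  have "subgroup (Collect P) (add_monoid ?R)"
  proof (rule group.subgroupI[OF R.a_group])
    fix x assume "x \<in> Collect P"
    thus "inv\<^bsub>add_monoid ?R\<^esub> x \<in> Collect P"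
      using a_inv[of x] uminus by (simp add: a_inv_def)
  qed (use zero in \<open>auto simp: ring_of_type_algebra_def add\<close>)
  hence "additive_subgroup (Collect P) ?R"
    by (rule additive_subgroup.intro)
  hence "ideal (Collect P) ?R"
    by (intro idealI ring_ring_of_type_algebra)
       (auto simp: additive_subgroup_def, auto simp: ring_of_type_algebra_def left right)
  moreover have "S \<subseteq> Collect P"
    using gen by auto
  ultimately have "gen_ideal S \<subseteq> Collect P"
    unfolding gen_ideal_def by (rule R.genideal_minimal)
  thus ?thesis using x by auto
qed

lemma gen_ideal_gen: "x \<in> S \<Longrightarrow> (x::'a::ring_1) \<in> gen_ideal S"
  unfolding gen_ideal_def
  using ring.genideal_self[OF ring_ring_of_type_algebra, of S]
  by (auto simp: ring_of_type_algebra_def)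

lemma gen_ideal_sum: "(\<And>a. a \<in> A \<Longrightarrow> h a \<in> gen_ideal S) \<Longrightarrow> sum h A \<in> gen_ideal S"
  by (induction A rule: infinite_finite_induct) (auto intro: gen_ideal_0 gen_ideal_add)

lemma ring_hom1_gen_ideal:
  assumes "ring_hom1 f" "x \<in> gen_ideal S" "\<And>r. r \<in> S \<Longrightarrow> f r \<in> gen_ideal T"
  shows "f x \<in> gen_ideal T"
  using assms(2) by (induction rule: gen_ideal_induct)
    (auto simp: ring_hom1_simps[OF assms(1)] assms(3) 
      intro: gen_ideal_0 gen_ideal_add gen_ideal_mult_left gen_ideal_mult_right)

lemma ring_hom1_kernel:
  assumes "ring_hom1 f" "x \<in> gen_ideal S" "\<And>r. r \<in> S \<Longrightarrow> f r = 0"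
  shows "f x = 0"
  using assms(2) by (induction rule: gen_ideal_induct)
    (auto simp: ring_hom1_simps[OF assms(1)] assms(3))

definition central :: "'a::ring_1 \<Rightarrow> bool" where "central x \<longleftrightarrow> (\<forall>y. x * y = y * x)"

section \<open>Evaluation of the free algebra\<close>

text \<open>A ring homomorphism from \<open>\<complex>\<close> with central image is the same as a \<open>\<complex>\<close>-algebra structure.\<close>

definition alg_unit :: "(complex \<Rightarrow> 'r::ring_1) \<Rightarrow> bool"
  where "alg_unit \<kappa> \<longleftrightarrow> ring_hom1 \<kappa> \<and> (\<forall>c. central (\<kappa> c))"

lemma alg_unitD: "alg_unit \<kappa> \<Longrightarrow> ring_hom1 \<kappa>" "alg_unit \<kappa> \<Longrightarrow> \<kappa> c * x = x * \<kappa> c"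
  by (auto simp: alg_unit_def central_def)

definition free_eval :: "(complex \<Rightarrow> 'r::ring_1) \<Rightarrow> ('x \<Rightarrow> 'r) \<Rightarrow> 'x free_alg \<Rightarrow> 'r" where
  "free_eval \<kappa> e p = (\<Sum>w\<in>Poly_Mapping.keys p. \<kappa> (Poly_Mapping.lookup p w) * prod_list (map e w))"

lemma pm_induct [case_names zero add single]:
  fixes p :: "'a \<Rightarrow>\<^sub>0 'b::comm_monoid_add"
  assumes "P 0" "\<And>p q. P p \<Longrightarrow> P q \<Longrightarrow> P (p + q)" "\<And>k v. P (Poly_Mapping.single k v)"
  shows "P p"
proof (induction p rule: Poly_Mapping.update_induct)
  case const
  show ?case using assms(1) by simp
next
  case (update f a b)
  have "Poly_Mapping.update a b f = f + Poly_Mapping.single a b"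
    using update by (intro poly_mapping_eqI)
      (auto simp: lookup_update lookup_add lookup_single when_def in_keys_iff)
  thus ?case using assms update by simp
qed

context
  fixes \<kappa> :: "complex \<Rightarrow> 'r::ring_1" and e :: "'x \<Rightarrow> 'r"
  assumes \<kappa>: "alg_unit \<kappa>"
begin

private lemma \<kappa>_hom: "ring_hom1 \<kappa>" using \<kappa> by (rule alg_unitD)

lemma free_eval_superset:
  assumes "finite K" "Poly_Mapping.keys p \<subseteq> K"
  shows "free_eval \<kappa> e p = (\<Sum>w\<in>K. \<kappa> (Poly_Mapping.lookup p w) * prod_list (map e w))"
  unfolding free_eval_def using assms
  by (intro sum.mono_neutral_left) (auto simp: in_keys_iff ring_hom1_simps[OF \<kappa>_hom])

lemma free_eval_add: "free_eval \<kappa> e (p + q) = free_eval \<kappa> e p + free_eval \<kappa> e q"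
proof -
  let ?K = "Poly_Mapping.keys p \<union> Poly_Mapping.keys q"
  have "Poly_Mapping.keys (p + q) \<subseteq> ?K" by (rule keys_add)
  thus ?thesis
    by (simp add: free_eval_superset[of ?K] lookup_add ring_hom1_simps[OF \<kappa>_hom]
        distrib_right sum.distrib)
qed

lemma free_eval_single: "free_eval \<kappa> e (Poly_Mapping.single w c) = \<kappa> c * prod_list (map e w)"
  by (cases "c = 0") (simp_all add: free_eval_def ring_hom1_simps[OF \<kappa>_hom])

lemma free_eval_hom: "ring_hom1 (free_eval \<kappa> e)"
proof (rule ring_hom1I)
  show "free_eval \<kappa> e (x + y) = free_eval \<kappa> e x + free_eval \<kappa> e y" for x y
    by (rule free_eval_add)
  have z: "free_eval \<kappa> e 0 = 0"
    by (simp add: free_eval_def)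
  have s: "free_eval \<kappa> e (Poly_Mapping.single v c * q) =
    free_eval \<kappa> e (Poly_Mapping.single v c) * free_eval \<kappa> e q" for v c q
  proof (induction q rule: pm_induct)
    case (single w d)
    have "\<kappa> (c * d) * (prod_list (map e v) * prod_list (map e w)) =
       \<kappa> c * (\<kappa> d * prod_list (map e v)) * prod_list (map e w)"
      by (simp add: ring_hom1_simps[OF \<kappa>_hom] mult.assoc)
    also have "\<kappa> d * prod_list (map e v) = prod_list (map e v) * \<kappa> d"
      by (rule alg_unitD[OF \<kappa>])
    finally show ?case
      by (simp add: mult_single free_eval_single plus_list_def mult.assoc)
  qed (simp_all add: distrib_left free_eval_add z)
  show "free_eval \<kappa> e (p * q) = free_eval \<kappa> e p * free_eval \<kappa> e q" for p q
    by (induction p rule: pm_induct) (simp_all add: s distrib_right free_eval_add z)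
  have "free_eval \<kappa> e (Poly_Mapping.single 0 1) = 1"
    by (simp add: free_eval_single ring_hom1_simps[OF \<kappa>_hom] zero_list_def)
  thus "free_eval \<kappa> e 1 = 1" by simp
qed

lemma free_eval_gen: "free_eval \<kappa> e (free_gen x) = e x"
  by (simp add: free_gen_def free_eval_single ring_hom1_simps[OF \<kappa>_hom])

lemma free_eval_scale: "free_eval \<kappa> e (free_scale c p) = \<kappa> c * free_eval \<kappa> e p"
  by (simp add: free_scale_def ring_hom1_mult[OF free_eval_hom] free_eval_single zero_list_def)

end

lemma free_eval_scalar: "alg_unit \<kappa> \<Longrightarrow> free_eval \<kappa> e (Poly_Mapping.single 0 c) = \<kappa> c"
  by (simp add: free_eval_single zero_list_def)

lemma free_alg_unit: "alg_unit (\<lambda>c. Poly_Mapping.single 0 c :: 'x free_alg)"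
proof -
  have "Poly_Mapping.single 0 c * p = p * Poly_Mapping.single 0 c" for c and p :: "'x free_alg"
    by (induction p rule: pm_induct) (simp_all add: distrib_left distrib_right mult_single mult.commute)
  thus ?thesis
    by (simp add: alg_unit_def ring_hom1_def central_def single_add mult_single)
qed

text \<open>Words are built by prepending letters, as suits spans stable under left multiplication.\<close>

lemma free_alg_induct [case_names add gen_mult scalar]:
  fixes p :: "'x free_alg"
  assumes add: "\<And>p q. P p \<Longrightarrow> P q \<Longrightarrow> P (p + q)"
    and gen: "\<And>x p. P p \<Longrightarrow> P (free_gen x * p)"
    and scalar: "\<And>c. P (Poly_Mapping.single 0 c)"
  shows "P p"
proof (induction p rule: pm_induct)
  case zero
  show ?case using scalar[of 0] by simp
next
  case (single w c)
  show ?case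
  proof (induction w)
    case Nil
    show ?case using scalar[of c] by (simp add: zero_list_def)
  next
    case (Cons x w)
    have "Poly_Mapping.single (x # w) c = free_gen x * Poly_Mapping.single w c"
      by (simp add: free_gen_def mult_single plus_list_def)
    thus ?case using gen[OF Cons] by simp
  qed
qed (use add in auto)

section \<open>The Poincare-Birkhoff-Witt basis\<close>

subsection \<open>Linear combinations of ordered monomials\<close>

context
  fixes \<kappa> :: "complex \<Rightarrow> 'r::ring_1" and y z x :: 'r
  assumes \<kappa>: "alg_unit \<kappa>"
begin

private lemma coeff_hom: "ring_hom1 \<kappa>" using \<kappa> by (rule alg_unitD)

lemma pbw_comb_superset:
  assumes "finite K" "Poly_Mapping.keys f \<subseteq> K"
  shows "pbw_comb (\<lambda>c v. \<kappa> c * v) y z x f =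
    (\<Sum>(a, b, c)\<in>K. \<kappa> (Poly_Mapping.lookup f (a, b, c)) * (y ^ a * z ^ b * x ^ c))"
  unfolding pbw_comb_def using assms
  by (intro sum.mono_neutral_left) (auto simp: in_keys_iff ring_hom1_simps[OF coeff_hom])

lemma pbw_comb_add:
  "pbw_comb (\<lambda>c v. \<kappa> c * v) y z x (f + g) =
    pbw_comb (\<lambda>c v. \<kappa> c * v) y z x f + pbw_comb (\<lambda>c v. \<kappa> c * v) y z x g"
proof -
  let ?K = "Poly_Mapping.keys f \<union> Poly_Mapping.keys g"
  have "Poly_Mapping.keys (f + g) \<subseteq> ?K" by (rule keys_add)
  thus ?thesis
    by (simp add: pbw_comb_superset[of ?K] lookup_add ring_hom1_simps[OF coeff_hom]
        distrib_right sum.distrib case_prod_unfold)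
qed

lemma pbw_comb_additive: "additive (pbw_comb (\<lambda>c v. \<kappa> c * v) y z x)"
  by (simp add: additive_def pbw_comb_add)

lemma pbw_comb_single:
  "pbw_comb (\<lambda>c v. \<kappa> c * v) y z x (Poly_Mapping.single (a, b, c) d) =
    \<kappa> d * (y ^ a * z ^ b * x ^ c)"
  by (cases "d = 0") (simp_all add: pbw_comb_def ring_hom1_simps[OF coeff_hom])

end

lemma free_scale_eq: "free_scale = (\<lambda>c v. Poly_Mapping.single 0 c * v)"
  by (simp add: fun_eq_iff free_scale_def)

text \<open>Ordered monomials in different algebras are compared through the homomorphisms between the algebras.\<close>

lemma ring_hom1_pbw_comb:
  assumes h: "ring_hom1 h" and \<kappa>: "\<And>c. h (\<kappa> c) = \<kappa>' c"
  shows "h (pbw_comb (\<lambda>c v. \<kappa> c * v) y z x f) = pbw_comb (\<lambda>c v. \<kappa>' c * v) (h y) (h z) (h x) f"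
  by (simp add: pbw_comb_def ring_hom1_sum[OF h] ring_hom1_simps[OF h] \<kappa> case_prod_unfold)

subsection \<open>The enveloping algebra as a quotient\<close>

lemma abs_usl2_hom: "ring_hom1 abs_usl2"
  by (rule ring_hom1I) (simp_all add: plus_usl2.abs_eq times_usl2.abs_eq one_usl2.abs_eq)

lemma abs_usl2_surj: "\<exists>p. u = abs_usl2 p"
  by (metis Quotient3_abs_rep Quotient3_usl2)

lemma abs_usl2_eq_iff: "abs_usl2 p = abs_usl2 q \<longleftrightarrow> p - q \<in> gen_ideal usl2_relators"
  by (simp add: usl2.abs_eq_iff usl2_eq_def)

definition usl2_unit :: "complex \<Rightarrow> usl2" where "usl2_unit c = abs_usl2 (Poly_Mapping.single 0 c)"

lemma usl2_unit: "alg_unit usl2_unit"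
proof -
  have "usl2_unit c * u = u * usl2_unit c" for c u
  proof -
    obtain p where "u = abs_usl2 p" using abs_usl2_surj by blast
    thus ?thesis
      by (simp add: usl2_unit_def times_usl2.abs_eq alg_unitD(2)[OF free_alg_unit, of c p])
  qed
  moreover have "ring_hom1 usl2_unit"
    unfolding usl2_unit_def
    by (intro ring_hom1_comp[OF abs_usl2_hom] alg_unitD(1)[OF free_alg_unit])
  ultimately show ?thesis by (auto simp: alg_unit_def central_def)
qed

lemmas usl2_unit_hom = alg_unitD(1)[OF usl2_unit]
lemmas usl2_unit_commute = alg_unitD(2)[OF usl2_unit]

lemma usl2_scale_eq: "usl2_scale = (\<lambda>c u. usl2_unit c * u)"
proof (intro ext)
  fix c u
  obtain p where "u = abs_usl2 p" using abs_usl2_surj by blast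
  thus "usl2_scale c u = usl2_unit c * u"
    by (simp add: usl2_scale.abs_eq usl2_unit_def times_usl2.abs_eq free_scale_def)
qed

abbreviation Ux :: usl2 where "Ux \<equiv> usl2_gen Xp"
abbreviation Uy :: usl2 where "Uy \<equiv> usl2_gen Xm"
abbreviation UH :: usl2 where "UH \<equiv> usl2_gen Hg"

lemma usl2_gen_eq: "usl2_gen v = abs_usl2 (free_gen v)"
  by (simp add: usl2_gen.abs_eq)

lemma usl2_relations:
  "UH * Ux = Ux * UH + 2 * Ux"
  "UH * Uy = Uy * UH - 2 * Uy"
  "Ux * Uy = Uy * Ux + UH"
proof -
  have *: "abs_usl2 r = 0" if "r \<in> usl2_relators" for r
    using gen_ideal_gen[OF that] abs_usl2_eq_iff[of r 0] by (simp add: zero_usl2.abs_eq)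
  note s = usl2_relators_def usl2_gen_eq[symmetric] ring_hom1_simps[OF abs_usl2_hom]
    ring_hom1_numeral[OF abs_usl2_hom] commutator_def
  show "UH * Ux = Ux * UH + 2 * Ux"
    using *[of "commutator (free_gen Hg) (free_gen Xp) - 2 * free_gen Xp"]
    by (simp add: s algebra_simps)
  show "UH * Uy = Uy * UH - 2 * Uy"
    using *[of "commutator (free_gen Hg) (free_gen Xm) + 2 * free_gen Xm"]
    by (simp add: s algebra_simps eq_neg_iff_add_eq_0)
  show "Ux * Uy = Uy * Ux + UH"
    using *[of "commutator (free_gen Xp) (free_gen Xm) - free_gen Hg"]
    by (simp add: s algebra_simps)
qed

subsection \<open>Spanning\<close>

lemma usl2_pbw_eq: "usl2_pbw = pbw_comb (\<lambda>c v. usl2_unit c * v) Uy UH Ux"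
  by (simp add: usl2_pbw_def usl2_scale_eq)

lemma usl2_pbw_additive: "additive usl2_pbw"
  unfolding usl2_pbw_eq by (rule pbw_comb_additive[OF usl2_unit])

lemma usl2_pbw_single: "usl2_pbw (Poly_Mapping.single (a, b, c) d) = usl2_unit d * (Uy ^ a * UH ^ b * Ux ^ c)"
  unfolding usl2_pbw_eq by (rule pbw_comb_single[OF usl2_unit])

text \<open>The span of the ordered monomials is stable under left multiplication by the generators; the
  commutation relations carry a letter past the monomial one factor at a time, so that no closed formula
  for the reordered product is needed.\<close>

lemma usl2_pbw_surj: "surj usl2_pbw"
proof -
  interpret P: additive usl2_pbw by (rule usl2_pbw_additive)
  define S where "S = range usl2_pbw"
  have add: "u + v \<in> S" if "u \<in> S" "v \<in> S" for u v
    using that unfolding S_def by (auto simp: P.add[symmetric])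
  have zero: "0 \<in> S"
    unfolding S_def by (rule range_eqI[of _ _ 0]) (simp add: P.zero)
  have mono: "usl2_unit d * (Uy ^ a * UH ^ b * Ux ^ c) \<in> S" for a b c d
    unfolding S_def usl2_pbw_single[symmetric] by simp
  have S_induct: "Q (usl2_pbw f)"
    if "Q 0" "\<And>u v. Q u \<Longrightarrow> Q v \<Longrightarrow> Q (u + v)"
      "\<And>a b c d. Q (usl2_unit d * (Uy ^ a * UH ^ b * Ux ^ c))" for Q f
  proof (induction f rule: pm_induct)
    case (single k v)
    show ?case using that(3) by (cases k) (simp add: usl2_pbw_single)
  qed (simp_all add: P.add P.zero that(1,2))
  have scale: "usl2_unit d * u \<in> S" if "u \<in> S" for d u
  proof -
    have "usl2_unit d * usl2_pbw f \<in> S" for f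
    proof (rule S_induct[where Q = "\<lambda>u. usl2_unit d * u \<in> S"])
      fix a b c e
      show "usl2_unit d * (usl2_unit e * (Uy ^ a * UH ^ b * Ux ^ c)) \<in> S" using mono[of "d * e" a b c]
        by (simp add: ring_hom1_simps[OF usl2_unit_hom] mult.assoc)
    qed (auto simp: zero distrib_left add)
    thus ?thesis using that by (auto simp: S_def)
  qed
  have mono1: "Uy ^ a * UH ^ b * Ux ^ c \<in> S" for a b c
    using mono[of 1 a b c] by (simp add: ring_hom1_simps[OF usl2_unit_hom])
  have left: "v * u \<in> S" if v: "\<And>a b c. v * (Uy ^ a * UH ^ b * Ux ^ c) \<in> S" and "u \<in> S" for u v
  proof -
    have "v * usl2_pbw f \<in> S" for f
    proof (rule S_induct[where Q = "\<lambda>u. v * u \<in> S"])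
      fix a b c d
      have "v * (usl2_unit d * (Uy ^ a * UH ^ b * Ux ^ c)) =
          usl2_unit d * (v * (Uy ^ a * UH ^ b * Ux ^ c))"
        by (metis mult.assoc usl2_unit_commute)
      thus "v * (usl2_unit d * (Uy ^ a * UH ^ b * Ux ^ c)) \<in> S"
        using scale[OF v[of a b c]] by simp
    qed (auto simp: zero distrib_left add)
    thus ?thesis using that by (auto simp: S_def)
  qed
  have two: "2 * u \<in> S" if "u \<in> S" for u
    using add[OF that that] by (simp add: mult_2)
  have neg: "- u \<in> S" if "u \<in> S" for u
    using scale[OF that, of "- 1"] by (simp add: ring_hom1_simps[OF usl2_unit_hom])
  have diff: "u - v \<in> S" if "u \<in> S" "v \<in> S" for u v
    using add[OF that(1) neg[OF that(2)]] by simp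
  have y: "Uy * u \<in> S" if "u \<in> S" for u
  proof (rule left[OF _ that])
    show "Uy * (Uy ^ a * UH ^ b * Ux ^ c) \<in> S" for a b c
      using mono1[of "Suc a" b c] by (simp add: mult.assoc)
  qed
  have h: "UH * u \<in> S" if "u \<in> S" for u
  proof (rule left[OF _ that])
    show "UH * (Uy ^ a * UH ^ b * Ux ^ c) \<in> S" for a b c
    proof (induction a)
      case 0
      show ?case using mono1[of 0 "Suc b" c] by (simp add: mult.assoc)
    next
      case (Suc a)
      let ?m = "Uy ^ a * UH ^ b * Ux ^ c"
      have "UH * (Uy ^ Suc a * UH ^ b * Ux ^ c) = (UH * Uy) * ?m"
        by (simp add: mult.assoc)
      also have "\<dots> = Uy * (UH * ?m) - 2 * (Uy * ?m)"
        by (simp add: usl2_relations(2) left_diff_distrib mult.assoc)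
      also have "\<dots> \<in> S" by (intro diff y two Suc mono1)
      finally show ?case .
    qed
  qed
  have x: "Ux * u \<in> S" if "u \<in> S" for u
  proof (rule left[OF _ that])
    show "Ux * (Uy ^ a * UH ^ b * Ux ^ c) \<in> S" for a b c
    proof (induction a)
      case 0
      have "Ux * (UH ^ b * Ux ^ c) \<in> S"
      proof (induction b)
        case 0
        show ?case using mono1[of 0 0 "Suc c"] by simp
      next
        case (Suc b)
        let ?m = "UH ^ b * Ux ^ c"
        have "Ux * (UH ^ Suc b * Ux ^ c) = (Ux * UH) * ?m"
          by (simp add: mult.assoc)
        also have "Ux * UH = UH * Ux - 2 * Ux"
          by (simp add: usl2_relations(1))
        also have "(UH * Ux - 2 * Ux) * ?m = UH * (Ux * ?m) - 2 * (Ux * ?m)"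
          by (simp add: left_diff_distrib mult.assoc)
        also have "\<dots> \<in> S" by (intro diff h two Suc)
        finally show ?case .
      qed
      thus ?case by simp
    next
      case (Suc a)
      let ?m = "Uy ^ a * UH ^ b * Ux ^ c"
      have "Ux * (Uy ^ Suc a * UH ^ b * Ux ^ c) = (Ux * Uy) * ?m"
        by (simp add: mult.assoc)
      also have "\<dots> = Uy * (Ux * ?m) + UH * ?m"
        by (simp add: usl2_relations(3) distrib_right mult.assoc)
      also have "\<dots> \<in> S" by (intro add y h Suc mono1)
      finally show ?case .
    qed
  qed
  have gen: "usl2_gen v * u \<in> S" if "u \<in> S" for u v
    using that x y h by (cases v) auto
  have "abs_usl2 p \<in> S" for p
  proof (induction p rule: free_alg_induct)
    case (scalar c)
    show ?case using mono[of c 0 0 0] by (simp add: usl2_unit_def)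
  qed (auto simp: ring_hom1_simps[OF abs_usl2_hom] usl2_gen_eq[symmetric] add gen)
  hence "u \<in> S" for u
    using abs_usl2_surj[of u] by auto
  thus ?thesis by (auto simp: S_def)
qed

subsection \<open>Linear independence\<close>

text \<open>The linear operators on sequences, on which the Verma modules are realised.\<close>

typedef seq_op = "{T :: (nat \<Rightarrow> complex) \<Rightarrow> nat \<Rightarrow> complex.
    (\<forall>u v. T (\<lambda>k. u k + v k) = (\<lambda>k. T u k + T v k)) \<and> (\<forall>c v. T (\<lambda>k. c * v k) = (\<lambda>k. c * T v k))}"
  by (rule exI[of _ "\<lambda>v. v"]) simp

setup_lifting type_definition_seq_op

instantiation seq_op :: ring_1
begin
lift_definition zero_seq_op :: seq_op is "\<lambda>v k. 0" by simp
lift_definition one_seq_op :: seq_op is "\<lambda>v. v" by simp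
lift_definition plus_seq_op :: "seq_op \<Rightarrow> seq_op \<Rightarrow> seq_op" is "\<lambda>S T v k. S v k + T v k"
  by (simp add: fun_eq_iff algebra_simps)
lift_definition minus_seq_op :: "seq_op \<Rightarrow> seq_op \<Rightarrow> seq_op" is "\<lambda>S T v k. S v k - T v k"
  by (simp add: fun_eq_iff algebra_simps)
lift_definition uminus_seq_op :: "seq_op \<Rightarrow> seq_op" is "\<lambda>T v k. - T v k"
  by (simp add: fun_eq_iff algebra_simps)
lift_definition times_seq_op :: "seq_op \<Rightarrow> seq_op \<Rightarrow> seq_op" is "\<lambda>S T v. S (T v)"
  by simp
instance
proof
  fix a b c :: seq_op
  show "a * b * c = a * (b * c)" by transfer simp
  show "1 * a = a" by transfer simp
  show "a * 1 = a" by transfer simp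
  show "a + b + c = a + (b + c)" by transfer (simp add: add.assoc)
  show "a + b = b + a" by transfer (simp add: add.commute)
  show "0 + a = a" by transfer simp
  show "- a + a = 0" by transfer simp
  show "a - b = a + - b" by transfer simp
  show "(a + b) * c = a * c + b * c" by transfer simp
  show "a * (b + c) = a * b + a * c" by transfer simp
  show "(0::seq_op) \<noteq> 1" by transfer (metis zero_neq_one)
qed
end

lift_definition seq_op_unit :: "complex \<Rightarrow> seq_op" is "\<lambda>c v k. c * v k"
  by (simp add: fun_eq_iff algebra_simps)

lemma seq_op_unit: "alg_unit seq_op_unit"
  unfolding alg_unit_def ring_hom1_def central_def
  by (intro conjI allI; transfer) (simp_all add: fun_eq_iff algebra_simps)

text \<open>The Verma module of highest weight \<open>l\<close>, with basis \<open>v\<^sub>k = y\<^sup>k v\<^sub>0\<close>.\<close>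

lift_definition verma_y :: seq_op is "\<lambda>v k. case k of 0 \<Rightarrow> 0 | Suc j \<Rightarrow> v j"
  by (auto simp: fun_eq_iff split: nat.split)
lift_definition verma_h :: "complex \<Rightarrow> seq_op" is "\<lambda>l v k. (l - 2 * of_nat k) * v k"
  by (auto simp: fun_eq_iff algebra_simps)
lift_definition verma_x :: "complex \<Rightarrow> seq_op" is "\<lambda>l v k. of_nat (Suc k) * (l - of_nat k) * v (Suc k)"
  by (auto simp: fun_eq_iff algebra_simps)

definition verma :: "complex \<Rightarrow> sl2_gen \<Rightarrow> seq_op" where
  "verma l v = (case v of Xp \<Rightarrow> verma_x l | Xm \<Rightarrow> verma_y | Hg \<Rightarrow> verma_h l)"

lemma two_seq_op: "(2::seq_op) = seq_op_unit 2"
  using ring_hom1_numeral[OF alg_unitD(1)[OF seq_op_unit]] by metis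

lemma verma_relations:
  "commutator (verma_h l) (verma_x l) - 2 * verma_x l = 0"
  "commutator (verma_h l) verma_y + 2 * verma_y = 0"
  "commutator (verma_x l) verma_y - verma_h l = 0"
  unfolding commutator_def two_seq_op
  by (transfer, force simp: fun_eq_iff algebra_simps split: nat.split)+

lift_definition seq_op_app :: "seq_op \<Rightarrow> (nat \<Rightarrow> complex) \<Rightarrow> nat \<Rightarrow> complex" is "\<lambda>T. T" .

lemma seq_op_app_mult: "seq_op_app (S * T) v = seq_op_app S (seq_op_app T v)"
  by transfer simp
lemma seq_op_app_one: "seq_op_app 1 v = v"
  by transfer simp
lemma seq_op_app_unit: "seq_op_app (seq_op_unit c) v = (\<lambda>k. c * v k)"
  by transfer simp
lemma seq_op_app_scaled: "seq_op_app S (\<lambda>k. c * v k) = (\<lambda>k. c * seq_op_app S v k)"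
  by transfer simp
lemma seq_op_app_sum: "seq_op_app (sum T A) v k = (\<Sum>a\<in>A. seq_op_app (T a) v k)"
proof -
  have "seq_op_app 0 v k = 0" "seq_op_app (S + T) v k = seq_op_app S v k + seq_op_app T v k" for S T
    by (transfer, simp)+
  thus ?thesis by (induction A rule: infinite_finite_induct) simp_all
qed

abbreviation (input) basis_vec :: "nat \<Rightarrow> nat \<Rightarrow> complex" where
  "basis_vec n \<equiv> (\<lambda>k. if k = n then 1 else 0)"

lemma verma_y_basis: "seq_op_app verma_y (basis_vec n) = basis_vec (Suc n)"
  by transfer (auto simp: fun_eq_iff split: nat.split)

lemma verma_y_power: "seq_op_app (verma_y ^ a) (basis_vec 0) = basis_vec a"
  by (induction a) (simp_all add: seq_op_app_one seq_op_app_mult verma_y_basis)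

lemma verma_h_power: "seq_op_app (verma_h l ^ b) (basis_vec 0) = (\<lambda>k. l ^ b * basis_vec 0 k)"
proof -
  have "seq_op_app (verma_h l) (basis_vec 0) = (\<lambda>k. l * basis_vec 0 k)"
    by transfer (auto simp: fun_eq_iff)
  hence *: "seq_op_app (verma_h l) (\<lambda>k. c * basis_vec 0 k) = (\<lambda>k. c * (l * basis_vec 0 k))" for c
    by (subst seq_op_app_scaled) simp
  show ?thesis
    by (induction b) (simp_all only: power_0 power_Suc seq_op_app_one seq_op_app_mult * mult.left_commute mult_1 mult.assoc)
qed

lemma verma_x_power:
  "seq_op_app (verma_x l ^ c) (basis_vec n) = (\<lambda>k. if k + c = n then
     (\<Prod>i<c. of_nat (n - i) * (l - of_nat n + 1 + of_nat i)) else 0)"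
proof (induction c)
  case 0
  show ?case by (simp add: seq_op_app_one fun_eq_iff)
next
  case (Suc c)
  have "seq_op_app (verma_x l) v = (\<lambda>k. of_nat (Suc k) * (l - of_nat k) * v (Suc k))" for v
    by transfer simp
  thus ?case
    unfolding power_Suc seq_op_app_mult Suc by (auto simp: of_nat_diff mult.commute fun_eq_iff)
qed

text \<open>In a vanishing combination, choose a monomial with the least power \<open>n\<close> of \<open>x\<close> and let the
  combination act on the vector \<open>v\<^sub>n\<close> of the Verma module of highest weight \<open>l\<close>. Higher powers of \<open>x\<close> kill
  \<open>v\<^sub>n\<close>, while \<open>x\<^sup>n\<close> maps it to a multiple of \<open>v\<^sub>0\<close> which is nonzero unless \<open>l\<close> is a natural number. The
  coordinate at \<open>v\<^sub>a\<close> is then, up to a nonzero factor, a polynomial in \<open>l\<close> whose coefficients are those of \<open>y\<^sup>a h\<^sup>b x\<^sup>n\<close>, and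
  it has infinitely many roots.\<close>

lemma usl2_pbw_kernel:
  assumes f0: "usl2_pbw f = 0"
  shows "f = 0"
proof (rule ccontr)
  assume "f \<noteq> 0"
  define K where "K = Poly_Mapping.keys f"
  have K: "finite K" "K \<noteq> {}"
    using \<open>f \<noteq> 0\<close> by (simp_all add: K_def)
  define n where "n = Min ((\<lambda>(a, b, c). c) ` K)"
  have "n \<in> (\<lambda>(a, b, c). c) ` K"
    unfolding n_def using K by (intro Min_in) auto
  then obtain a b where ab: "(a, b, n) \<in> K" by auto
  have n_le: "n \<le> c'" if "(a', b', c') \<in> K" for a' b' c'
    unfolding n_def using K that by (intro Min_le) force+
  let ?F = "pbw_comb free_scale (free_gen Xm) (free_gen Hg) (free_gen Xp) f"
  define p where "p = (\<Sum>(a', b', c')\<in>K. if a' = a \<and> c' = n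
     then Polynomial.monom (Poly_Mapping.lookup f (a', b', c')) b' else 0)"
  have "?F \<in> gen_ideal usl2_relators"
  proof -
    have "abs_usl2 ?F = usl2_pbw f"
      unfolding free_scale_eq usl2_pbw_eq
      by (subst ring_hom1_pbw_comb[OF abs_usl2_hom])
        (simp_all add: usl2_unit_def[symmetric] usl2_gen_eq[symmetric])
    thus ?thesis using f0 abs_usl2_eq_iff[of ?F 0] by (simp add: zero_usl2.abs_eq)
  qed
  hence "free_eval seq_op_unit (verma l) ?F = 0" for l
    by (rule ring_hom1_kernel[OF free_eval_hom[OF seq_op_unit]])
      (auto simp: usl2_relators_def ring_hom1_simps[OF free_eval_hom[OF seq_op_unit]]
        ring_hom1_numeral[OF free_eval_hom[OF seq_op_unit]]
        ring_hom1_commutator[OF free_eval_hom[OF seq_op_unit]] free_eval_gen[OF seq_op_unit]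
        verma_relations verma_def)
  moreover have "free_eval seq_op_unit (verma l) ?F =
      pbw_comb (\<lambda>c v. seq_op_unit c * v) verma_y (verma_h l) (verma_x l) f" for l
    unfolding free_scale_eq
    by (subst ring_hom1_pbw_comb[OF free_eval_hom[OF seq_op_unit]])
      (simp_all add: free_eval_gen[OF seq_op_unit] free_eval_single[OF seq_op_unit] verma_def zero_list_def)
  ultimately have op0: "pbw_comb (\<lambda>c v. seq_op_unit c * v) verma_y (verma_h l) (verma_x l) f = 0" for l
    by metis
  have root: "poly p l = 0" if l: "\<And>i. l \<noteq> of_nat i" for l
  proof -
    define \<gamma> where "\<gamma> = (\<Prod>i<n. of_nat (n - i) * (l - of_nat n + 1 + of_nat i))"
    have "\<gamma> \<noteq> 0"
    proof -
      have "l - of_nat n + 1 + of_nat i \<noteq> 0" if "i < n" for i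
      proof
        assume "l - of_nat n + 1 + of_nat i = 0"
        hence "l = of_nat n - of_nat (Suc i)" by (simp add: algebra_simps)
        also have "\<dots> = of_nat (n - Suc i)" using that by (subst of_nat_diff) auto
        finally show False using l by blast
      qed
      thus ?thesis by (auto simp: \<gamma>_def)
    qed
    have app_term: "seq_op_app (seq_op_unit d * (verma_y ^ a' * verma_h l ^ b' * verma_x l ^ c')) (basis_vec n) a
       = (if a' = a \<and> c' = n then \<gamma> * (d * l ^ b') else 0)" if "n \<le> c'" for a' b' c' d
    proof (cases "c' = n")
      case True
      have "seq_op_app (verma_x l ^ n) (basis_vec n) = (\<lambda>k. \<gamma> * basis_vec 0 k)"
        by (auto simp: verma_x_power \<gamma>_def fun_eq_iff)
      thus ?thesis using True
        by (simp add: seq_op_app_mult seq_op_app_unit seq_op_app_scaled verma_h_power verma_y_power)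
    next
      case False
      have "seq_op_app (verma_x l ^ c') (basis_vec n) = (\<lambda>k. 0 * basis_vec 0 k)"
        using False that by (auto simp: verma_x_power fun_eq_iff)
      thus ?thesis using False
        by (simp only: seq_op_app_mult seq_op_app_unit seq_op_app_scaled) simp
    qed
    have "0 = seq_op_app (pbw_comb (\<lambda>c v. seq_op_unit c * v) verma_y (verma_h l) (verma_x l) f) (basis_vec n) a"
      unfolding op0 by transfer simp
    also have "\<dots> = (\<Sum>(a', b', c')\<in>K. if a' = a \<and> c' = n
        then \<gamma> * (Poly_Mapping.lookup f (a', b', c') * l ^ b') else 0)"
      unfolding pbw_comb_def seq_op_app_sum K_def[symmetric]
      using n_le by (intro sum.cong) (auto simp: app_term)
    also have "\<dots> = \<gamma> * poly p l"
      unfolding p_def poly_sum sum_distrib_left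
      by (intro sum.cong) (auto simp: poly_monom)
    finally show ?thesis using \<open>\<gamma> \<noteq> 0\<close> by simp
  qed
  have "p = 0"
  proof (rule ccontr)
    assume "p \<noteq> 0"
    hence "finite {l. poly p l = 0}" by (rule poly_roots_finite)
    \<comment> \<open>negative integers avoid the exceptional highest weights\<close>
    moreover have "(\<lambda>k::nat. - 1 - of_nat k) ` UNIV \<subseteq> {l. poly p l = 0}"
    proof clarify
      fix k
      have "- 1 - of_nat k \<noteq> (of_nat i :: complex)" for i
      proof
        assume "- 1 - of_nat k = (of_nat i :: complex)"
        hence "of_nat (i + k) = (- 1 :: complex)"
          by (simp add: algebra_simps)
        hence "of_nat (i + k + 1) = (0 :: complex)" by simp
        thus False by (simp only: of_nat_eq_0_iff)
      qed
      thus "poly p (- 1 - of_nat k) = 0" by (rule root)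
    qed
    moreover have "infinite (range (\<lambda>k::nat. - 1 - of_nat k :: complex))"
      by (rule range_inj_infinite) (simp add: inj_def)
    ultimately show False using finite_subset by blast
  qed
  moreover have "Polynomial.coeff p b = Poly_Mapping.lookup f (a, b, n)"
  proof -
    have "Polynomial.coeff p b = (\<Sum>t\<in>K. if t = (a, b, n) then Poly_Mapping.lookup f t else 0)"
      unfolding p_def coeff_sum by (intro sum.cong) (auto simp: coeff_monom split: if_splits)
    thus ?thesis using ab K by simp
  qed
  ultimately show False using ab by (simp add: K_def in_keys_iff)
qed

theorem usl2_pbw_bij: "bij usl2_pbw"
proof -
  interpret P: additive usl2_pbw by (rule usl2_pbw_additive)
  have "inj usl2_pbw"
    by (rule injI) (metis P.diff eq_iff_diff_eq_0 usl2_pbw_kernel)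
  thus ?thesis using usl2_pbw_surj by (simp add: bij_def)
qed

section \<open>Power series extensions of homomorphisms\<close>

lemma map_fps_nth [simp]: "map_fps f x $ n = f (x $ n)"
  by (simp add: map_fps_def)

lemma fps_swap_nth [simp]: "fps_swap x $ i $ j = x $ j $ i"
  by (simp add: fps_swap_def)

lemma fps_swap_swap [simp]: "fps_swap (fps_swap x) = x"
  by (simp add: fps_eq_iff)

lemma fps2_eqI: "(\<And>i j. x $ j $ i = y $ j $ i) \<Longrightarrow> x = y"
  by (simp add: fps_eq_iff)

lemma fps2_mult_nth:
  fixes x y :: "'a::ring_1 fps fps"
  shows "(x * y) $ j $ i = (\<Sum>q\<le>j. \<Sum>p\<le>i. x $ q $ p * y $ (j - q) $ (i - p))"
  by (simp add: fps_mult_nth fps_sum_nth atMost_atLeast0)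

lemma map_fps_additive: "additive f \<Longrightarrow> additive (map_fps f)"
  by (simp add: additive_def fps_eq_iff)

lemma map_fps_hom:
  assumes "ring_hom1 f"
  shows "ring_hom1 (map_fps f)"
  by (rule ring_hom1I)
    (auto simp: fps_eq_iff ring_hom1_simps[OF assms] ring_hom1_sum[OF assms] fps_mult_nth)

lemma fps_nth_0_hom: "ring_hom1 (\<lambda>x :: 'a::ring_1 fps. x $ 0)"
  by (rule ring_hom1I) simp_all

lemma fps_const_hom: "ring_hom1 (fps_const :: 'a::ring_1 \<Rightarrow> _)"
  by (rule ring_hom1I) simp_all

lemma fps_swap_hom: "ring_hom1 (fps_swap :: 'a::ring_1 fps fps \<Rightarrow> _)"
proof (rule ring_hom1I)
  show "fps_swap (x * y) = fps_swap x * fps_swap y" for x y :: "'a fps fps"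
    by (rule fps2_eqI) (simp add: fps2_mult_nth, rule sum.swap)
  show "fps_swap (1 :: 'a fps fps) = 1"
    by (rule fps2_eqI) simp
qed (simp add: fps_eq_iff)

text \<open>Setting both variables of a series in two variables equal.\<close>

definition fps_diag :: "'a::ring_1 fps fps \<Rightarrow> 'a fps" where
  "fps_diag z = Abs_fps (\<lambda>n. \<Sum>k\<le>n. z $ k $ (n - k))"

lemma fps_diag_hom: "ring_hom1 (fps_diag :: 'a::ring_1 fps fps \<Rightarrow> _)"
proof (rule ring_hom1I)
  show "fps_diag (x + y) = fps_diag x + fps_diag y" for x y :: "'a fps fps"
    by (simp add: fps_diag_def fps_eq_iff sum.distrib)
  show "fps_diag (1 :: 'a fps fps) = 1"
  proof (rule fps_ext)
    fix n
    have "(\<Sum>k\<le>n. (1 :: 'a fps fps) $ k $ (n - k)) = (\<Sum>k\<in>{0}. (1 :: 'a fps fps) $ k $ (n - k))"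
      by (rule sum.mono_neutral_right) auto
    thus "fps_diag (1 :: 'a fps fps) $ n = 1 $ n"
      by (simp add: fps_diag_def)
  qed
  show "fps_diag (z * w) = fps_diag z * fps_diag w" for z w :: "'a fps fps"
  proof (rule fps_ext)
    fix n
    have "fps_diag (z * w) $ n =
        (\<Sum>k\<le>n. \<Sum>a\<le>k. \<Sum>b\<le>n - k. z $ a $ b * w $ (k - a) $ (n - k - b))"
      by (simp add: fps_diag_def fps2_mult_nth)
    also have "\<dots> = (\<Sum>(k, a, b)\<in>(SIGMA k:{..n}. {..k} \<times> {..n - k}).
        z $ a $ b * w $ (k - a) $ (n - k - b))"
      by (simp add: sum.Sigma sum.cartesian_product)
    \<comment> \<open>both sides are sums over the decompositions of \<open>n\<close> into four exponents\<close>
    also have "\<dots> = (\<Sum>(m, a, p)\<in>(SIGMA m:{..n}. {..m} \<times> {..n - m}).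
        z $ a $ (m - a) * w $ p $ (n - m - p))"
      by (rule sum.reindex_bij_witness[where i = "\<lambda>(m, a, p). (a + p, a, m - a)"
            and j = "\<lambda>(k, a, b). (a + b, a, k - a)"])
        (auto simp: diff_right_commute add.commute)
    also have "\<dots> = (\<Sum>m\<le>n. (\<Sum>a\<le>m. z $ a $ (m - a)) * (\<Sum>p\<le>n - m. w $ p $ (n - m - p)))"
      by (simp add: sum.Sigma sum.cartesian_product sum_product)
    also have "\<dots> = (fps_diag z * fps_diag w) $ n"
      by (simp add: fps_diag_def fps_mult_nth atMost_atLeast0)
    finally show "fps_diag (z * w) $ n = (fps_diag z * fps_diag w) $ n" .
  qed
qed

text \<open>The extension of a map on \<open>A\<close>, with values in power series, to \<open>A[[h]]\<close> and \<open>A[[h,h']]\<close> which is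
  continuous and linear in the parameters. Written as coefficientwise application followed by
  identification of the two copies of each parameter, it is visibly multiplicative when \<open>\<theta>\<close> is.\<close>

definition fps_extend1 :: "('a \<Rightarrow> 'b::ring_1 fps) \<Rightarrow> 'a fps \<Rightarrow> 'b fps" where
  "fps_extend1 \<theta> x = fps_diag (map_fps \<theta> x)"

definition fps_extend2 :: "('a \<Rightarrow> 'b::ring_1 fps fps) \<Rightarrow> 'a fps fps \<Rightarrow> 'b fps fps" where
  "fps_extend2 \<theta> = fps_extend1 (\<lambda>x. fps_swap (fps_extend1 (\<lambda>a. fps_swap (\<theta> a)) x))"

lemma fps_extend1_nth: "fps_extend1 \<theta> x $ n = (\<Sum>k\<le>n. \<theta> (x $ k) $ (n - k))"
  by (simp add: fps_extend1_def fps_diag_def)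

lemma fps_extend2_nth:
  "fps_extend2 \<theta> x $ j $ i = (\<Sum>q\<le>j. \<Sum>p\<le>i. \<theta> (x $ q $ p) $ (j - q) $ (i - p))"
  by (simp add: fps_extend2_def fps_extend1_nth fps_sum_nth)

lemma fps_extend1_hom: "ring_hom1 \<theta> \<Longrightarrow> ring_hom1 (fps_extend1 \<theta>)"
  unfolding fps_extend1_def by (intro ring_hom1_comp[OF fps_diag_hom] map_fps_hom)

lemma fps_extend2_hom: "ring_hom1 \<theta> \<Longrightarrow> ring_hom1 (fps_extend2 \<theta>)"
proof -
  assume "ring_hom1 \<theta>"
  hence "ring_hom1 (\<lambda>a. fps_swap (\<theta> a))"
    by (rule ring_hom1_comp[OF fps_swap_hom])
  hence "ring_hom1 (\<lambda>x. fps_swap (fps_extend1 (\<lambda>a. fps_swap (\<theta> a)) x))"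
    by (rule ring_hom1_comp[OF fps_swap_hom fps_extend1_hom])
  thus ?thesis
    unfolding fps_extend2_def by (rule fps_extend1_hom)
qed

lemma fps_extend1_additive: "additive \<theta> \<Longrightarrow> additive (fps_extend1 \<theta>)"
  by (simp add: additive_def fps_eq_iff fps_extend1_nth sum.distrib)

lemma fps_extend2_additive: "additive \<theta> \<Longrightarrow> additive (fps_extend2 \<theta>)"
  by (simp add: additive_def fps_eq_iff fps_extend2_nth sum.distrib)

lemma fps_extend1_const:
  assumes "additive \<theta>"
  shows "fps_extend1 \<theta> (fps_const a) = \<theta> a"
proof (rule fps_ext)
  fix n
  have "fps_extend1 \<theta> (fps_const a) $ n = (\<Sum>k\<in>{0}. \<theta> (fps_const a $ k) $ (n - k))"
    unfolding fps_extend1_nth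
    by (rule sum.mono_neutral_right) (auto simp: additive.zero[OF assms])
  thus "fps_extend1 \<theta> (fps_const a) $ n = \<theta> a $ n" by simp
qed

lemma fps_extend2_const:
  assumes "additive \<theta>"
  shows "fps_extend2 \<theta> (fps_const (fps_const a)) = \<theta> a"
proof -
  have "additive (\<lambda>a. fps_swap (\<theta> a))"
    using assms by (simp add: additive_def ring_hom1_simps[OF fps_swap_hom])
  moreover from this have "additive (\<lambda>x. fps_swap (fps_extend1 (\<lambda>a. fps_swap (\<theta> a)) x))"
    by (simp add: additive_def ring_hom1_simps[OF fps_swap_hom] additive.add[OF fps_extend1_additive])
  ultimately show ?thesis
    by (simp add: fps_extend2_def fps_extend1_const)
qed

lemma fps_extend2_at_0: "fps_extend2 \<theta> x $ 0 = fps_extend1 (\<lambda>a. \<theta> a $ 0) (x $ 0)"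
  by (simp add: fps_eq_iff fps_extend2_nth fps_extend1_nth)

lemma fps_extend2_swap: "fps_swap (fps_extend2 \<theta> x) = fps_extend2 (\<lambda>a. fps_swap (\<theta> a)) (fps_swap x)"
  by (rule fps2_eqI) (simp add: fps_extend2_nth, rule sum.swap)

section \<open>Adic filtrations and successive approximation\<close>

definition fil1 :: "nat \<Rightarrow> 'a::zero fps set" where "fil1 n = {x. \<forall>i<n. x $ i = 0}"

definition fil2 :: "nat \<Rightarrow> 'a::zero fps fps set" where "fil2 n = {x. \<forall>i j. i + j < n \<longrightarrow> x $ j $ i = 0}"

lemma adic_closure1_iff: "x \<in> adic_closure1 S \<longleftrightarrow> (\<forall>n. \<exists>y\<in>S. x - y \<in> fil1 n)"
  for x :: "'a::ring_1 fps"
  by (simp add: adic_closure1_def fil1_def)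

lemma adic_closure2_iff: "x \<in> adic_closure2 S \<longleftrightarrow> (\<forall>n. \<exists>y\<in>S. x - y \<in> fil2 n)"
  for x :: "'a::ring_1 fps fps"
  by (simp add: adic_closure2_def fil2_def)

lemma fil1_add: "x \<in> fil1 n \<Longrightarrow> y \<in> fil1 n \<Longrightarrow> x + y \<in> fil1 n" for x :: "'a::ring_1 fps"
  by (simp add: fil1_def)

lemma fil2_add: "x \<in> fil2 n \<Longrightarrow> y \<in> fil2 n \<Longrightarrow> x + y \<in> fil2 n" for x :: "'a::ring_1 fps fps"
  by (simp add: fil2_def)

lemma fil1_mult: "x \<in> fil1 m \<Longrightarrow> y \<in> fil1 n \<Longrightarrow> x * y \<in> fil1 (m + n)" for x :: "'a::ring_1 fps"
proof -
  assume *: "x \<in> fil1 m" "y \<in> fil1 n"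
  have "x $ p * y $ (i - p) = 0" if "i < m + n" "p \<le> i" for p i
  proof (cases "p < m")
    case False
    hence "i - p < n" using that by auto
    thus ?thesis using * by (simp add: fil1_def)
  qed (use * in \<open>simp add: fil1_def\<close>)
  thus ?thesis by (auto simp: fil1_def fps_mult_nth)
qed

lemma fil2_mult: "x \<in> fil2 m \<Longrightarrow> y \<in> fil2 n \<Longrightarrow> x * y \<in> fil2 (m + n)" for x :: "'a::ring_1 fps fps"
proof -
  assume *: "x \<in> fil2 m" "y \<in> fil2 n"
  have "x $ q $ p * y $ (j - q) $ (i - p) = 0" if "i + j < m + n" "p \<le> i" "q \<le> j" for p q i j
  proof (cases "p + q < m")
    case False
    hence "i - p + (j - q) < n" using that by auto
    thus ?thesis using * by (simp add: fil2_def)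
  qed (use * in \<open>simp add: fil2_def\<close>)
  thus ?thesis by (auto simp: fil2_def fps2_mult_nth)
qed

lemma fil1_0: "x \<in> fil1 0" and fil2_0: "y \<in> fil2 0"
  by (simp_all add: fil1_def fil2_def)

lemma fil1_separated: "(\<And>n. x \<in> fil1 n) \<Longrightarrow> x = 0"
  by (force simp: fil1_def fps_eq_iff)

lemma fil2_separated: "(\<And>n. x \<in> fil2 n) \<Longrightarrow> x = 0"
  by (force simp: fil2_def fps_eq_iff)

lemma fps_extend1_fil: "additive \<theta> \<Longrightarrow> x \<in> fil1 n \<Longrightarrow> fps_extend1 \<theta> x \<in> fil1 n"
  by (auto simp: fil1_def fps_extend1_nth additive.zero)

lemma fps_extend2_fil: "additive \<theta> \<Longrightarrow> x \<in> fil2 n \<Longrightarrow> fps_extend2 \<theta> x \<in> fil2 n"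
  by (auto simp: fil2_def fps_extend2_nth additive.zero)

lemma fil1_complete:
  fixes u :: "nat \<Rightarrow> 'a::ring_1 fps"
  assumes "\<And>k. u k \<in> fil1 k"
  shows "\<exists>s. \<forall>n. s - (\<Sum>k<n. u k) \<in> fil1 n"
proof (intro exI allI)
  fix n
  have "(\<Sum>k<n. u k $ i) = (\<Sum>k\<le>i. u k $ i)" if "i < n" for i
    using that assms by (intro sum.mono_neutral_right) (auto simp: fil1_def)
  thus "Abs_fps (\<lambda>i. \<Sum>k\<le>i. u k $ i) - (\<Sum>k<n. u k) \<in> fil1 n"
    by (simp add: fil1_def fps_sum_nth)
qed

lemma fil2_complete:
  fixes u :: "nat \<Rightarrow> 'a::ring_1 fps fps"
  assumes "\<And>k. u k \<in> fil2 k"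
  shows "\<exists>s. \<forall>n. s - (\<Sum>k<n. u k) \<in> fil2 n"
proof (intro exI allI)
  fix n
  have "(\<Sum>k<n. u k $ j $ i) = (\<Sum>k\<le>i + j. u k $ j $ i)" if "i + j < n" for i j
    using that assms by (intro sum.mono_neutral_right) (auto simp: fil2_def)
  thus "Abs_fps (\<lambda>j. Abs_fps (\<lambda>i. \<Sum>k\<le>i + j. u k $ j $ i)) - (\<Sum>k<n. u k) \<in> fil2 n"
    by (simp add: fil2_def fps_sum_nth)
qed

text \<open>The corrections \<open>u\<^sub>n\<close> found at the successive steps sum to a limit by completeness, whereas the
  corrections in \<open>J\<close> are only used through their partial sums. So \<open>J\<close> need not be closed, and
  the conclusion is membership in its closure.\<close>

lemma successive_approximation:
  fixes FU :: "nat \<Rightarrow> 'u::ab_group_add set" and F :: "nat \<Rightarrow> 'a::ab_group_add set"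
  assumes L: "additive L" and J0: "0 \<in> J" and Jadd: "\<And>x y. x \<in> J \<Longrightarrow> y \<in> J \<Longrightarrow> x + y \<in> J"
    and complete: "\<And>u. (\<And>k. u k \<in> FU k) \<Longrightarrow> \<exists>s. \<forall>n. s - (\<Sum>k<n. u k) \<in> FU n"
    and LF: "\<And>n u. u \<in> FU n \<Longrightarrow> L u \<in> F n"
    and F0: "\<And>x. x \<in> F 0" and Fadd: "\<And>n x y. x \<in> F n \<Longrightarrow> y \<in> F n \<Longrightarrow> x - y \<in> F n"
    and step: "\<And>n x. x \<in> F n \<Longrightarrow> \<exists>u\<in>FU n. \<exists>j\<in>J. x - L u - j \<in> F (Suc n)"
  shows "\<exists>u. \<forall>n. \<exists>j\<in>J. x - L u - j \<in> F n"
proof -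
  obtain U V where UV: "\<And>n x. x \<in> F n \<Longrightarrow> U n x \<in> FU n \<and> V n x \<in> J \<and> x - L (U n x) - V n x \<in> F (Suc n)"
  proof -
    have "\<forall>n x. \<exists>t. x \<in> F n \<longrightarrow> fst t \<in> FU n \<and> snd t \<in> J \<and> x - L (fst t) - snd t \<in> F (Suc n)"
      using step by fastforce
    then obtain T where
      "\<And>n x. x \<in> F n \<longrightarrow> fst (T n x) \<in> FU n \<and> snd (T n x) \<in> J \<and>
        x - L (fst (T n x)) - snd (T n x) \<in> F (Suc n)"
      by metis
    thus ?thesis by (intro that[of "\<lambda>n x. fst (T n x)" "\<lambda>n x. snd (T n x)"]) blast
  qed
  define r where "r = rec_nat x (\<lambda>n y. y - L (U n y) - V n y)"
  have r_Suc: "r (Suc n) = r n - L (U n (r n)) - V n (r n)" for n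
    by (simp add: r_def)
  have r: "r n \<in> F n" for n
    by (induction n) (use UV F0 in \<open>auto simp: r_Suc\<close>)
  have "\<exists>s. \<forall>n. s - (\<Sum>k<n. U k (r k)) \<in> FU n"
    by (rule complete) (use UV r in auto)
  then obtain s where s: "\<And>n. s - (\<Sum>k<n. U k (r k)) \<in> FU n" by auto
  have "\<exists>j\<in>J. x - L s - j \<in> F n" for n
  proof
    have Jsum: "(\<Sum>k<n. V k (r k)) \<in> J" for n
      by (induction n) (use J0 Jadd UV r in auto)
    show "(\<Sum>k<n. V k (r k)) \<in> J" by (rule Jsum)
    have "r n = x - (\<Sum>k<n. L (U k (r k))) - (\<Sum>k<n. V k (r k))" for n
    proof (induction n)
      case 0
      show ?case by (simp add: r_def)
    next
      case (Suc n)
      thus ?case by (simp add: r_Suc)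
    qed
    hence "r n - L (s - (\<Sum>k<n. U k (r k))) = x - L s - (\<Sum>k<n. V k (r k))"
      by (simp add: additive.diff[OF L] additive.sum[OF L] algebra_simps)
    thus "x - L s - (\<Sum>k<n. V k (r k)) \<in> F n"
      using Fadd[OF r LF[OF s]] by metis
  qed
  thus ?thesis by blast
qed

lemma fil1_diff: "x \<in> fil1 n \<Longrightarrow> y \<in> fil1 n \<Longrightarrow> x - y \<in> fil1 n" for x :: "'a::ring_1 fps"
  by (simp add: fil1_def)

lemma fil2_diff: "x \<in> fil2 n \<Longrightarrow> y \<in> fil2 n \<Longrightarrow> x - y \<in> fil2 n" for x :: "'a::ring_1 fps fps"
  by (simp add: fil2_def)

lemma fps_extend1_diff_fil:
  assumes \<theta>: "additive \<theta>" "\<And>u. \<theta> u $ 0 = u" and x: "x \<in> fil1 n"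
  shows "fps_extend1 \<theta> x - x \<in> fil1 (Suc n)"
proof -
  have "(\<Sum>k\<le>i. \<theta> (x $ k) $ (i - k)) = (\<Sum>k\<in>{i}. \<theta> (x $ k) $ (i - k))" if "i < Suc n" for i
    using that x by (intro sum.mono_neutral_right) (auto simp: fil1_def additive.zero[OF \<theta>(1)])
  thus ?thesis by (simp add: fil1_def fps_extend1_nth \<theta>)
qed

lemma fps_extend2_diff_fil:
  assumes \<theta>: "additive \<theta>" "\<And>u. \<theta> u $ 0 $ 0 = u" and x: "x \<in> fil2 n"
  shows "fps_extend2 \<theta> x - x \<in> fil2 (Suc n)"
proof -
  have "(\<Sum>q\<le>j. \<Sum>p\<le>i. \<theta> (x $ q $ p) $ (j - q) $ (i - p)) = x $ j $ i" if "i + j < Suc n" for i j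
  proof -
    have "(\<Sum>q\<le>j. \<Sum>p\<le>i. \<theta> (x $ q $ p) $ (j - q) $ (i - p)) =
        (\<Sum>(q, p)\<in>{..j} \<times> {..i}. \<theta> (x $ q $ p) $ (j - q) $ (i - p))"
      by (simp add: sum.cartesian_product)
    also have "\<dots> = (\<Sum>(q, p)\<in>{(j, i)}. \<theta> (x $ q $ p) $ (j - q) $ (i - p))"
    proof (intro sum.mono_neutral_right ballI)
      fix t assume t: "t \<in> {..j} \<times> {..i} - {(j, i)}"
      obtain q p where "t = (q, p)" by (cases t)
      moreover from this have "p + q < n" using t that by auto
      ultimately show "(case t of (q, p) \<Rightarrow> \<theta> (x $ q $ p) $ (j - q) $ (i - p)) = 0"
        using x by (simp add: fil2_def additive.zero[OF \<theta>(1)])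
    qed auto
    finally show ?thesis by (simp add: \<theta>)
  qed
  thus ?thesis by (simp add: fil2_def fps_extend2_nth)
qed

text \<open>A map which is linear in the parameters and the identity modulo the parameters differs from the
  identity by an operator raising the filtration. An element of the kernel is therefore in every step of
  the filtration, and preimages are found by successive approximation.\<close>

lemma fps_extend1_bij:
  fixes \<theta> :: "'a::ring_1 \<Rightarrow> 'a fps"
  assumes \<theta>: "additive \<theta>" "\<And>u. \<theta> u $ 0 = u"
  shows "bij (fps_extend1 \<theta>)"
proof (rule bijI)
  let ?E = "fps_extend1 \<theta>"
  note E = fps_extend1_additive[OF \<theta>(1)]
  show "inj ?E"
  proof (rule injI)
    fix x y assume "?E x = ?E y"
    hence 0: "?E (x - y) = 0" by (simp add: additive.diff[OF E])
    have "x - y \<in> fil1 n" for n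
    proof (induction n)
      case (Suc n)
      from fps_extend1_diff_fil[OF \<theta> Suc] show ?case using 0 by (simp add: fil1_def)
    qed (rule fil1_0)
    thus "x = y" using fil1_separated[of "x - y"] by simp
  qed
  show "surj ?E"
  proof (unfold surj_def, rule allI)
    fix x
    have "\<exists>u. \<forall>n. \<exists>j\<in>{0}. x - ?E u - j \<in> fil1 n"
    proof (rule successive_approximation[OF E])
      fix n and x :: "'a fps" assume x: "x \<in> fil1 n"
      show "\<exists>u\<in>fil1 n. \<exists>j\<in>{0}. x - ?E u - j \<in> fil1 (Suc n)"
        using fps_extend1_diff_fil[OF \<theta> x] x by (intro rev_bexI[OF x]) (auto simp: fil1_def)
    qed (auto intro: fil1_complete fil1_0 fil1_diff fps_extend1_fil \<theta>)
    then obtain u where "\<And>n. x - ?E u \<in> fil1 n" by auto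
    hence "x - ?E u = 0" by (rule fil1_separated)
    thus "\<exists>u. x = ?E u" by (intro exI[of _ u]) simp
  qed
qed

lemma fps_extend2_bij:
  fixes \<theta> :: "'a::ring_1 \<Rightarrow> 'a fps fps"
  assumes \<theta>: "additive \<theta>" "\<And>u. \<theta> u $ 0 $ 0 = u"
  shows "bij (fps_extend2 \<theta>)"
proof (rule bijI)
  let ?E = "fps_extend2 \<theta>"
  note E = fps_extend2_additive[OF \<theta>(1)]
  show "inj ?E"
  proof (rule injI)
    fix x y assume "?E x = ?E y"
    hence 0: "?E (x - y) = 0" by (simp add: additive.diff[OF E])
    have "x - y \<in> fil2 n" for n
    proof (induction n)
      case (Suc n)
      from fps_extend2_diff_fil[OF \<theta> Suc] show ?case using 0 by (simp add: fil2_def)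
    qed (rule fil2_0)
    thus "x = y" using fil2_separated[of "x - y"] by simp
  qed
  show "surj ?E"
  proof (unfold surj_def, rule allI)
    fix x
    have "\<exists>u. \<forall>n. \<exists>j\<in>{0}. x - ?E u - j \<in> fil2 n"
    proof (rule successive_approximation[OF E])
      fix n and x :: "'a fps fps" assume x: "x \<in> fil2 n"
      show "\<exists>u\<in>fil2 n. \<exists>j\<in>{0}. x - ?E u - j \<in> fil2 (Suc n)"
        using fps_extend2_diff_fil[OF \<theta> x] x by (intro rev_bexI[OF x]) (auto simp: fil2_def)
    qed (auto intro: fil2_complete fil2_0 fil2_diff fps_extend2_fil \<theta>)
    then obtain u where "\<And>n. x - ?E u \<in> fil2 n" by auto
    hence "x - ?E u = 0" by (rule fil2_separated)
    thus "\<exists>u. x = ?E u" by (intro exI[of _ u]) simp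
  qed
qed

section \<open>Quotients by closed ideals\<close>

definition two_sided :: "'a::ring_1 set \<Rightarrow> bool" where
  "two_sided I \<longleftrightarrow> 0 \<in> I \<and> (\<forall>x\<in>I. \<forall>y\<in>I. x + y \<in> I) \<and> (\<forall>x\<in>I. \<forall>a. a * x \<in> I \<and> x * a \<in> I)"

lemma two_sided_uminus: "two_sided I \<Longrightarrow> x \<in> I \<Longrightarrow> - x \<in> I"
  unfolding two_sided_def by (drule conjunct2, drule conjunct2, drule bspec, assumption,
    drule spec[of _ "- 1"]) simp

lemma two_sided_adic_closure1: "two_sided (adic_closure1 (gen_ideal R))"
  unfolding two_sided_def
proof (intro conjI ballI allI)
  show "0 \<in> adic_closure1 (gen_ideal R)"
    unfolding adic_closure1_def using gen_ideal_0[of R] by force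
next
  fix x y assume *: "x \<in> adic_closure1 (gen_ideal R)" "y \<in> adic_closure1 (gen_ideal R)"
  show "x + y \<in> adic_closure1 (gen_ideal R)" unfolding adic_closure1_iff
  proof
    fix n
    obtain x' y' where "x' \<in> gen_ideal R" "x - x' \<in> fil1 n" "y' \<in> gen_ideal R" "y - y' \<in> fil1 n"
      using * unfolding adic_closure1_iff by blast
    thus "\<exists>z\<in>gen_ideal R. x + y - z \<in> fil1 n"
      using fil1_add[of "x - x'" n "y - y'"] by (auto simp: algebra_simps intro!: bexI[of _ "x' + y'"] gen_ideal_add)
  qed
next
  fix x a assume *: "x \<in> adic_closure1 (gen_ideal R)"
  have "\<exists>z\<in>gen_ideal R. a * x - z \<in> fil1 n" for n
  proof -
    obtain x' where "x' \<in> gen_ideal R" "x - x' \<in> fil1 n" using * unfolding adic_closure1_iff by blast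
    thus ?thesis using fil1_mult[OF fil1_0, of "x - x'" n a]
      by (intro bexI[of _ "a * x'"]) (auto simp: right_diff_distrib gen_ideal_mult_left)
  qed
  thus "a * x \<in> adic_closure1 (gen_ideal R)" by (simp add: adic_closure1_iff)
  have "\<exists>z\<in>gen_ideal R. x * a - z \<in> fil1 n" for n
  proof -
    obtain x' where "x' \<in> gen_ideal R" "x - x' \<in> fil1 n" using * unfolding adic_closure1_iff by blast
    thus ?thesis using fil1_mult[OF _ fil1_0, of "x - x'" n a]
      by (intro bexI[of _ "x' * a"]) (auto simp: left_diff_distrib gen_ideal_mult_right)
  qed
  thus "x * a \<in> adic_closure1 (gen_ideal R)" by (simp add: adic_closure1_iff)
qed

lemma two_sided_adic_closure2: "two_sided (adic_closure2 (gen_ideal R))"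
  unfolding two_sided_def
proof (intro conjI ballI allI)
  show "0 \<in> adic_closure2 (gen_ideal R)"
    unfolding adic_closure2_def using gen_ideal_0[of R] by force
next
  fix x y assume *: "x \<in> adic_closure2 (gen_ideal R)" "y \<in> adic_closure2 (gen_ideal R)"
  show "x + y \<in> adic_closure2 (gen_ideal R)" unfolding adic_closure2_iff
  proof
    fix n
    obtain x' y' where "x' \<in> gen_ideal R" "x - x' \<in> fil2 n" "y' \<in> gen_ideal R" "y - y' \<in> fil2 n"
      using * unfolding adic_closure2_iff by blast
    thus "\<exists>z\<in>gen_ideal R. x + y - z \<in> fil2 n"
      using fil2_add[of "x - x'" n "y - y'"] by (auto simp: algebra_simps intro!: bexI[of _ "x' + y'"] gen_ideal_add)
  qed
next
  fix x a assume *: "x \<in> adic_closure2 (gen_ideal R)"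
  have "\<exists>z\<in>gen_ideal R. a * x - z \<in> fil2 n" for n
  proof -
    obtain x' where "x' \<in> gen_ideal R" "x - x' \<in> fil2 n" using * unfolding adic_closure2_iff by blast
    thus ?thesis using fil2_mult[OF fil2_0, of "x - x'" n a]
      by (intro bexI[of _ "a * x'"]) (auto simp: right_diff_distrib gen_ideal_mult_left)
  qed
  thus "a * x \<in> adic_closure2 (gen_ideal R)" by (simp add: adic_closure2_iff)
  have "\<exists>z\<in>gen_ideal R. x * a - z \<in> fil2 n" for n
  proof -
    obtain x' where "x' \<in> gen_ideal R" "x - x' \<in> fil2 n" using * unfolding adic_closure2_iff by blast
    thus ?thesis using fil2_mult[OF _ fil2_0, of "x - x'" n a]
      by (intro bexI[of _ "x' * a"]) (auto simp: left_diff_distrib gen_ideal_mult_right)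
  qed
  thus "x * a \<in> adic_closure2 (gen_ideal R)" by (simp add: adic_closure2_iff)
qed

abbreviation (input) coset :: "'a::ring_1 set \<Rightarrow> 'a \<Rightarrow> 'a set" where
  "coset I x \<equiv> a_r_coset ring_of_type_algebra I x"

lemma coset_def: "coset I x = {i + x | i. i \<in> I}"
  by (auto simp: a_r_coset_def r_coset_def ring_of_type_algebra_def)

context
  fixes I :: "'a::ring_1 set"
  assumes I: "two_sided I"
begin

lemma ideal_two_sided: "ideal I ring_of_type_algebra"
proof -
  let ?R = "ring_of_type_algebra :: 'a ring"
  interpret R: ring ?R by (rule ring_ring_of_type_algebra)
  have a_inv: "a_inv ?R x = - x" for x
    by (rule R.minus_equality) (simp_all add: ring_of_type_algebra_def)
  have "subgroup I (add_monoid ?R)"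
  proof (rule group.subgroupI[OF R.a_group])
    fix x assume "x \<in> I"
    thus "inv\<^bsub>add_monoid ?R\<^esub> x \<in> I"
      using a_inv[of x] two_sided_uminus[OF I] by (simp add: a_inv_def)
  qed (use I in \<open>auto simp: ring_of_type_algebra_def two_sided_def\<close>)
  hence "additive_subgroup I ?R"
    by (rule additive_subgroup.intro)
  thus ?thesis using I
    by (intro idealI ring_ring_of_type_algebra)
       (auto simp: additive_subgroup_def, auto simp: ring_of_type_algebra_def two_sided_def)
qed

lemma coset_eq_iff: "coset I x = coset I y \<longleftrightarrow> x - y \<in> I"
proof
  assume *: "coset I x = coset I y"
  have "0 + x \<in> coset I x" unfolding coset_def using I by (auto simp: two_sided_def)
  then obtain i where "i \<in> I" "x = i + y" unfolding * by (auto simp: coset_def)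
  thus "x - y \<in> I" by simp
next
  have sub: "coset I x \<subseteq> coset I y" if "x - y \<in> I" for x y
  proof
    fix z assume "z \<in> coset I x"
    then obtain i where "i \<in> I" "z = i + x" by (auto simp: coset_def)
    hence "z = (i + (x - y)) + y" "i + (x - y) \<in> I"
      using that I by (auto simp: two_sided_def)
    thus "z \<in> coset I y" unfolding coset_def by blast
  qed
  assume "x - y \<in> I"
  moreover from this have "y - x \<in> I" using two_sided_uminus[OF I] by fastforce
  ultimately show "coset I x = coset I y" using sub by blast
qed

lemma Quot_carrier: "carrier (ring_of_type_algebra Quot I) = range (coset I)"
  by (auto simp: FactRing_def A_RCOSETS_defs a_r_coset_def ring_of_type_algebra_def)

lemma Quot_mult: "coset I x \<otimes>\<^bsub>ring_of_type_algebra Quot I\<^esub> coset I y = coset I (x * y)"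
proof -
  have "[mod I:] coset I x \<Otimes>\<^bsub>ring_of_type_algebra\<^esub> coset I y = coset I (x \<otimes>\<^bsub>ring_of_type_algebra\<^esub> y)"
    by (rule ideal.rcoset_mult_add[OF ideal_two_sided]) (simp_all add: ring_of_type_algebra_def)
  thus ?thesis by (simp add: FactRing_def ring_of_type_algebra_def)
qed

text \<open>\<open>L\<close> is a candidate for a section of the quotient map, and \<open>\<Psi>\<close> a homomorphism inducing a map on the
  quotient. If \<open>\<Psi>\<close> separates the values of \<open>L\<close>, these are independent modulo \<open>I\<close>, even though the kernel
  of \<open>\<Psi>\<close> is not known to be \<open>I\<close>; and products in the quotient can be computed after applying \<open>\<Psi>\<close>.\<close>

lemma transport_mult_quotient:
  assumes \<Psi>: "ring_hom1 \<Psi>" "\<And>x. x \<in> I \<Longrightarrow> \<Psi> x = 0"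
    and inj: "inj (\<lambda>u. \<Psi> (L u))"
    and span: "\<And>x. \<exists>u. x - L u \<in> I"
  shows "bij_betw (\<lambda>u. coset I (L u)) UNIV (carrier (ring_of_type_algebra Quot I))"
    and "\<Psi> (L (transport_mult (\<lambda>u. coset I (L u)) (ring_of_type_algebra Quot I) u v)) = \<Psi> (L u) * \<Psi> (L v)"
proof -
  have \<Psi>_eq: "\<Psi> x = \<Psi> y" if "coset I x = coset I y" for x y
  proof -
    have "\<Psi> (x - y) = 0" by (rule \<Psi>(2)) (use that in \<open>simp only: coset_eq_iff\<close>)
    thus ?thesis by (simp add: ring_hom1_simps[OF \<Psi>(1)])
  qed
  have "coset I x \<in> range (\<lambda>u. coset I (L u))" for x
  proof -
    obtain u where "x - L u \<in> I" using span by blast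
    hence "coset I x = coset I (L u)" by (simp only: coset_eq_iff)
    thus ?thesis by (rule range_eqI)
  qed
  hence ran: "range (\<lambda>u. coset I (L u)) = range (coset I)" by blast
  have "inj (\<lambda>u. coset I (L u))"
    by (rule injI, rule injD[OF inj], rule \<Psi>_eq)
  thus "bij_betw (\<lambda>u. coset I (L u)) UNIV (carrier (ring_of_type_algebra Quot I))"
    unfolding bij_betw_def ran Quot_carrier by blast
  let ?w = "transport_mult (\<lambda>u. coset I (L u)) (ring_of_type_algebra Quot I) u v"
  have "coset I (L u * L v) \<in> range (\<lambda>u. coset I (L u))" unfolding ran by (rule rangeI)
  hence "coset I (L ?w) = coset I (L u * L v)"
    unfolding transport_mult_def Quot_mult by (rule f_inv_into_f)
  from \<Psi>_eq[OF this] show "\<Psi> (L ?w) = \<Psi> (L u) * \<Psi> (L v)"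
    unfolding ring_hom1_mult[OF \<Psi>(1)] .
qed

end

lemma fps_extend1_closure:
  assumes "ring_hom1 \<theta>" "\<And>r. r \<in> R \<Longrightarrow> fps_extend1 \<theta> r = 0" "x \<in> adic_closure1 (gen_ideal R)"
  shows "fps_extend1 \<theta> x = 0"
proof (rule fil1_separated)
  fix n
  obtain y where y: "y \<in> gen_ideal R" "x - y \<in> fil1 n"
    using assms(3) unfolding adic_closure1_iff by blast
  have "fps_extend1 \<theta> y = 0"
    by (rule ring_hom1_kernel[OF fps_extend1_hom[OF assms(1)] y(1)]) (rule assms(2))
  thus "fps_extend1 \<theta> x \<in> fil1 n"
    using fps_extend1_fil[OF ring_hom1_additive[OF assms(1)] y(2)]
    by (simp add: ring_hom1_simps[OF fps_extend1_hom[OF assms(1)]])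
qed

lemma fps_extend2_closure:
  assumes "ring_hom1 \<theta>" "\<And>r. r \<in> R \<Longrightarrow> fps_extend2 \<theta> r = 0" "x \<in> adic_closure2 (gen_ideal R)"
  shows "fps_extend2 \<theta> x = 0"
proof (rule fil2_separated)
  fix n
  obtain y where y: "y \<in> gen_ideal R" "x - y \<in> fil2 n"
    using assms(3) unfolding adic_closure2_iff by blast
  have "fps_extend2 \<theta> y = 0"
    by (rule ring_hom1_kernel[OF fps_extend2_hom[OF assms(1)] y(1)]) (rule assms(2))
  thus "fps_extend2 \<theta> x \<in> fil2 n"
    using fps_extend2_fil[OF ring_hom1_additive[OF assms(1)] y(2)]
    by (simp add: ring_hom1_simps[OF fps_extend2_hom[OF assms(1)]])
qed

section \<open>Spanning modulo the closure of an ideal\<close>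

text \<open>It suffices to span the degree zero part modulo the constant terms of the ideal: the coefficients of
  lowest degree of a series can then be corrected, after multiplication with the parameters.\<close>

lemma fps_span_closure1:
  fixes L :: "'u::ring_1 \<Rightarrow> 'a::ring_1"
  assumes L: "additive L" and span: "\<And>p. \<exists>u. \<exists>j\<in>gen_ideal R. p - L u = j $ 0"
  shows "\<exists>u. x - map_fps L u \<in> adic_closure1 (gen_ideal R)"
proof -
  have "\<exists>u. \<forall>n. \<exists>j\<in>gen_ideal R. x - map_fps L u - j \<in> fil1 n"
  proof (rule successive_approximation[OF map_fps_additive[OF L]])
    show "u \<in> fil1 n \<Longrightarrow> map_fps L u \<in> fil1 n" for u n
      by (simp add: fil1_def additive.zero[OF L])
    fix n and x :: "'a fps" assume x: "x \<in> fil1 n"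
    obtain u j where uj: "j \<in> gen_ideal R" "x $ n - L u = j $ 0" using span by blast
    show "\<exists>u\<in>fil1 n. \<exists>j\<in>gen_ideal R. x - map_fps L u - j \<in> fil1 (Suc n)"
    proof (intro bexI)
      show "fps_X ^ n * fps_const u \<in> fil1 n" by (simp add: fil1_def fps_X_power_mult_nth)
      show "fps_X ^ n * j \<in> gen_ideal R" by (intro gen_ideal_mult_left uj)
      show "x - map_fps L (fps_X ^ n * fps_const u) - fps_X ^ n * j \<in> fil1 (Suc n)"
        using x uj(2) by (auto simp: fil1_def fps_X_power_mult_nth additive.zero[OF L] less_Suc_eq)
    qed
  qed (rule gen_ideal_0 gen_ideal_add fil1_complete fil1_0 fil1_diff; assumption)+
  thus ?thesis unfolding adic_closure1_iff .
qed

lemma fps_span_closure2: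
  fixes L :: "'u::ring_1 \<Rightarrow> 'a::ring_1"
  assumes L: "additive L" and span: "\<And>p. \<exists>u. \<exists>j\<in>gen_ideal R. p - L u = j $ 0 $ 0"
  shows "\<exists>u. x - map_fps (map_fps L) u \<in> adic_closure2 (gen_ideal R)"
proof -
  have "\<exists>u. \<forall>n. \<exists>j\<in>gen_ideal R. x - map_fps (map_fps L) u - j \<in> fil2 n"
  proof (rule successive_approximation[OF map_fps_additive[OF map_fps_additive[OF L]]])
    show "u \<in> fil2 n \<Longrightarrow> map_fps (map_fps L) u \<in> fil2 n" for u n
      by (simp add: fil2_def additive.zero[OF L])
    obtain U J where UJ: "\<And>p. J p \<in> gen_ideal R \<and> p - L (U p) = J p $ 0 $ 0"
      using span by metis
    fix n and x :: "'a fps fps" assume x: "x \<in> fil2 n"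
    show "\<exists>u\<in>fil2 n. \<exists>j\<in>gen_ideal R. x - map_fps (map_fps L) u - j \<in> fil2 (Suc n)"
    proof (intro bexI)
      let ?u = "Abs_fps (\<lambda>j. Abs_fps (\<lambda>i. if i + j = n then U (x $ j $ i) else 0))"
      let ?t = "\<lambda>a. fps_X ^ a * (fps_const (fps_X ^ (n - a)) * J (x $ a $ (n - a)))"
      show "?u \<in> fil2 n" by (simp add: fil2_def)
      show "(\<Sum>a\<le>n. ?t a) \<in> gen_ideal R"
        by (intro gen_ideal_sum gen_ideal_mult_left) (use UJ in blast)
      have t_nth: "?t a $ j $ i = (if a \<le> j \<and> n - a \<le> i then J (x $ a $ (n - a)) $ (j - a) $ (i - (n - a)) else 0)"
        for a i j by (simp add: fps_X_power_mult_nth)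
      have low: "(\<Sum>a\<le>n. ?t a $ j $ i) = 0" if "i + j < n" for i j
        by (rule sum.neutral) (use that in \<open>auto simp: t_nth\<close>)
      have top: "(\<Sum>a\<le>n. ?t a $ j $ i) = J (x $ j $ i) $ 0 $ 0" if "i + j = n" for i j
      proof -
        have "(\<Sum>a\<le>n. ?t a $ j $ i) = (\<Sum>a\<in>{j}. ?t a $ j $ i)"
          by (rule sum.mono_neutral_right) (use that in \<open>auto simp: t_nth\<close>)
        also have "\<dots> = ?t j $ j $ i" by simp
        also have "\<dots> = J (x $ j $ i) $ 0 $ 0" unfolding t_nth using that by auto
        finally show ?thesis .
      qed
      have "x $ j $ i - L (?u $ j $ i) - (\<Sum>a\<le>n. ?t a $ j $ i) = 0" if "i + j < Suc n" for i j
      proof (cases "i + j = n")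
        case True
        thus ?thesis unfolding top[OF True] using UJ[of "x $ j $ i"] True by (simp del: fps_mult_nth_0)
      next
        case False
        hence "i + j < n" using that by simp
        thus ?thesis using low[of i j] x by (simp add: fil2_def additive.zero[OF L])
      qed
      thus "x - map_fps (map_fps L) ?u - (\<Sum>a\<le>n. ?t a) \<in> fil2 (Suc n)"
        by (simp add: fil2_def fps_sum_nth)
    qed
  qed (rule gen_ideal_0 gen_ideal_add fil2_complete fil2_0 fil2_diff; assumption)+
  thus ?thesis unfolding adic_closure2_iff .
qed

text \<open>The constant terms of an ideal of power series form an ideal, since the constant term is a
  homomorphism with a section; so it is enough to find the generators among them.\<close>

lemma gen_ideal_lift:
  assumes h: "ring_hom1 h" "\<And>a. h (c a) = a" and p: "p \<in> gen_ideal S"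
    and S: "\<And>s. s \<in> S \<Longrightarrow> \<exists>j\<in>gen_ideal R. s = h j"
  shows "\<exists>j\<in>gen_ideal R. p = h j"
  using p
proof (induction rule: gen_ideal_induct)
  case zero
  show ?case by (intro bexI[of _ 0] gen_ideal_0) (simp add: ring_hom1_simps[OF h(1)])
next
  case (add x y)
  thus ?case by (metis gen_ideal_add ring_hom1_add[OF h(1)])
next
  case (left a x)
  thus ?case by (metis gen_ideal_mult_left ring_hom1_mult[OF h(1)] h(2))
next
  case (right a x)
  thus ?case by (metis gen_ideal_mult_right ring_hom1_mult[OF h(1)] h(2))
qed (rule S)

section \<open>The linear lifts of the enveloping algebra\<close>

lemma inv_usl2_pbw_additive: "additive (inv_into UNIV usl2_pbw)"
proof
  fix u v
  have "inv_into UNIV usl2_pbw (usl2_pbw (inv_into UNIV usl2_pbw u) + usl2_pbw (inv_into UNIV usl2_pbw v)) =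
      inv_into UNIV usl2_pbw u + inv_into UNIV usl2_pbw v"
    unfolding additive.add[OF usl2_pbw_additive, symmetric] using usl2_pbw_bij by (simp add: bij_is_inj)
  thus "inv_into UNIV usl2_pbw (u + v) = inv_into UNIV usl2_pbw u + inv_into UNIV usl2_pbw v"
    using usl2_pbw_bij by (simp add: bij_is_surj surj_f_inv_f)
qed

lemma pbw_lift_additive: "additive (pbw_lift y z x)"
  unfolding additive_def pbw_lift_def free_scale_eq
  by (simp add: additive.add[OF inv_usl2_pbw_additive] pbw_comb_add[OF free_alg_unit])

lemma pbw_lift_eval:
  assumes \<kappa>: "alg_unit \<kappa>"
  shows "free_eval \<kappa> e (pbw_lift y z x u) = pbw_comb (\<lambda>c v. \<kappa> c * v) (e y) (e z) (e x) (inv_into UNIV usl2_pbw u)"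
  unfolding pbw_lift_def free_scale_eq
  by (subst ring_hom1_pbw_comb[OF free_eval_hom[OF \<kappa>]])
    (simp_all add: free_eval_gen[OF \<kappa>] free_eval_single[OF \<kappa>] zero_list_def)

lemma abs_usl2_pbw_lift: "abs_usl2 (pbw_lift Xm Hg Xp u) = u"
proof -
  have "abs_usl2 (pbw_lift Xm Hg Xp u) = usl2_pbw (inv_into UNIV usl2_pbw u)"
    unfolding pbw_lift_def free_scale_eq usl2_pbw_eq
    by (subst ring_hom1_pbw_comb[OF abs_usl2_hom])
      (simp_all add: usl2_unit_def[symmetric] usl2_gen_eq[symmetric])
  thus ?thesis using usl2_pbw_bij by (simp add: bij_is_surj surj_f_inv_f)
qed

lemma pbw_lift_span: "p - pbw_lift Xm Hg Xp (abs_usl2 p) \<in> gen_ideal usl2_relators"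
  unfolding abs_usl2_eq_iff[symmetric] abs_usl2_pbw_lift ..

section \<open>The structure series\<close>

subsection \<open>Series in one element\<close>

abbreviation (input) HC_const :: "complex \<Rightarrow> complex poly poly" where "HC_const c \<equiv> [:[:c:]:]"

lemma HC_const_hom: "ring_hom1 HC_const"
  by (rule ring_hom1I) (simp_all add: one_pCons)

lemma cst_hom: "ring_hom1 cst"
  using ring_hom1_comp[OF ring_hom1_comp[OF fps_const_hom fps_const_hom] HC_const_hom]
  by (simp add: cst_def[abs_def])

lemma cst_mult_nth: "(cst c * y) $ j $ i = HC_const c * y $ j $ i"
  by (simp add: cst_def)

text \<open>The value \<open>\<Sum>\<^sub>k c\<^sub>k b\<^sup>k\<close> at a series \<open>b\<close> without constant term. Then \<open>b\<^sup>k\<close> has no terms of total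
  degree below \<open>k\<close>, which justifies the truncation.\<close>

definition HC_series_in :: "(nat \<Rightarrow> complex) \<Rightarrow> HC_series \<Rightarrow> HC_series" where
  "HC_series_in c b = Abs_fps (\<lambda>j. Abs_fps (\<lambda>i. \<Sum>k\<le>i + j. (cst (c k) * b ^ k) $ j $ i))"

lemma fil2_power: "b \<in> fil2 1 \<Longrightarrow> b ^ k \<in> fil2 k" for b :: "'a::ring_1 fps fps"
proof (induction k)
  case (Suc k)
  thus ?case using fil2_mult[of b 1 "b ^ k" k] by simp
qed (rule fil2_0)

lemma HC_series_in_approx:
  assumes "b \<in> fil2 1"
  shows "HC_series_in c b - (\<Sum>k<n. cst (c k) * b ^ k) \<in> fil2 n"
proof -
  have "cst (c k) * b ^ k \<in> fil2 k" for k
    using fil2_mult[OF fil2_0 fil2_power[OF assms], of "cst (c k)" k] by simp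
  hence "(\<Sum>k<n. (cst (c k) * b ^ k) $ j $ i) = (\<Sum>k\<le>i + j. (cst (c k) * b ^ k) $ j $ i)"
    if "i + j < n" for i j
    using that by (intro sum.mono_neutral_right) (auto simp: fil2_def)
  thus ?thesis by (simp add: fil2_def HC_series_in_def fps_sum_nth)
qed

lemma HC_series_in_unique:
  assumes "b \<in> fil2 1" "\<And>n. y - (\<Sum>k<n. cst (c k) * b ^ k) \<in> fil2 n"
  shows "y = HC_series_in c b"
proof -
  have "y - HC_series_in c b \<in> fil2 n" for n
    using fil2_diff[OF assms(2)[of n] HC_series_in_approx[OF assms(1), of c n]] by simp
  thus ?thesis using fil2_separated[of "y - HC_series_in c b"] by simp
qed

lemma HC_series_in_uminus: "HC_series_in c (- b) = HC_series_in (\<lambda>k. (- 1) ^ k * c k) b"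
proof -
  have "cst (c k) * (- b) ^ k = cst ((- 1) ^ k * c k) * b ^ k" for k
    by (cases "even k") (simp_all add: ring_hom1_simps[OF cst_hom])
  thus ?thesis by (simp add: HC_series_in_def)
qed

lemma HC_series_in_diff: "HC_series_in c b - HC_series_in d b = HC_series_in (\<lambda>k. c k - d k) b"
  by (simp add: HC_series_in_def fps_eq_iff ring_hom1_simps[OF cst_hom] left_diff_distrib sum_subtractf)

lemma HC_series_in_shift:
  assumes "b \<in> fil2 1"
  shows "b * HC_series_in c b = HC_series_in (\<lambda>k. if k = 0 then 0 else c (k - 1)) b"
proof (rule HC_series_in_unique[OF assms])
  fix n
  show "b * HC_series_in c b - (\<Sum>k<n. cst (if k = 0 then 0 else c (k - 1)) * b ^ k) \<in> fil2 n"
  proof (cases n)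
    case (Suc m)
    have "(\<Sum>k<Suc m. cst (if k = 0 then 0 else c (k - 1)) * b ^ k) = b * (\<Sum>k<m. cst (c k) * b ^ k)"
      by (simp add: sum.lessThan_Suc_shift ring_hom1_simps[OF cst_hom] sum_distrib_left mult_ac
          del: sum.lessThan_Suc)
    thus ?thesis
      using fil2_mult[OF assms HC_series_in_approx[OF assms, of c m]] Suc
      by (simp add: right_diff_distrib)
  qed (simp add: fil2_0)
qed

lemma ser_exp_eq: "ser_exp b = HC_series_in (\<lambda>k. 1 / fact k) b"
  by (simp add: ser_exp_def HC_series_in_def)

text \<open>The even series \<open>2 sinh(b) / b\<close>.\<close>

definition sinhc_coeff :: "nat \<Rightarrow> complex" where
  "sinhc_coeff k = (if even k then 2 / fact (Suc k) else 0)"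

definition two_sinhc :: "HC_series \<Rightarrow> HC_series" where
  "two_sinhc b = HC_series_in sinhc_coeff b"

lemma two_sinh_coeff: "1 / fact k - (- 1) ^ k * (1 / fact k) =
    (if k = 0 then 0 else sinhc_coeff (k - 1))"
  by (cases k) (auto simp: sinhc_coeff_def)

lemma two_sinh_eq: "b \<in> fil2 1 \<Longrightarrow> two_sinh b = b * two_sinhc b"
  unfolding two_sinh_def ser_exp_eq HC_series_in_uminus HC_series_in_diff two_sinhc_def
    HC_series_in_shift two_sinh_coeff ..

lemma two_sinhc_uminus: "two_sinhc (- b) = two_sinhc b"
proof -
  have "(\<lambda>k. (- 1) ^ k * sinhc_coeff k) = sinhc_coeff"
    by (auto simp: fun_eq_iff sinhc_coeff_def)
  thus ?thesis by (simp add: two_sinhc_def HC_series_in_uminus)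
qed

lemma HC_series_in_0: "HC_series_in c b $ 0 $ 0 = HC_const (c 0)"
  by (simp add: HC_series_in_def cst_def)

subsection \<open>Naturality\<close>

text \<open>All constructions in the relations are natural for \<open>\<complex>\<close>-algebra endomorphisms of
  \<open>\<complex>[H, \<surd>C]\<close>. This yields the evenness in \<open>\<surd>C\<close> and the behaviour under the shift of \<open>H\<close>.\<close>

definition HC_endo :: "(complex poly poly \<Rightarrow> complex poly poly) \<Rightarrow> bool" where
  "HC_endo \<tau> \<longleftrightarrow> ring_hom1 \<tau> \<and> (\<forall>c. \<tau> (HC_const c) = HC_const c)"

context
  fixes \<tau> assumes \<tau>: "HC_endo \<tau>"
begin

private abbreviation T :: "HC_series \<Rightarrow> HC_series" where "T \<equiv> map_fps (map_fps \<tau>)"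

private lemma \<tau>_hom: "ring_hom1 \<tau>" using \<tau> by (simp add: HC_endo_def)

lemma HC_endo_hom: "ring_hom1 T"
  by (intro map_fps_hom \<tau>_hom)

lemma HC_endo_cst: "T (cst c) = cst c"
  using \<tau> by (auto simp: cst_def HC_endo_def fps_eq_iff ring_hom1_0[OF \<tau>_hom])

lemma HC_endo_series_in: "T (HC_series_in c b) = HC_series_in c (T b)"
proof (rule fps2_eqI)
  fix i j
  have "cst (c k) * T b ^ k = T (cst (c k) * b ^ k)" for k
    by (simp add: ring_hom1_simps[OF HC_endo_hom] HC_endo_cst)
  thus "T (HC_series_in c b) $ j $ i = HC_series_in c (T b) $ j $ i"
    by (simp add: HC_series_in_def ring_hom1_sum[OF \<tau>_hom])
qed

lemma HC_endo_par: "T par_h = par_h" "T par_h' = par_h'"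
  by (rule fps2_eqI, simp add: par_h_def par_h'_def ring_hom1_simps[OF \<tau>_hom] fps_X_def)+

lemma HC_endo_bracket: "T (bracket_Q g x) = bracket_Q g (T x)"
  unfolding bracket_Q_def P_fun_def ser_exp_eq
  by (simp add: ring_hom1_simps[OF HC_endo_hom] HC_endo_cst HC_endo_series_in HC_endo_par
      ring_hom1_prod[OF HC_endo_hom])

end

lemma HC_swap_cst: "fps_swap (cst c) = cst c"
  by (rule fps2_eqI) (simp add: cst_def)

lemma HC_swap_series_in: "fps_swap (HC_series_in c b) = HC_series_in c (fps_swap b)"
proof (rule fps2_eqI)
  fix i j
  have "cst (c k) * fps_swap b ^ k = fps_swap (cst (c k) * b ^ k)" for k
    by (simp add: ring_hom1_simps[OF fps_swap_hom] HC_swap_cst)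
  thus "fps_swap (HC_series_in c b) $ j $ i = HC_series_in c (fps_swap b) $ j $ i"
    by (simp add: HC_series_in_def add.commute)
qed

lemma fps_swap_par: "fps_swap par_h = par_h'" "fps_swap par_h' = par_h"
  by (rule fps2_eqI, simp add: par_h_def par_h'_def fps_X_def)+

subsection \<open>The bracket\<close>

lemma eps_power_g: "g \<ge> 1 \<Longrightarrow> eps g ^ g = - 1"
  by (simp add: eps_def exp_of_nat_mult[symmetric])

lemma eps_nonzero: "eps g \<noteq> 0"
  by (simp add: eps_def)

lemma eps_power_ne:
  assumes "1 \<le> k" "k < g" shows "eps g ^ k - inverse (eps g ^ k) \<noteq> 0"
proof
  assume *: "eps g ^ k - inverse (eps g ^ k) = 0"
  have "eps g ^ k = exp (\<i> * of_real (pi * k / g))"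
    unfolding eps_def exp_of_nat_mult[symmetric] by (simp add: field_simps)
  hence e: "eps g ^ k = cis (pi * k / g)" by (simp add: cis_conv_exp)
  have "Im (eps g ^ k - inverse (eps g ^ k)) = 2 * sin (pi * k / g)"
    unfolding e by (simp add: cis_inverse)
  moreover have "0 < pi * k / g" "pi * k / g < pi"
    using assms by (simp_all add: field_simps)
  ultimately show False using * sin_gt_zero by force
qed

lemma P_fun_1: assumes "g \<ge> 1" shows "P_fun g 1 1 = 1"
proof -
  have "(cst (eps g ^ k) * 1 - cst (inverse (eps g ^ k)) * 1) * cst (1 / (eps g ^ k - inverse (eps g ^ k))) = 1"
    if "k \<in> {1..g - 1}" for k
  proof -
    have "k < g" using that assms unfolding atLeastAtMost_iff by linarith
    have "cst ((a - b) * (1 / (a - b))) = (cst a * 1 - cst b * 1) * cst (1 / (a - b))" for a b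
      by (simp only: ring_hom1_mult[OF cst_hom] ring_hom1_diff[OF cst_hom] mult_1_right)
    from this[of "eps g ^ k" "inverse (eps g ^ k)", symmetric] show ?thesis
      using eps_power_ne[of k g] \<open>k < g\<close> that by (auto simp: ring_hom1_1[OF cst_hom])
  qed
  moreover have "cst (1 / 2) * (1 ^ (g - 1) + 1 ^ (g - 1)) = 1"
  proof -
    have "cst (1 / 2 * 2) = cst (1 / 2) * 2"
      by (simp only: ring_hom1_mult[OF cst_hom] ring_hom1_numeral[OF cst_hom])
    thus ?thesis by (simp add: ring_hom1_1[OF cst_hom])
  qed
  ultimately show ?thesis unfolding P_fun_def by (simp only: prod.neutral_const mult_1_right cong: prod.cong)
qed

text \<open>The substitution \<open>k \<mapsto> g - k\<close> turns \<open>\<epsilon>\<^sup>k\<close> into \<open>- \<epsilon>\<^bsup>-k\<^esup>\<close>, and so exchanges the roles of \<open>u\<close> and its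
  inverse in the product.\<close>

lemma P_fun_commute: assumes "g \<ge> 1" shows "P_fun g u v = P_fun g v u"
proof -
  let ?f = "\<lambda>u v k. (cst (eps g ^ k) * u - cst (inverse (eps g ^ k)) * v) *
      cst (1 / (eps g ^ k - inverse (eps g ^ k)))"
  have eps_diff: "eps g ^ (g - k) = - inverse (eps g ^ k)" if "k \<in> {1..g - 1}" for k
  proof -
    have "eps g ^ (g - k) * eps g ^ k = - 1"
      unfolding power_add[symmetric] using that assms eps_power_g[of g] by auto
    thus ?thesis using eps_nonzero[of g] by (simp add: field_simps)
  qed
  have "prod (?f u v) {1..g - 1} = (\<Prod>k\<in>{1..g - 1}. ?f u v (g - k))"
    by (rule prod.reindex_bij_witness[of _ "\<lambda>k. g - k" "\<lambda>k. g - k"]) auto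
  also have "\<dots> = prod (?f v u) {1..g - 1}"
  proof (rule prod.cong)
    fix k assume "k \<in> {1..g - 1}"
    note e = eps_diff[OF this]
    have "eps g ^ (g - k) - inverse (eps g ^ (g - k)) = eps g ^ k - inverse (eps g ^ k)"
      by (simp add: e)
    thus "?f u v (g - k) = ?f v u k"
      by (simp add: e ring_hom1_simps[OF cst_hom])
  qed simp
  finally show ?thesis
    unfolding P_fun_def by (simp add: add.commute)
qed

lemma bracket_Q_uminus: "g \<ge> 1 \<Longrightarrow> bracket_Q g (- x) = bracket_Q g x"
  using P_fun_commute unfolding bracket_Q_def by simp

lemma HC_series_in_zero_nth0:
  assumes "b $ 0 = 0" shows "HC_series_in c b $ 0 = fps_const (HC_const (c 0))"
proof (rule fps_ext)
  fix i
  have p: "b ^ k $ 0 = 0 ^ k" for k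
    using assms ring_hom1_power[OF fps_nth_0_hom, of b k] by simp
  have "HC_series_in c b $ 0 $ i = (\<Sum>k\<le>i. (cst (c k) * b ^ k) $ 0 $ i)"
    by (simp add: HC_series_in_def)
  also have "\<dots> = (\<Sum>k\<in>{0}. (cst (c k) * b ^ k) $ 0 $ i)"
    by (rule sum.mono_neutral_right) (auto simp: p power_0_left)
  finally show "HC_series_in c b $ 0 $ i = fps_const (HC_const (c 0)) $ i"
    by (simp add: cst_def)
qed

text \<open>At \<open>h = 0\<close> both exponentials are \<open>1\<close>, and \<open>P(1) = 1\<close>.\<close>

lemma bracket_Q_swap_0: 
  assumes "g \<ge> 1" shows "fps_swap (bracket_Q g x) $ 0 = 1"
proof -
  let ?b = "fps_swap (par_h * x)"
  have b0: "?b $ 0 = 0"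
    by (simp add: ring_hom1_simps[OF fps_swap_hom] fps_swap_par par_h'_def)
  let ?z = "\<lambda>y :: HC_series. fps_const (fps_swap y $ 0) :: HC_series"
  have hom: "ring_hom1 ?z"
    by (rule ring_hom1_comp[OF ring_hom1_comp[OF fps_const_hom fps_nth_0_hom] fps_swap_hom])
  have exp: "?z (ser_exp (par_h * x)) = 1" "?z (ser_exp (- (par_h * x))) = 1"
    unfolding ser_exp_eq HC_series_in_uminus HC_swap_series_in
    using b0 by (simp_all add: HC_series_in_zero_nth0 one_pCons[symmetric])
  have c: "?z (cst c) = cst c" for c
    by (simp only: HC_swap_cst) (simp add: cst_def)
  have "?z (bracket_Q g x) = P_fun g (?z (ser_exp (par_h * x))) (?z (ser_exp (- (par_h * x))))"
    unfolding bracket_Q_def P_fun_def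
    by (simp only: ring_hom1_simps[OF hom] ring_hom1_prod[OF hom] c)
  also have "\<dots> = 1" unfolding exp by (rule P_fun_1[OF assms])
  finally have "?z (bracket_Q g x) $ 0 = 1" by simp
  thus ?thesis by simp
qed

subsection \<open>The factors of the defining relations\<close>

lemma exact_quot_eq: "q \<noteq> 0 \<Longrightarrow> r * q = p \<Longrightarrow> exact_quot p q = r" for p q r :: "'a::idom"
  unfolding exact_quot_def by (rule the_equality) auto

lemma fps_left_invertible: "y * f $ 0 = 1 \<Longrightarrow> \<exists>r. r * f = 1" for f :: "'a::ring_1 fps"
  using fps_left_inverse[of y f] by blast

lemma two_sinhc_invertible: "\<exists>r. r * two_sinhc b = 1"
proof -
  have "HC_const (1 / 2) * two_sinhc b $ 0 $ 0 = 1"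
    by (simp add: two_sinhc_def HC_series_in_0 sinhc_coeff_def one_pCons)
  from fps_left_invertible[OF this] obtain y where "y * two_sinhc b $ 0 = 1" by blast
  thus ?thesis by (rule fps_left_invertible)
qed

lemma two_sinhc_nonzero: "two_sinhc b \<noteq> 0"
  using two_sinhc_invertible[of b] by auto

text \<open>The series \<open>sinh(a x) / (x sinh(a))\<close>.\<close>

definition sinhc_ratio :: "HC_series \<Rightarrow> HC_series \<Rightarrow> HC_series" where
  "sinhc_ratio a x = exact_quot (two_sinhc (a * x)) (two_sinhc a)"

lemma sinhc_ratio_unique: "r * two_sinhc a = two_sinhc (a * x) \<Longrightarrow> sinhc_ratio a x = r"
  unfolding sinhc_ratio_def by (rule exact_quot_eq[OF two_sinhc_nonzero])

lemma sinhc_ratio_mult: "sinhc_ratio a x * two_sinhc a = two_sinhc (a * x)"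
proof -
  obtain r where "r * two_sinhc a = 1" using two_sinhc_invertible by blast
  hence "(two_sinhc (a * x) * r) * two_sinhc a = two_sinhc (a * x)" by (simp add: mult.assoc)
  thus ?thesis using sinhc_ratio_unique by metis
qed

lemma sinhc_ratio_uminus: "sinhc_ratio a (- x) = sinhc_ratio a x"
  by (simp add: sinhc_ratio_def two_sinhc_uminus)

lemma sinhc_ratio_endo:
  assumes "HC_endo \<tau>"
  shows "map_fps (map_fps \<tau>) (sinhc_ratio a x) =
    sinhc_ratio (map_fps (map_fps \<tau>) a) (map_fps (map_fps \<tau>) x)"
proof (rule sinhc_ratio_unique[symmetric])
  let ?T = "map_fps (map_fps \<tau>)"
  have "?T (sinhc_ratio a x * two_sinhc a) = ?T (two_sinhc (a * x))"
    by (simp only: sinhc_ratio_mult)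
  thus "?T (sinhc_ratio a x) * two_sinhc (?T a) = two_sinhc (?T a * ?T x)"
    by (simp add: ring_hom1_mult[OF HC_endo_hom[OF assms]] two_sinhc_def HC_endo_series_in[OF assms])
qed

lemma sinhc_ratio_swap: "fps_swap (sinhc_ratio a x) = sinhc_ratio (fps_swap a) (fps_swap x)"
proof (rule sinhc_ratio_unique[symmetric])
  have "fps_swap (sinhc_ratio a x * two_sinhc a) = fps_swap (two_sinhc (a * x))"
    by (simp only: sinhc_ratio_mult)
  thus "fps_swap (sinhc_ratio a x) * two_sinhc (fps_swap a) = two_sinhc (fps_swap a * fps_swap x)"
    by (simp add: ring_hom1_mult[OF fps_swap_hom] two_sinhc_def HC_swap_series_in)
qed

lemma sinhc_ratio_0: "sinhc_ratio a x $ 0 $ 0 = 1"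
proof -
  have "(sinhc_ratio a x * two_sinhc a) $ 0 $ 0 = two_sinhc (a * x) $ 0 $ 0"
    by (simp only: sinhc_ratio_mult)
  hence "sinhc_ratio a x $ 0 $ 0 * HC_const 2 = 1 * HC_const 2"
    by (simp add: two_sinhc_def HC_series_in_0 sinhc_coeff_def)
  thus ?thesis by (metis mult_cancel_right pCons_eq_0_iff zero_neq_numeral)
qed

text \<open>The series \<open>h + h' {x}\<close>.\<close>

definition rel_par :: "nat \<Rightarrow> HC_series \<Rightarrow> HC_series" where
  "rel_par g x = par_h + par_h' * bracket_Q g x"

lemma rel_par_at_0: "rel_par g x $ 0 = fps_X"
  by (simp add: rel_par_def par_h_def par_h'_def)

lemma rel_par_swap_at_0: "g \<ge> 1 \<Longrightarrow> fps_swap (rel_par g x) $ 0 = fps_X"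
  by (simp add: rel_par_def ring_hom1_simps[OF fps_swap_hom] fps_swap_par bracket_Q_swap_0)
    (simp add: par_h_def par_h'_def)

lemma rel_par_fil: "rel_par g x \<in> fil2 1"
  by (simp add: fil2_def rel_par_at_0)

lemma rel_factor_eq: "rel_factor g x = x * sinhc_ratio (rel_par g x) x"
proof -
  let ?a = "rel_par g x"
  have "?a \<noteq> 0" using rel_par_at_0[of g x] by auto
  have ax: "?a * x \<in> fil2 1" using fil2_mult[OF rel_par_fil fil2_0, of g x x] by simp
  have "exact_quot (two_sinh (?a * x)) ?a = x * two_sinhc (?a * x)"
    by (rule exact_quot_eq[OF \<open>?a \<noteq> 0\<close>]) (unfold two_sinh_eq[OF ax], simp only: mult_ac)
  moreover have "exact_quot (two_sinh ?a) ?a = two_sinhc ?a"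
    by (rule exact_quot_eq[OF \<open>?a \<noteq> 0\<close>]) (simp add: two_sinh_eq[OF rel_par_fil] mult_ac)
  moreover have "exact_quot (x * two_sinhc (?a * x)) (two_sinhc ?a) = x * sinhc_ratio ?a x"
    by (rule exact_quot_eq[OF two_sinhc_nonzero]) (simp add: mult.assoc sinhc_ratio_mult)
  ultimately show ?thesis
    by (simp add: rel_factor_def Let_def rel_par_def[symmetric])
qed

text \<open>The polynomial \<open>H\<^sub>e\<^sup>\<plusminus>\<close>.\<close>

definition He_poly :: "complex \<Rightarrow> complex \<Rightarrow> complex poly poly" where
  "He_poly \<sigma> e = [:[:- \<sigma> * e / 2, e / 2:], [:1 / 2:]:]"

lemma H_e_eq: "H_e \<sigma> e = fps_const (fps_const (He_poly \<sigma> e))"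
  by (simp add: H_e_def He_poly_def cst_def var_H_def var_sqrtC_def)

text \<open>The unit \<open>w\<close> by which the structure series of the deformation differs from that of
  \<open>U(sl\<^sub>2)\<close>.\<close>

definition rel_unit :: "nat \<Rightarrow> complex \<Rightarrow> HC_series" where
  "rel_unit g \<sigma> = (\<Prod>e\<in>{1, - 1}. sinhc_ratio (rel_par g (H_e \<sigma> e)) (H_e \<sigma> e))"

lemma rel_rhs_eq:
  "rel_rhs g \<sigma> = rel_unit g \<sigma> * fps_const (fps_const (He_poly \<sigma> 1 * He_poly \<sigma> (- 1)))"
proof -
  have "fps_const (fps_const (He_poly \<sigma> 1 * He_poly \<sigma> (- 1))) = H_e \<sigma> 1 * H_e \<sigma> (- 1)"
    by (simp add: H_e_eq)
  thus ?thesis by (simp add: rel_rhs_def rel_unit_def rel_factor_eq mult_ac)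
qed

lemma rel_unit_0: "rel_unit g \<sigma> $ 0 $ 0 = 1"
  by (simp add: rel_unit_def sinhc_ratio_0)

lemma rel_unit_endo:
  assumes \<tau>: "HC_endo \<tau>"
  shows "map_fps (map_fps \<tau>) (rel_unit g \<sigma>) =
    (\<Prod>e\<in>{1, - 1}. sinhc_ratio (rel_par g (fps_const (fps_const (\<tau> (He_poly \<sigma> e)))))
      (fps_const (fps_const (\<tau> (He_poly \<sigma> e)))))"
proof -
  have c: "map_fps (map_fps \<tau>) (fps_const (fps_const p)) = fps_const (fps_const (\<tau> p))" for p
  proof -
    have "\<tau> 0 = 0" using \<tau> by (auto simp: HC_endo_def ring_hom1_0)
    thus ?thesis by (auto simp: fps_eq_iff)
  qed
  have "map_fps (map_fps \<tau>) (rel_par g x) = rel_par g (map_fps (map_fps \<tau>) x)" for x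
    by (simp add: rel_par_def ring_hom1_simps[OF HC_endo_hom[OF \<tau>]] HC_endo_bracket[OF \<tau>] HC_endo_par[OF \<tau>])
  thus ?thesis
    by (simp add: rel_unit_def ring_hom1_simps[OF HC_endo_hom[OF \<tau>]] sinhc_ratio_endo[OF \<tau>] c H_e_eq)
qed

definition sqrtC_neg :: "complex poly poly \<Rightarrow> complex poly poly" where
  "sqrtC_neg q = pcompose q [:0, - 1:]"

definition H_shift :: "complex poly poly \<Rightarrow> complex poly poly" where
  "H_shift q = map_poly (\<lambda>p. pcompose p [:2, 1:]) q"

lemma sqrtC_neg_endo: "HC_endo sqrtC_neg"
  by (simp add: HC_endo_def ring_hom1_def sqrtC_neg_def pcompose_add pcompose_mult pcompose_1)

lemma H_shift_coeff: "Polynomial.coeff (H_shift q) n = pcompose (Polynomial.coeff q n) [:2, 1:]"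
  by (simp add: H_shift_def coeff_map_poly)

lemma H_shift_endo: "HC_endo H_shift"
proof -
  have "ring_hom1 H_shift"
    by (rule ring_hom1I)
       (simp_all add: poly_eq_iff H_shift_coeff pcompose_add coeff_mult pcompose_mult pcompose_sum pcompose_1
         split: nat.split)
  moreover have "H_shift (HC_const c) = HC_const c" for c
    by (simp add: H_shift_def map_poly_pCons)
  ultimately show ?thesis by (simp add: HC_endo_def)
qed

text \<open>The change of sign of \<open>\<surd>C\<close> maps \<open>H\<^sub>e\<close> to \<open>- H\<^bsub>-e\<^esub>\<close>, and the factors are even in \<open>x\<close>.\<close>

lemma rel_unit_even: assumes "g \<ge> 1" shows "map_fps (map_fps sqrtC_neg) (rel_unit g 1) = rel_unit g 1"
proof -
  have n: "sqrtC_neg (He_poly 1 e) = - He_poly 1 (- e)" for e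
    by (simp add: sqrtC_neg_def He_poly_def pcompose_pCons)
  have c: "fps_const (fps_const (- p)) = - fps_const (fps_const p)" for p :: "complex poly poly"
    by simp
  have r: "sinhc_ratio (rel_par g (- y)) (- y) = sinhc_ratio (rel_par g y) y" for y
    by (simp only: rel_par_def bracket_Q_uminus[OF assms] sinhc_ratio_uminus)
  have p: "(\<Prod>e\<in>{1, - 1 :: complex}. f (- e)) = (\<Prod>e\<in>{1, - 1}. f e)" for f :: "complex \<Rightarrow> HC_series"
    by (simp add: mult.commute)
  show ?thesis
    unfolding rel_unit_endo[OF sqrtC_neg_endo] n c r unfolding rel_unit_def H_e_eq
    by (rule p[of "\<lambda>e. sinhc_ratio (rel_par g (fps_const (fps_const (He_poly 1 e)))) (fps_const (fps_const (He_poly 1 e)))"])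
qed

lemma rel_unit_shift: "map_fps (map_fps H_shift) (rel_unit g 1) = rel_unit g (- 1)"
proof -
  have "H_shift (He_poly 1 e) = He_poly (- 1) e" for e
    by (simp add: H_shift_def He_poly_def map_poly_pCons pcompose_pCons)
  thus ?thesis
    unfolding rel_unit_endo[OF H_shift_endo] by (simp add: rel_unit_def H_e_eq)
qed

subsection \<open>Specialisation of one parameter\<close>

definition poly_series :: "(nat \<Rightarrow> complex) \<Rightarrow> complex poly poly \<Rightarrow> complex poly poly fps" where
  "poly_series c x = Abs_fps (\<lambda>i. HC_const (c i) * x ^ i)"

lemma HC_series_in_at_0:
  assumes "b $ 0 = fps_X * fps_const x"
  shows "HC_series_in c b $ 0 = poly_series c x"
proof (rule fps_ext)
  fix i
  have p: "b ^ k $ 0 $ i = (if i = k then x ^ k else 0)" for k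
  proof -
    have "b ^ k $ 0 = fps_X ^ k * fps_const (x ^ k)"
      using assms ring_hom1_power[OF fps_nth_0_hom, of b k]
      by (simp add: power_mult_distrib)
    thus ?thesis by (simp add: fps_X_power_mult_nth)
  qed
  have "HC_series_in c b $ 0 $ i = (\<Sum>k\<le>i. HC_const (c k) * b ^ k $ 0 $ i)"
    by (simp add: HC_series_in_def cst_mult_nth del: fps_mult_nth_0)
  also have "\<dots> = (\<Sum>k\<in>{i}. HC_const (c k) * b ^ k $ 0 $ i)"
    by (rule sum.mono_neutral_right) (auto simp: p)
  finally show "HC_series_in c b $ 0 $ i = poly_series c x $ i"
    by (simp add: poly_series_def p)
qed

definition poly_exp :: "complex poly poly \<Rightarrow> complex poly poly fps" where
  "poly_exp = poly_series (\<lambda>k. 1 / fact k)"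

definition poly_two_sinh :: "complex poly poly \<Rightarrow> complex poly poly fps" where
  "poly_two_sinh x = poly_exp x - poly_exp (- x)"

lemma poly_exp_add: "poly_exp (x + y) = poly_exp x * poly_exp y"
proof (rule fps_ext)
  fix n
  have "poly_exp (x + y) $ n = (\<Sum>k\<le>n. HC_const (1 / fact n) * (of_nat (n choose k) * x ^ k * y ^ (n - k)))"
    by (simp add: poly_exp_def poly_series_def binomial_ring sum_distrib_left)
  also have "\<dots> = (\<Sum>k\<le>n. (HC_const (1 / fact k) * x ^ k) * (HC_const (1 / fact (n - k)) * y ^ (n - k)))"
  proof (rule sum.cong)
    fix k assume "k \<in> {..n}"
    hence "complex_of_nat (n choose k) = fact n / (fact k * fact (n - k))"
      by (intro binomial_fact) auto
    hence "1 / fact n * complex_of_nat (n choose k) = 1 / fact k * (1 / fact (n - k))"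
      by (simp add: field_simps)
    hence "HC_const (1 / fact n) * HC_const (of_nat (n choose k)) = HC_const (1 / fact k) * HC_const (1 / fact (n - k))"
      unfolding ring_hom1_mult[OF HC_const_hom, symmetric] by simp
    moreover have "HC_const (of_nat m) = of_nat m" for m
      by (simp add: of_nat_poly)
    ultimately have e: "HC_const (1 / fact n) * of_nat (n choose k) =
        HC_const (1 / fact k) * HC_const (1 / fact (n - k))" by simp
    have "HC_const (1 / fact n) * (of_nat (n choose k) * x ^ k * y ^ (n - k)) =
        (HC_const (1 / fact n) * of_nat (n choose k)) * (x ^ k * y ^ (n - k))"
      by (simp only: mult.assoc)
    also have "\<dots> = (HC_const (1 / fact k) * x ^ k) * (HC_const (1 / fact (n - k)) * y ^ (n - k))"
      unfolding e by (simp only: mult_ac)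
    finally show "HC_const (1 / fact n) * (of_nat (n choose k) * x ^ k * y ^ (n - k)) =
      (HC_const (1 / fact k) * x ^ k) * (HC_const (1 / fact (n - k)) * y ^ (n - k))" .
  qed simp
  finally show "poly_exp (x + y) $ n = (poly_exp x * poly_exp y) $ n"
    by (simp add: poly_exp_def poly_series_def fps_mult_nth atMost_atLeast0)
qed

lemma poly_two_sinh_mult:
  "poly_two_sinh x * poly_two_sinh y =
    poly_exp (x + y) + poly_exp (- (x + y)) - poly_exp (x - y) - poly_exp (y - x)"
  using poly_exp_add[of x y] poly_exp_add[of "- x" "- y"] poly_exp_add[of x "- y"] poly_exp_add[of "- x" y]
  by (simp add: poly_two_sinh_def algebra_simps)

lemma poly_two_sinh_nth:
  "poly_two_sinh x $ n = (if odd n then HC_const (2 / fact n) * x ^ n else 0)"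
proof -
  have "HC_const (1 / fact n) + HC_const (1 / fact n) = HC_const (2 / fact n)"
    by simp
  hence "HC_const (1 / fact n) * x ^ n + HC_const (1 / fact n) * x ^ n = HC_const (2 / fact n) * x ^ n"
    by (simp only: distrib_right[symmetric])
  thus ?thesis
    by (cases "even n") (simp_all add: poly_two_sinh_def poly_exp_def poly_series_def del: smult_add_right)
qed

lemma poly_two_sinh_eq: "poly_two_sinh x = fps_X * fps_const x * poly_series sinhc_coeff x"
proof (rule fps_ext)
  fix n
  show "poly_two_sinh x $ n = (fps_X * fps_const x * poly_series sinhc_coeff x) $ n"
    by (cases n) (auto simp: poly_two_sinh_nth mult.assoc poly_series_def sinhc_coeff_def)
qed

lemma sinhc_ratio_at_0:
  assumes "a $ 0 = fps_X"
  shows "sinhc_ratio a (fps_const (fps_const x)) $ 0 * poly_series sinhc_coeff 1 = poly_series sinhc_coeff x"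
proof -
  have "a $ 0 = fps_X * fps_const 1" "(a * fps_const (fps_const x)) $ 0 = fps_X * fps_const x"
    using assms by simp_all
  note * = HC_series_in_at_0[OF this(1)] HC_series_in_at_0[OF this(2)]
  have "(sinhc_ratio a (fps_const (fps_const x)) * two_sinhc a) $ 0 = two_sinhc (a * fps_const (fps_const x)) $ 0"
    by (simp only: sinhc_ratio_mult)
  thus ?thesis unfolding two_sinhc_def fps_mult_nth_0 * .
qed

lemma poly_series_sinhc_nonzero: "poly_series sinhc_coeff x \<noteq> 0"
proof
  assume "poly_series sinhc_coeff x = 0"
  hence "poly_series sinhc_coeff x $ 0 = 0" by simp
  thus False by (simp add: poly_series_def sinhc_coeff_def)
qed

text \<open>Exchanging the parameters and then setting \<open>h' = 0\<close> amounts to the specialisation \<open>h = 0\<close>. Both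
  specialisations only depend on the value of \<open>h + h' {x}\<close>, which is the remaining parameter.\<close>

lemma rel_unit_swap_at_0:
  assumes "g \<ge> 1"
  shows "fps_swap (rel_unit g \<sigma>) $ 0 = rel_unit g \<sigma> $ 0"
proof -
  have c: "fps_swap (fps_const (fps_const x)) = fps_const (fps_const x)" for x :: "complex poly poly"
    by (rule fps2_eqI) auto
  have "sinhc_ratio (fps_swap (rel_par g y)) (fps_const (fps_const x)) $ 0 =
      sinhc_ratio (rel_par g y) (fps_const (fps_const x)) $ 0" for x y
    using sinhc_ratio_at_0[OF rel_par_swap_at_0[OF assms, of y], of x]
      sinhc_ratio_at_0[OF rel_par_at_0[of g y], of x] poly_series_sinhc_nonzero[of 1]
    by (metis mult_cancel_right)
  thus ?thesis
    by (simp add: rel_unit_def ring_hom1_simps[OF fps_swap_hom] sinhc_ratio_swap H_e_eq c)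
qed

lemma rel_rhs_at_0_mult:
  "rel_rhs g \<sigma> $ 0 * (poly_two_sinh 1 * poly_two_sinh 1) =
    poly_two_sinh (He_poly \<sigma> 1) * poly_two_sinh (He_poly \<sigma> (- 1))"
proof -
  let ?r = "\<lambda>e. sinhc_ratio (rel_par g (H_e \<sigma> e)) (H_e \<sigma> e) $ 0"
  have "(?r e * fps_const (He_poly \<sigma> e)) * poly_two_sinh 1 = poly_two_sinh (He_poly \<sigma> e)" for e
    unfolding poly_two_sinh_eq sinhc_ratio_at_0[OF rel_par_at_0, of g "H_e \<sigma> e" "He_poly \<sigma> e", symmetric] H_e_eq
    by (simp add: mult_ac)
  from this[of 1, symmetric] this[of "- 1", symmetric] show ?thesis
    by (simp add: rel_rhs_eq rel_unit_def mult_ac fps_const_mult[symmetric] del: fps_const_mult)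
qed

text \<open>With \<open>x\<^sub>1 + x\<^sub>2 = \<surd>C\<close> for both signs, the terms involving \<open>\<surd>C\<close> in the product formula
  for \<open>sinh(h x\<^sub>1) sinh(h x\<^sub>2)\<close> cancel in the difference, which becomes \<open>sinh(h H) sinh(h)\<close>. In particular
  the exact quotient \<open>sinh(h H) / sinh(h)\<close> exists.\<close>

lemma rel_rhs_at_0_diff:
  "rel_rhs g 1 $ 0 - rel_rhs g (- 1) $ 0 = map_fps (\<lambda>p. [:p:]) (exact_quot sinh_hH sinh_h)"
proof -
  let ?G = "rel_rhs g 1 $ 0 - rel_rhs g (- 1) $ 0" and ?H = "[:[:0, 1:]:] :: complex poly poly"
  let ?e = "map_fps (\<lambda>p. [:p:]) :: complex poly fps \<Rightarrow> complex poly poly fps"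
  let ?p = "map_fps (\<lambda>q. Polynomial.coeff q 0) :: complex poly poly fps \<Rightarrow> complex poly fps"
  have e_hom: "ring_hom1 ?e"
    by (intro map_fps_hom ring_hom1I) (simp_all add: one_pCons)
  have p_hom: "ring_hom1 ?p"
    by (intro map_fps_hom ring_hom1I) (simp_all add: coeff_mult)
  have pe: "?p (?e x) = x" for x by (simp add: fps_eq_iff)
  have He: "He_poly 1 1 + He_poly 1 (- 1) = He_poly (- 1) 1 + He_poly (- 1) (- 1)"
    "He_poly 1 1 - He_poly 1 (- 1) = ?H - 1" "He_poly 1 (- 1) - He_poly 1 1 = 1 - ?H"
    "He_poly (- 1) 1 - He_poly (- 1) (- 1) = ?H + 1" "He_poly (- 1) (- 1) - He_poly (- 1) 1 = - (?H + 1)"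
    by (simp_all add: He_poly_def one_pCons)
  have s1: "poly_two_sinh 1 = 2 * ?e sinh_h"
    by (simp add: fps_eq_iff poly_two_sinh_nth sinh_h_def numeral_fps_const numeral_poly)
  have s1_nz: "?e sinh_h \<noteq> 0"
  proof
    assume "?e sinh_h = 0"
    hence "?e sinh_h $ 1 = 0" by simp
    thus False by (simp add: sinh_h_def)
  qed
  have const_power: "[:p:] ^ n = [:p ^ n:]" for p :: "complex poly" and n
    by (induction n) (simp_all add: one_pCons)
  have sH: "poly_two_sinh ?H = 2 * ?e sinh_hH"
    by (simp add: fps_eq_iff poly_two_sinh_nth sinh_hH_def numeral_fps_const numeral_poly const_power
        monom_altdef)
  have "?G * (poly_two_sinh 1 * poly_two_sinh 1) = poly_two_sinh ?H * poly_two_sinh 1"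
    unfolding left_diff_distrib rel_rhs_at_0_mult unfolding poly_two_sinh_mult He by simp
  from this have G: "?G * ?e sinh_h = ?e sinh_hH"
  proof -
    assume "?G * (poly_two_sinh 1 * poly_two_sinh 1) = poly_two_sinh ?H * poly_two_sinh 1"
    hence "(?G * ?e sinh_h) * (2 * (2 * ?e sinh_h)) = ?e sinh_hH * (2 * (2 * ?e sinh_h))"
      unfolding s1 sH by (simp only: mult_ac)
    thus ?thesis using s1_nz by simp
  qed
  have "?p (?G * ?e sinh_h) = ?p (?e sinh_hH)" by (simp only: G)
  hence pG: "?p ?G * sinh_h = sinh_hH"
    unfolding ring_hom1_mult[OF p_hom] pe .
  have "sinh_h \<noteq> 0" using s1_nz ring_hom1_0[OF e_hom] by auto
  from exact_quot_eq[OF this pG] have q: "exact_quot sinh_hH sinh_h = ?p ?G" .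
  have "?e (?p ?G) * ?e sinh_h = ?G * ?e sinh_h"
    unfolding ring_hom1_mult[OF e_hom, symmetric] pG G ..
  thus ?thesis unfolding q using s1_nz by (metis mult_cancel_right)
qed

section \<open>Evaluation of the structure series in the enveloping algebra\<close>

subsection \<open>Polynomials at commuting elements\<close>

definition poly_eval :: "('a::comm_ring_1 \<Rightarrow> 'r::ring_1) \<Rightarrow> 'r \<Rightarrow> 'a poly \<Rightarrow> 'r" where
  "poly_eval f z p = (\<Sum>k\<le>Polynomial.degree p. f (Polynomial.coeff p k) * z ^ k)"

context
  fixes f :: "'a::comm_ring_1 \<Rightarrow> 'r::ring_1" and z :: 'r
  assumes f: "ring_hom1 f"
begin

lemma poly_eval_bound: "Polynomial.degree p \<le> n \<Longrightarrow> poly_eval f z p = (\<Sum>k\<le>n. f (Polynomial.coeff p k) * z ^ k)"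
  unfolding poly_eval_def
  by (rule sum.mono_neutral_left) (auto simp: coeff_eq_0 ring_hom1_0[OF f])

lemma poly_eval_pCons: "poly_eval f z (pCons a p) = f a + poly_eval f z p * z"
proof -
  have "poly_eval f z (pCons a p) = (\<Sum>k\<le>Suc (Polynomial.degree p). f (Polynomial.coeff (pCons a p) k) * z ^ k)"
    by (rule poly_eval_bound) (rule degree_pCons_le)
  thus ?thesis
    by (simp add: poly_eval_def sum.atMost_Suc_shift sum_distrib_right mult.assoc power_Suc2 del: power_Suc sum.atMost_Suc)
qed

lemma poly_eval_0: "poly_eval f z 0 = 0"
  by (simp add: poly_eval_def ring_hom1_0[OF f])

lemma poly_eval_add: "poly_eval f z (p + q) = poly_eval f z p + poly_eval f z q"
proof -
  let ?n = "max (Polynomial.degree p) (Polynomial.degree q)"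
  have "Polynomial.degree (p + q) \<le> ?n" by (rule degree_add_le) auto
  thus ?thesis
    by (simp add: poly_eval_bound[of _ ?n] ring_hom1_add[OF f] distrib_right sum.distrib)
qed

lemma poly_eval_commute:
  assumes "\<And>a. v * f a = f a * v" "v * z = z * v"
  shows "v * poly_eval f z p = poly_eval f z p * v"
proof (induction p)
  case (pCons a p)
  have "v * (poly_eval f z p * z) = poly_eval f z p * z * v"
    by (metis pCons.IH assms(2) mult.assoc)
  thus ?case by (simp add: poly_eval_pCons distrib_left distrib_right assms)
qed (simp add: poly_eval_0)

lemma poly_eval_smult: "poly_eval f z (Polynomial.smult a q) = f a * poly_eval f z q"
  by (induction q) (simp_all add: poly_eval_0 poly_eval_pCons ring_hom1_mult[OF f] distrib_left mult.assoc)

lemma poly_eval_hom: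
  assumes z: "\<And>a. z * f a = f a * z"
  shows "ring_hom1 (poly_eval f z)"
proof (rule ring_hom1I)
  show "poly_eval f z (p * q) = poly_eval f z p * poly_eval f z q" for p q
  proof (induction p)
    case (pCons a p)
    have c: "z * poly_eval f z q = poly_eval f z q * z"
      by (rule poly_eval_commute) (simp_all add: z)
    have "poly_eval f z p * (z * poly_eval f z q) = poly_eval f z p * poly_eval f z q * z"
      unfolding c by (simp only: mult.assoc)
    thus ?case
      by (simp add: poly_eval_add poly_eval_smult poly_eval_pCons pCons.IH ring_hom1_0[OF f] distrib_right mult.assoc)
  qed (simp add: poly_eval_0)
  show "poly_eval f z 1 = 1"
    by (simp add: poly_eval_def ring_hom1_1[OF f])
qed (rule poly_eval_add)

end

subsection \<open>The Casimir element\<close>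

definition casimir :: usl2 where
  "casimir = Uy * Ux + Uy * Ux + Uy * Ux + Uy * Ux + (UH + 1) * (UH + 1)"

lemma usl2_normal:
  "Ux * UH = UH * Ux - Ux - Ux" "UH * Uy = Uy * UH - Uy - Uy" "Ux * Uy = Uy * Ux + UH"
  by (simp_all add: usl2_relations mult_2)

lemma usl2_normal_assoc:
  "Ux * (UH * v) = UH * (Ux * v) - Ux * v - Ux * v"
  "UH * (Uy * v) = Uy * (UH * v) - Uy * v - Uy * v"
  "Ux * (Uy * v) = Uy * (Ux * v) + UH * v"
  by (simp_all add: mult.assoc[symmetric] usl2_normal left_diff_distrib distrib_right)

text \<open>The relations \<open>usl2_normal\<close>, oriented as rewrite rules, bring every product into the order
  \<open>y\<close>, \<open>h\<close>, \<open>x\<close>.\<close>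

lemma casimir_commute_gen: "casimir * usl2_gen v = usl2_gen v * casimir"
  by (cases v) (simp_all add: casimir_def algebra_simps usl2_normal usl2_normal_assoc)

lemma casimir_central: "casimir * u = u * casimir"
proof -
  obtain p where u: "u = abs_usl2 p" using abs_usl2_surj by blast
  have "casimir * abs_usl2 p = abs_usl2 p * casimir"
  proof (induction p rule: free_alg_induct)
    case (gen_mult x p)
    have "casimir * (usl2_gen x * abs_usl2 p) = usl2_gen x * abs_usl2 p * casimir"
      by (metis casimir_commute_gen gen_mult mult.assoc)
    thus ?case by (simp add: ring_hom1_mult[OF abs_usl2_hom] usl2_gen_eq)
  next
    case (scalar c)
    show ?case using usl2_unit_commute[of c casimir] by (simp add: usl2_unit_def)
  qed (simp add: ring_hom1_add[OF abs_usl2_hom] distrib_left distrib_right)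
  thus ?thesis unfolding u .
qed

definition H_eval :: "complex poly \<Rightarrow> usl2" where "H_eval = poly_eval usl2_unit UH"

lemma H_eval_hom: "ring_hom1 H_eval"
  unfolding H_eval_def by (rule poly_eval_hom[OF usl2_unit_hom]) (simp add: usl2_unit_commute)

lemma H_eval_pCons: "H_eval (pCons a p) = usl2_unit a + H_eval p * UH"
  unfolding H_eval_def by (rule poly_eval_pCons[OF usl2_unit_hom])

lemma H_eval_commute: "UH * H_eval p = H_eval p * UH"
  unfolding H_eval_def by (rule poly_eval_commute[OF usl2_unit_hom]) (simp_all add: usl2_unit_commute)

lemma Uy_H_eval: "Uy * H_eval p = H_eval (pcompose p [:2, 1:]) * Uy"
proof (induction p)
  case (pCons a p)
  have "usl2_unit 2 = 1 + 1"
    unfolding one_add_one[symmetric] ring_hom1_add[OF usl2_unit_hom] ring_hom1_1[OF usl2_unit_hom] ..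
  hence two: "H_eval [:2, 1:] = UH + 1 + 1"
    by (simp add: H_eval_pCons ring_hom1_0[OF H_eval_hom] ring_hom1_1[OF usl2_unit_hom])
  have "pcompose (pCons a p) [:2, 1:] = [:a:] + pcompose p [:2, 1:] * [:2, 1:]"
    by (simp only: pcompose_pCons mult.commute)
  hence "H_eval (pcompose (pCons a p) [:2, 1:]) = usl2_unit a + H_eval (pcompose p [:2, 1:]) * (UH + 1 + 1)"
    by (simp only: ring_hom1_add[OF H_eval_hom] ring_hom1_mult[OF H_eval_hom] two)
      (simp add: H_eval_pCons ring_hom1_0[OF H_eval_hom])
  hence "H_eval (pcompose (pCons a p) [:2, 1:]) * Uy =
      usl2_unit a * Uy + H_eval (pcompose p [:2, 1:]) * ((UH + 1 + 1) * Uy)"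
    by (simp only: distrib_right mult.assoc)
  also have "(UH + 1 + 1) * Uy = Uy * UH"
    by (simp add: distrib_right usl2_normal)
  also have "usl2_unit a * Uy + H_eval (pcompose p [:2, 1:]) * (Uy * UH) = Uy * H_eval (pCons a p)"
    by (simp add: H_eval_pCons distrib_left usl2_unit_commute mult.assoc[symmetric] pCons.IH)
  finally show ?case by simp
qed (simp add: ring_hom1_simps[OF H_eval_hom])

text \<open>The polynomial in \<open>C\<close> obtained from an even polynomial in \<open>\<surd>C\<close>. It discards odd powers, and so
  is multiplicative on even polynomials only.\<close>

definition even_part :: "complex poly poly \<Rightarrow> complex poly poly" where
  "even_part q = (\<Sum>b\<le>Polynomial.degree q. Polynomial.monom (Polynomial.coeff q (2 * b)) b)"

lemma even_part_coeff: "Polynomial.coeff (even_part q) n = Polynomial.coeff q (2 * n)"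
proof -
  have "Polynomial.coeff (even_part q) n = (if n \<le> Polynomial.degree q then Polynomial.coeff q (2 * n) else 0)"
    by (simp add: even_part_def coeff_sum coeff_monom)
  thus ?thesis by (simp add: coeff_eq_0)
qed

definition is_even :: "complex poly poly \<Rightarrow> bool" where
  "is_even q \<longleftrightarrow> (\<forall>n. odd n \<longrightarrow> Polynomial.coeff q n = 0)"

lemma even_part_mult:
  assumes "is_even q" "is_even r"
  shows "even_part (q * r) = even_part q * even_part r"
proof (rule poly_eqI)
  fix n
  have "Polynomial.coeff (even_part (q * r)) n = (\<Sum>i\<le>2 * n. Polynomial.coeff q i * Polynomial.coeff r (2 * n - i))"
    by (simp add: even_part_coeff coeff_mult)
  also have "\<dots> = (\<Sum>i\<in>(\<lambda>i. 2 * i) ` {..n}. Polynomial.coeff q i * Polynomial.coeff r (2 * n - i))"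
  proof (rule sum.mono_neutral_right)
    show "\<forall>i\<in>{..2 * n} - (\<lambda>i. 2 * i) ` {..n}. Polynomial.coeff q i * Polynomial.coeff r (2 * n - i) = 0"
    proof
      fix i assume i: "i \<in> {..2 * n} - (\<lambda>i. 2 * i) ` {..n}"
      have "odd i"
      proof
        assume "even i"
        then obtain j where "i = 2 * j" by (rule evenE)
        thus False using i by auto
      qed
      thus "Polynomial.coeff q i * Polynomial.coeff r (2 * n - i) = 0"
        using assms by (simp add: is_even_def)
    qed
  qed auto
  also have "\<dots> = (\<Sum>i\<le>n. Polynomial.coeff q (2 * i) * Polynomial.coeff r (2 * (n - i)))"
    by (subst sum.reindex) (auto simp: inj_on_def diff_mult_distrib2)
  finally show "Polynomial.coeff (even_part (q * r)) n = Polynomial.coeff (even_part q * even_part r) n"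
    by (simp add: coeff_mult even_part_coeff)
qed

definition HC_eval :: "complex poly poly \<Rightarrow> usl2" where
  "HC_eval q = poly_eval H_eval casimir (even_part q)"

lemma HC_eval_additive: "additive HC_eval"
proof
  fix q r
  have "even_part (q + r) = even_part q + even_part r"
    by (simp add: poly_eq_iff even_part_coeff)
  thus "HC_eval (q + r) = HC_eval q + HC_eval r"
    by (simp add: HC_eval_def poly_eval_add[OF H_eval_hom])
qed

lemma HC_eval_mult: "is_even q \<Longrightarrow> is_even r \<Longrightarrow> HC_eval (q * r) = HC_eval q * HC_eval r"
  unfolding HC_eval_def even_part_mult
  by (rule ring_hom1_mult) (rule poly_eval_hom[OF H_eval_hom], rule casimir_central)

lemma HC_eval_const: "HC_eval [:p:] = H_eval p"
proof -
  have "even_part [:p:] = [:p:]"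
    by (auto simp: poly_eq_iff even_part_coeff coeff_pCons split: nat.split)
  thus ?thesis by (simp add: HC_eval_def poly_eval_pCons[OF H_eval_hom] poly_eval_0[OF H_eval_hom])
qed

lemma HC_eval_1: "HC_eval 1 = 1"
  using HC_eval_const[of 1] by (simp add: one_pCons[symmetric] ring_hom1_1[OF H_eval_hom])

lemma HC_eval_commute: "UH * HC_eval q = HC_eval q * UH"
  unfolding HC_eval_def by (rule poly_eval_commute[OF H_eval_hom]) (simp_all add: H_eval_commute casimir_central)

lemma Uy_HC_eval: "Uy * HC_eval q = HC_eval (H_shift q) * Uy"
proof -
  have "Uy * poly_eval H_eval casimir p = poly_eval H_eval casimir (H_shift p) * Uy" for p
  proof (induction p)
    case (pCons a p)
    have s: "H_shift (pCons a p) = pCons (pcompose a [:2, 1:]) (H_shift p)"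
      by (rule poly_eqI) (simp add: H_shift_coeff coeff_pCons split: nat.split)
    show ?case
      unfolding s poly_eval_pCons[OF H_eval_hom]
      by (simp add: distrib_left distrib_right Uy_H_eval mult.assoc casimir_central[of Uy])
        (simp add: mult.assoc[symmetric] pCons.IH)
  qed (simp add: H_shift_def poly_eval_0[OF H_eval_hom])
  moreover have "even_part (H_shift q) = H_shift (even_part q)"
    by (rule poly_eqI) (simp add: even_part_coeff H_shift_coeff)
  ultimately show ?thesis by (simp add: HC_eval_def)
qed

lemma HC_eval_sum:
  "HC_eval q = (\<Sum>b\<le>Polynomial.degree q. \<Sum>a\<le>Polynomial.degree (Polynomial.coeff q (2 * b)).
     usl2_unit (Polynomial.coeff (Polynomial.coeff q (2 * b)) a) * (UH ^ a * casimir ^ b))"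
proof -
  have "Polynomial.degree (even_part q) \<le> Polynomial.degree q"
    by (rule degree_le) (auto simp: even_part_coeff coeff_eq_0)
  from poly_eval_bound[OF H_eval_hom this] show ?thesis
    unfolding HC_eval_def
    by (simp add: even_part_coeff H_eval_def[symmetric])
      (simp add: H_eval_def poly_eval_def sum_distrib_right mult.assoc)
qed

lemma He_poly_mult:
  assumes "\<sigma> = 1 \<or> \<sigma> = - 1"
  shows "He_poly \<sigma> 1 * He_poly \<sigma> (- 1) = [:[:- 1 / 4, \<sigma> / 2, - 1 / 4:], 0, [:1 / 4:]:]"
  using assms by (auto simp: He_poly_def)

lemma He_poly_even: "\<sigma> = 1 \<or> \<sigma> = - 1 \<Longrightarrow> is_even (He_poly \<sigma> 1 * He_poly \<sigma> (- 1))"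
  unfolding He_poly_mult is_even_def by (auto simp: coeff_pCons split: nat.split)

lemma usl2_unit_half: "usl2_unit (c / 2) = usl2_unit (c / 4) + usl2_unit (c / 4)"
  unfolding ring_hom1_add[OF usl2_unit_hom, symmetric] by simp

lemma usl2_unit_quarter:
  fixes v :: usl2
  shows "usl2_unit (1 / 4) * v + usl2_unit (1 / 4) * v + usl2_unit (1 / 4) * v + usl2_unit (1 / 4) * v = v"
proof -
  have "usl2_unit (1 / 4) + usl2_unit (1 / 4) + usl2_unit (1 / 4) + usl2_unit (1 / 4) = 1"
    unfolding ring_hom1_add[OF usl2_unit_hom, symmetric] by (simp add: ring_hom1_1[OF usl2_unit_hom])
  hence "(usl2_unit (1 / 4) + usl2_unit (1 / 4) + usl2_unit (1 / 4) + usl2_unit (1 / 4)) * v = 1 * v"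
    by (simp only:)
  thus ?thesis by (simp add: distrib_right)
qed

lemma HC_eval_He_poly:
  "HC_eval (He_poly 1 1 * He_poly 1 (- 1)) = Ux * Uy"
  "HC_eval (He_poly (- 1) 1 * He_poly (- 1) (- 1)) = Uy * Ux"
proof -
  have e: "even_part [:p, 0, r:] = [:p, r:]" for p r
    by (auto simp: poly_eq_iff even_part_coeff coeff_pCons split: nat.split)
  have n: "usl2_unit (- c) = - usl2_unit c" for c
    by (rule ring_hom1_minus[OF usl2_unit_hom])
  have *: "HC_eval (He_poly \<sigma> 1 * He_poly \<sigma> (- 1)) = usl2_unit (- 1 / 4) + usl2_unit (\<sigma> / 2) * UH
      + usl2_unit (- 1 / 4) * (UH * UH) + usl2_unit (1 / 4) * casimir" if "\<sigma> = 1 \<or> \<sigma> = - 1" for \<sigma>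
    unfolding He_poly_mult[OF that] HC_eval_def e
    by (simp add: poly_eval_pCons[OF H_eval_hom] poly_eval_0[OF H_eval_hom] H_eval_pCons
        ring_hom1_0[OF H_eval_hom] distrib_right add.assoc mult.assoc)
  show "HC_eval (He_poly 1 1 * He_poly 1 (- 1)) = Ux * Uy"
    using usl2_unit_quarter[of "Uy * Ux"] usl2_unit_quarter[of UH]
    by (simp add: * usl2_unit_half n casimir_def algebra_simps usl2_normal(3))
  show "HC_eval (He_poly (- 1) 1 * He_poly (- 1) (- 1)) = Uy * Ux"
    using usl2_unit_quarter[of "Uy * Ux"] arg_cong[OF usl2_unit_half[of 1], of "\<lambda>v. v * UH"]
    by (simp add: * n casimir_def algebra_simps)
qed

lemma rel_unit_coeff_even:
  assumes "g \<ge> 1"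
  shows "is_even (rel_unit g 1 $ j $ i)"
proof -
  have "map_fps (map_fps sqrtC_neg) (rel_unit g 1) $ j $ i = rel_unit g 1 $ j $ i"
    by (simp only: rel_unit_even[OF assms])
  hence "sqrtC_neg (rel_unit g 1 $ j $ i) = rel_unit g 1 $ j $ i" by simp
  hence "Polynomial.coeff (sqrtC_neg (rel_unit g 1 $ j $ i)) n = Polynomial.coeff (rel_unit g 1 $ j $ i) n" for n
    by simp
  hence c: "(- 1) ^ n * Polynomial.coeff (rel_unit g 1 $ j $ i) n = Polynomial.coeff (rel_unit g 1 $ j $ i) n" for n
    by (simp only: sqrtC_neg_def coeff_pcompose_linear)
  have "Polynomial.coeff (rel_unit g 1 $ j $ i) n = 0" if "odd n" for n
  proof -
    have "- Polynomial.coeff (rel_unit g 1 $ j $ i) n = Polynomial.coeff (rel_unit g 1 $ j $ i) n"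
      using c[of n] that by simp
    thus ?thesis by (simp add: equal_neg_zero neg_equal_zero)
  qed
  thus ?thesis by (simp add: is_even_def)
qed

lemma rel_unit_minus_nth: "rel_unit g (- 1) $ j $ i = H_shift (rel_unit g 1 $ j $ i)"
  unfolding rel_unit_shift[symmetric] by simp

text \<open>The images \<open>w x\<^sup>+\<close> and \<open>x\<^sup>-\<close> multiply as the last two defining relations prescribe. In the second
  product, \<open>x\<^sup>-\<close> moves past \<open>w\<close> by the shift of \<open>H\<close>, which also relates the two structure series.\<close>

lemma HC_eval_rel_rhs:
  assumes "g \<ge> 1"
  shows "HC_eval (rel_rhs g 1 $ j $ i) = HC_eval (rel_unit g 1 $ j $ i) * Ux * Uy"
    and "HC_eval (rel_rhs g (- 1) $ j $ i) = Uy * (HC_eval (rel_unit g 1 $ j $ i) * Ux)"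
proof -
  have nth: "rel_rhs g \<sigma> $ j $ i = rel_unit g \<sigma> $ j $ i * (He_poly \<sigma> 1 * He_poly \<sigma> (- 1))" for \<sigma>
    unfolding rel_rhs_eq by simp
  note ev = rel_unit_coeff_even[OF assms, of j i]
  hence ev': "is_even (rel_unit g (- 1) $ j $ i)"
    by (simp add: rel_unit_minus_nth is_even_def H_shift_coeff)
  show "HC_eval (rel_rhs g 1 $ j $ i) = HC_eval (rel_unit g 1 $ j $ i) * Ux * Uy"
    unfolding nth HC_eval_mult[OF ev He_poly_even[of 1, simplified]] HC_eval_He_poly by (simp only: mult.assoc)
  show "HC_eval (rel_rhs g (- 1) $ j $ i) = Uy * (HC_eval (rel_unit g 1 $ j $ i) * Ux)"
    unfolding nth using HC_eval_mult[OF ev' He_poly_even[of "- 1"]]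
    by (simp add: HC_eval_He_poly rel_unit_minus_nth mult.assoc[symmetric] Uy_HC_eval)
qed

section \<open>The homomorphisms to the constant deformations\<close>

abbreviation fps_const2 :: "'a::zero \<Rightarrow> 'a fps fps" where "fps_const2 u \<equiv> fps_const (fps_const u)"

lemma fps_const2_hom: "ring_hom1 (fps_const2 :: 'a::ring_1 \<Rightarrow> _)"
  by (rule ring_hom1_comp[OF fps_const_hom fps_const_hom])

definition rel_unit_image :: "nat \<Rightarrow> usl2 fps fps" where
  "rel_unit_image g = map_fps (map_fps HC_eval) (rel_unit g 1)"

definition Uhh'_unit :: "complex \<Rightarrow> usl2 fps fps" where "Uhh'_unit c = fps_const2 (usl2_unit c)"

text \<open>The rescaling \<open>X\<^sup>+ \<mapsto> w x\<^sup>+\<close>.\<close>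

definition Uhh'_gen_value :: "nat \<Rightarrow> sl2C_gen \<Rightarrow> usl2 fps fps" where
  "Uhh'_gen_value g v = (case v of XXp \<Rightarrow> rel_unit_image g * fps_const2 Ux | XXm \<Rightarrow> fps_const2 Uy
     | HH \<Rightarrow> fps_const2 UH | CC \<Rightarrow> fps_const2 casimir)"

definition Uhh'_eval :: "nat \<Rightarrow> sl2C_gen free_alg \<Rightarrow> usl2 fps fps" where
  "Uhh'_eval g = free_eval Uhh'_unit (Uhh'_gen_value g)"

definition Uh_unit :: "complex \<Rightarrow> usl2 fps" where "Uh_unit c = fps_const (usl2_unit c)"

definition Uh_gen_value :: "nat \<Rightarrow> sl2_gen \<Rightarrow> usl2 fps" where
  "Uh_gen_value g v = (case v of Xp \<Rightarrow> rel_unit_image g $ 0 * fps_const Ux | Xm \<Rightarrow> fps_const Uy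
     | Hg \<Rightarrow> fps_const UH)"

definition Uh_eval :: "nat \<Rightarrow> sl2_gen free_alg \<Rightarrow> usl2 fps" where
  "Uh_eval g = free_eval Uh_unit (Uh_gen_value g)"

lemma fps_const_central: "central u \<Longrightarrow> central (fps_const u)" for u :: "'a::ring_1"
  by (simp add: central_def fps_eq_iff)

lemma alg_unit_fps_const:
  assumes "alg_unit \<kappa>" shows "alg_unit (\<lambda>c. fps_const (\<kappa> c))"
  using assms unfolding alg_unit_def by (auto intro: ring_hom1_comp[OF fps_const_hom] fps_const_central)

lemma Uh_unit: "alg_unit Uh_unit"
  unfolding Uh_unit_def[abs_def] by (intro alg_unit_fps_const usl2_unit)

lemma Uhh'_unit: "alg_unit Uhh'_unit"
  unfolding Uhh'_unit_def[abs_def] by (intro alg_unit_fps_const usl2_unit)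

lemma Uhh'_eval_hom: "ring_hom1 (Uhh'_eval g)"
  unfolding Uhh'_eval_def by (rule free_eval_hom[OF Uhh'_unit])

lemma Uh_eval_hom: "ring_hom1 (Uh_eval g)"
  unfolding Uh_eval_def by (rule free_eval_hom[OF Uh_unit])

lemma fps_extend1_map: "fps_extend1 \<theta> (map_fps s x) = fps_extend1 (\<lambda>a. \<theta> (s a)) x"
  by (simp add: fps_eq_iff fps_extend1_nth)

lemma fps_extend2_map: "fps_extend2 \<theta> (map_fps (map_fps s) x) = fps_extend2 (\<lambda>a. \<theta> (s a)) x"
  by (simp add: fps_eq_iff fps_extend2_nth)

lemma fps_extend1_const_values: "fps_extend1 (\<lambda>a. fps_const (f a)) x = map_fps f x"
proof (rule fps_ext)
  fix n
  have "(\<Sum>k\<le>n. fps_const (f (x $ k)) $ (n - k)) = (\<Sum>k\<in>{n}. fps_const (f (x $ k)) $ (n - k))"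
    by (rule sum.mono_neutral_right) auto
  thus "fps_extend1 (\<lambda>a. fps_const (f a)) x $ n = map_fps f x $ n"
    by (simp add: fps_extend1_nth)
qed

lemma fps_extend2_const_values:
  fixes f :: "'a \<Rightarrow> 'b::ring_1"
  shows "fps_extend2 (\<lambda>a. fps_const2 (f a)) x = map_fps (map_fps f) x"
proof -
  have s: "fps_swap (fps_const2 u) = fps_const2 u" for u :: 'b
    by (rule fps2_eqI) auto
  have "fps_swap (map_fps fps_const (map_fps f x)) = fps_const (map_fps f x)" for x
    by (rule fps2_eqI) auto
  hence "fps_swap (fps_extend1 (\<lambda>a. fps_const2 (f a)) x) = fps_const (map_fps f x)" for x
    unfolding fps_extend1_const_values[of "\<lambda>a. fps_const (f a)"] by (simp add: map_fps_def)
  thus ?thesis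
    unfolding fps_extend2_def s by (simp add: fps_extend1_const_values)
qed

lemma poly_at_Hg_eval: "Uh_eval g (poly_at_Hg p) = fps_const (H_eval p)"
proof -
  have "Uh_eval g (poly_at_Hg p) = (\<Sum>k\<le>Polynomial.degree p. fps_const (usl2_unit (Polynomial.coeff p k)) * fps_const UH ^ k)"
    unfolding poly_at_Hg_def ring_hom1_sum[OF Uh_eval_hom]
    by (simp add: Uh_eval_def free_eval_scale[OF Uh_unit] ring_hom1_power[OF free_eval_hom[OF Uh_unit]]
        free_eval_gen[OF Uh_unit] Uh_gen_value_def Uh_unit_def)
  also have "\<dots> = fps_const (H_eval p)"
    unfolding H_eval_def poly_eval_def ring_hom1_sum[OF fps_const_hom] ring_hom1_mult[OF fps_const_hom]
      ring_hom1_power[OF fps_const_hom] ..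
  finally show ?thesis .
qed

lemma subst_HC_eval: "Uhh'_eval g (subst_HC q) = fps_const2 (HC_eval q)"
proof -
  have "Uhh'_eval g (subst_HC q) = (\<Sum>b\<le>Polynomial.degree q. \<Sum>a\<le>Polynomial.degree (Polynomial.coeff q (2 * b)).
      fps_const2 (usl2_unit (Polynomial.coeff (Polynomial.coeff q (2 * b)) a)) * (fps_const2 UH ^ a * fps_const2 casimir ^ b))"
    unfolding subst_HC_def ring_hom1_sum[OF Uhh'_eval_hom]
    by (simp add: Uhh'_eval_def free_eval_scale[OF Uhh'_unit] ring_hom1_power[OF free_eval_hom[OF Uhh'_unit]]
        ring_hom1_mult[OF free_eval_hom[OF Uhh'_unit]] free_eval_gen[OF Uhh'_unit] Uhh'_gen_value_def Uhh'_unit_def)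
  also have "\<dots> = fps_const2 (HC_eval q)"
    unfolding HC_eval_sum ring_hom1_sum[OF fps_const2_hom] ring_hom1_mult[OF fps_const2_hom]
      ring_hom1_power[OF fps_const2_hom] ..
  finally show ?thesis .
qed

lemma casimir_commutator: "commutator (fps_const2 casimir) x = 0"
  by (simp add: commutator_def fps_eq_iff casimir_central)

lemma rel_unit_image_commute: "fps_const2 UH * rel_unit_image g = rel_unit_image g * fps_const2 UH"
  by (simp add: fps_eq_iff rel_unit_image_def HC_eval_commute)

text \<open>Everything commutes with the Casimir element, \<open>w\<close> commutes with \<open>H\<close>, and the two products are
  those of \<open>HC_eval_rel_rhs\<close>.\<close>

lemma Uhh'_relators_kernel:
  assumes "g \<ge> 1" "r \<in> Uhh'_relators g"
  shows "fps_extend2 (Uhh'_eval g) r = 0"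
proof -
  let ?E = "fps_extend2 (Uhh'_eval g)"
  note E = fps_extend2_hom[OF Uhh'_eval_hom[of g]]
  have gen: "?E (fps_const2 (free_gen v)) = Uhh'_gen_value g v" for v
    unfolding fps_extend2_const[OF ring_hom1_additive[OF Uhh'_eval_hom]]
    by (simp add: Uhh'_eval_def free_eval_gen[OF Uhh'_unit])
  have rhs: "?E (map_fps (map_fps subst_HC) s) = map_fps (map_fps HC_eval) s" for s
    by (simp only: fps_extend2_map subst_HC_eval fps_extend2_const_values)
  have hx: "commutator (fps_const2 UH) (rel_unit_image g * fps_const2 Ux) - 2 * (rel_unit_image g * fps_const2 Ux) = 0"
  proof -
    have "fps_const2 UH * (rel_unit_image g * fps_const2 Ux) =
        rel_unit_image g * (fps_const2 (UH * Ux))"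
      by (simp add: mult.assoc[symmetric] rel_unit_image_commute) (simp add: mult.assoc)
    also have "fps_const2 (UH * Ux) = fps_const2 Ux * fps_const2 UH + fps_const2 Ux + fps_const2 Ux"
      by (simp add: usl2_relations(1) mult_2 add.assoc)
    finally show ?thesis
      by (simp add: commutator_def distrib_left mult.assoc mult_2 del: fps_const_mult fps_const_add)
  qed
  have hy: "commutator (fps_const2 UH) (fps_const2 Uy) + 2 * fps_const2 Uy = 0"
  proof -
    have "fps_const2 UH * fps_const2 Uy = fps_const2 (Uy * UH - Uy - Uy)"
      by (simp add: usl2_normal(2))
    thus ?thesis by (simp add: commutator_def mult_2)
  qed
  have xy: "rel_unit_image g * fps_const2 Ux * fps_const2 Uy = map_fps (map_fps HC_eval) (rel_rhs g 1)"
    by (rule fps2_eqI) (simp add: rel_unit_image_def HC_eval_rel_rhs[OF assms(1)])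
  have yx: "fps_const2 Uy * (rel_unit_image g * fps_const2 Ux) = map_fps (map_fps HC_eval) (rel_rhs g (- 1))"
    by (rule fps2_eqI) (simp add: rel_unit_image_def HC_eval_rel_rhs[OF assms(1)])
  show ?thesis
    using assms(2) unfolding Uhh'_relators_def Let_def
    by (auto simp: ring_hom1_simps[OF E] ring_hom1_numeral[OF E] ring_hom1_commutator[OF E] gen rhs
        Uhh'_gen_value_def casimir_commutator hx hy xy yx simp del: fps_const_mult)
qed

text \<open>The relation for the commutator is the difference of the two product relations at \<open>h' = 0\<close>.\<close>

lemma Uh_relators_kernel:
  assumes "g \<ge> 1" "r \<in> Uh_relators"
  shows "fps_extend1 (Uh_eval g) r = 0"
proof -
  let ?E = "fps_extend1 (Uh_eval g)" and ?W = "rel_unit_image g $ 0"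
  note E = fps_extend1_hom[OF Uh_eval_hom[of g]]
  have gen: "?E (fps_const (free_gen v)) = Uh_gen_value g v" for v
    unfolding fps_extend1_const[OF ring_hom1_additive[OF Uh_eval_hom]]
    by (simp add: Uh_eval_def free_eval_gen[OF Uh_unit])
  have comm: "fps_const UH * ?W = ?W * fps_const UH"
    by (simp add: fps_eq_iff rel_unit_image_def HC_eval_commute)
  have hx: "commutator (fps_const UH) (?W * fps_const Ux) - 2 * (?W * fps_const Ux) = 0"
  proof -
    have "fps_const UH * (?W * fps_const Ux) = ?W * fps_const (UH * Ux)"
      by (simp add: mult.assoc[symmetric] comm) (simp add: mult.assoc)
    also have "fps_const (UH * Ux) = fps_const Ux * fps_const UH + fps_const Ux + fps_const Ux"
      by (simp add: usl2_relations(1) mult_2 add.assoc)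
    finally show ?thesis
      by (simp add: commutator_def distrib_left mult.assoc mult_2 del: fps_const_mult fps_const_add)
  qed
  have hy: "commutator (fps_const UH) (fps_const Uy) + 2 * fps_const Uy = 0"
  proof -
    have "fps_const UH * fps_const Uy = fps_const (Uy * UH - Uy - Uy)"
      by (simp add: usl2_normal(2))
    thus ?thesis by (simp add: commutator_def mult_2)
  qed
  have "?E (map_fps poly_at_Hg q) = map_fps H_eval q" for q
    by (simp only: fps_extend1_map poly_at_Hg_eval fps_extend1_const_values)
  moreover have "commutator (?W * fps_const Ux) (fps_const Uy) =
      map_fps HC_eval (rel_rhs g 1 $ 0 - rel_rhs g (- 1) $ 0)"
    by (rule fps_ext)
      (simp add: rel_unit_image_def HC_eval_rel_rhs[OF assms(1)] commutator_def additive.diff[OF HC_eval_additive])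
  moreover have "map_fps HC_eval (map_fps (\<lambda>p. [:p:]) q) = map_fps H_eval q" for q
    by (simp add: fps_eq_iff HC_eval_const)
  ultimately have xy: "commutator (?W * fps_const Ux) (fps_const Uy) - ?E (map_fps poly_at_Hg (exact_quot sinh_hH sinh_h)) = 0"
    by (simp add: rel_rhs_at_0_diff)
  show ?thesis
    using assms(2) unfolding Uh_relators_def Let_def
    by (auto simp: ring_hom1_simps[OF E] ring_hom1_numeral[OF E] ring_hom1_commutator[OF E] gen
        Uh_gen_value_def hx hy xy)
qed

section \<open>Spanning by ordered monomials\<close>

text \<open>The quotient was identified with a difference of structure series, whose constant term is known.\<close>

lemma sinh_quot_0: "exact_quot sinh_hH sinh_h $ 0 = [:0, 1:]"
proof -
  have "(rel_rhs 1 1 $ 0 - rel_rhs 1 (- 1) $ 0) $ 0 = [:[:0, 1:]:]"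
    by (simp add: rel_rhs_eq rel_unit_0 He_poly_mult)
  thus ?thesis unfolding rel_rhs_at_0_diff by simp
qed

lemma Uh_span_constant_term:
  "\<exists>u. \<exists>j\<in>gen_ideal Uh_relators. p - pbw_lift Xm Hg Xp u = j $ 0"
proof (rule exI, rule gen_ideal_lift[OF fps_nth_0_hom _ pbw_lift_span])
  show "fps_const a $ 0 = a" for a :: "sl2_gen free_alg" by simp
  have "poly_at_Hg [:0, 1:] = free_gen Hg"
    by (simp add: poly_at_Hg_def free_scale_def)
  hence "(\<lambda>r. r $ 0) ` Uh_relators = usl2_relators"
    by (simp add: Uh_relators_def usl2_relators_def Let_def commutator_def sinh_quot_0)
  hence "s \<in> (\<lambda>r. r $ 0) ` Uh_relators" if "s \<in> usl2_relators" for s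
    using that by simp
  thus "\<exists>j\<in>gen_ideal Uh_relators. s = j $ 0" if "s \<in> usl2_relators" for s
    using that gen_ideal_gen by blast
qed

lemma Uh_span: "\<exists>u. x - map_fps (pbw_lift Xm Hg Xp) u \<in> adic_closure1 (gen_ideal Uh_relators)"
  by (rule fps_span_closure1[OF pbw_lift_additive Uh_span_constant_term])

lemma subst_HC_He_poly:
  assumes "\<sigma> = 1 \<or> \<sigma> = - 1"
  shows "subst_HC (He_poly \<sigma> 1 * He_poly \<sigma> (- 1)) =
    free_scale (- 1 / 4) 1 + free_scale (\<sigma> / 2) (free_gen HH) + free_scale (- 1 / 4) (free_gen HH * free_gen HH)
      + free_scale (1 / 4) (free_gen CC)"
  unfolding He_poly_mult[OF assms] subst_HC_def
  using assms by (auto simp: numeral_2_eq_2 coeff_pCons free_scale_def[of 0])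

definition Uhh'_letter :: "sl2_gen \<Rightarrow> sl2C_gen" where
  "Uhh'_letter v = (case v of Xp \<Rightarrow> XXp | Xm \<Rightarrow> XXm | Hg \<Rightarrow> HH)"

abbreviation free_unit :: "complex \<Rightarrow> 'x free_alg" where "free_unit c \<equiv> Poly_Mapping.single 0 c"

lemma quarter_free_scale:
  "free_scale (1 / 4) v + free_scale (1 / 4) v + free_scale (1 / 4) v + free_scale (1 / 4) v = v"
  for v :: "'x free_alg"
proof -
  have "free_unit (1 / 4) + free_unit (1 / 4) + free_unit (1 / 4) + free_unit (1 / 4) = (1 :: 'x free_alg)"
    by (simp add: single_add[symmetric])
  hence "(free_unit (1 / 4) + free_unit (1 / 4) + free_unit (1 / 4) + free_unit (1 / 4)) * v = 1 * v"
    by (simp only:)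
  thus ?thesis by (simp add: distrib_right free_scale_def)
qed

lemma free_scale_half: "free_scale (c / 2) v = free_scale (c / 4) v + free_scale (c / 4) v"
  by (simp add: free_scale_def distrib_right[symmetric] single_add[symmetric])

lemma free_scale_uminus: "free_scale (- c) v = - free_scale c v"
  by (simp add: free_scale_def single_uminus)

text \<open>Modulo the parameters, the last relation expresses \<open>C\<close> by the other generators. Hence every element is
  congruent to one in \<open>X\<^sup>\<plusminus>\<close> and \<open>H\<close>, and on these the relations of \<open>U(sl\<^sub>2)\<close> hold. Here \<open>\<pi>\<close>
  eliminates \<open>C\<close> and \<open>\<iota>\<close> includes the three letters into the four.\<close>

lemma Uhh'_span_constant_term:
  "\<exists>u. \<exists>j\<in>gen_ideal (Uhh'_relators g). p - pbw_lift XXm HH XXp u = j $ 0 $ 0"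
proof -
  let ?x = "free_gen XXp" and ?y = "free_gen XXm" and ?h = "free_gen HH" and ?c = "free_gen CC"
  let ?S = "(\<lambda>r. r $ 0 $ 0) ` Uhh'_relators g" and ?f = "\<lambda>\<sigma>. subst_HC (He_poly \<sigma> 1 * He_poly \<sigma> (- 1))"
  define \<iota> where "\<iota> = free_eval free_unit (\<lambda>v. free_gen (Uhh'_letter v))"
  define \<pi> where "\<pi> = free_eval free_unit (\<lambda>v. case v of XXp \<Rightarrow> free_gen Xp | XXm \<Rightarrow> free_gen Xm
     | HH \<Rightarrow> free_gen Hg | CC \<Rightarrow> free_gen Xm * free_gen Xp + free_gen Xm * free_gen Xp
       + free_gen Xm * free_gen Xp + free_gen Xm * free_gen Xp + (free_gen Hg + 1) * (free_gen Hg + 1))"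
  have \<iota>: "ring_hom1 \<iota>" and \<pi>: "ring_hom1 \<pi>"
    unfolding \<iota>_def \<pi>_def by (rule free_eval_hom[OF free_alg_unit])+
  have \<iota>_gen: "\<iota> (free_gen v) = free_gen (Uhh'_letter v)" for v
    by (simp add: \<iota>_def free_eval_gen[OF free_alg_unit])
  have S: "?S = {commutator ?c ?x, commutator ?c ?y, commutator ?c ?h, commutator ?h ?x - 2 * ?x,
      commutator ?h ?y + 2 * ?y, ?x * ?y - ?f 1, ?y * ?x - ?f (- 1)}"
    by (simp add: Uhh'_relators_def Let_def commutator_def rel_rhs_eq rel_unit_0)
  have Sgen: "r \<in> gen_ideal ?S" if "r \<in> {commutator ?h ?x - 2 * ?x,
      commutator ?h ?y + 2 * ?y, ?x * ?y - ?f 1, ?y * ?x - ?f (- 1)}" for r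
    using that by (intro gen_ideal_gen) (auto simp: S)
  have c: "?c - (?y * ?x + ?y * ?x + ?y * ?x + ?y * ?x + (?h + 1) * (?h + 1)) \<in> gen_ideal ?S"
  proof -
    let ?r = "?y * ?x - ?f (- 1)"
    have "?r \<in> gen_ideal ?S" by (rule Sgen) simp
    hence "- (?r + ?r + ?r + ?r) \<in> gen_ideal ?S" by (intro gen_ideal_uminus gen_ideal_add)
    moreover have "?f (- 1) + ?f (- 1) + ?f (- 1) + ?f (- 1) = ?c - (?h + 1) * (?h + 1)"
      using quarter_free_scale[of 1] quarter_free_scale[of ?h] quarter_free_scale[of "?h * ?h"] quarter_free_scale[of ?c]
      by (simp add: subst_HC_He_poly free_scale_half free_scale_uminus algebra_simps)
    hence "- (?r + ?r + ?r + ?r) = ?c - (?y * ?x + ?y * ?x + ?y * ?x + ?y * ?x + (?h + 1) * (?h + 1))"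
      by (simp add: algebra_simps)
    ultimately show ?thesis by (simp only:)
  qed
  have gen: "free_gen v - \<iota> (\<pi> (free_gen v)) \<in> gen_ideal ?S" for v
    using c by (cases v) (simp_all add: \<pi>_def free_eval_gen[OF free_alg_unit] ring_hom1_simps[OF \<iota>] \<iota>_gen
        Uhh'_letter_def gen_ideal_0)
  have retract: "p - \<iota> (\<pi> p) \<in> gen_ideal ?S" for p
  proof (induction p rule: free_alg_induct)
    case (add p q)
    have "p + q - \<iota> (\<pi> (p + q)) = (p - \<iota> (\<pi> p)) + (q - \<iota> (\<pi> q))"
      by (simp add: ring_hom1_simps[OF \<iota>] ring_hom1_simps[OF \<pi>])
    thus ?case using gen_ideal_add[OF add] by (simp only:)
  next
    case (gen_mult v p)
    have "free_gen v * p - \<iota> (\<pi> (free_gen v * p)) =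
        free_gen v * (p - \<iota> (\<pi> p)) + (free_gen v - \<iota> (\<pi> (free_gen v))) * \<iota> (\<pi> p)"
      by (simp add: ring_hom1_simps[OF \<iota>] ring_hom1_simps[OF \<pi>] algebra_simps)
    thus ?case using gen_ideal_add[OF gen_ideal_mult_left[OF gen_mult] gen_ideal_mult_right[OF gen]] by simp
  next
    case (scalar c)
    show ?case
      by (simp add: \<iota>_def \<pi>_def free_eval_scalar[OF free_alg_unit] gen_ideal_0)
  qed
  have \<iota>_rel: "\<iota> r \<in> gen_ideal ?S" if "r \<in> usl2_relators" for r
  proof -
    have "?f 1 - ?f (- 1) = ?h"
      using quarter_free_scale[of ?h]
      by (simp add: subst_HC_He_poly free_scale_half free_scale_uminus algebra_simps)
    hence "commutator ?x ?y - ?h = (?x * ?y - ?f 1) - (?y * ?x - ?f (- 1))"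
      by (simp add: commutator_def algebra_simps)
    also have "\<dots> \<in> gen_ideal ?S" by (intro gen_ideal_diff Sgen) auto
    finally have "commutator ?x ?y - ?h \<in> gen_ideal ?S" .
    moreover have "commutator ?h ?x - 2 * ?x \<in> gen_ideal ?S" "commutator ?h ?y + 2 * ?y \<in> gen_ideal ?S"
      by (rule Sgen, simp)+
    ultimately show ?thesis using that
      by (auto simp: usl2_relators_def ring_hom1_simps[OF \<iota>] ring_hom1_commutator[OF \<iota>] ring_hom1_numeral[OF \<iota>]
          \<iota>_gen Uhh'_letter_def)
  qed
  have \<iota>_lift: "\<iota> (pbw_lift Xm Hg Xp u) = pbw_lift XXm HH XXp u" for u
    unfolding \<iota>_def pbw_lift_eval[OF free_alg_unit] by (simp add: pbw_lift_def free_scale_eq Uhh'_letter_def)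
  have "\<iota> (\<pi> p - pbw_lift Xm Hg Xp (abs_usl2 (\<pi> p))) \<in> gen_ideal ?S"
    by (rule ring_hom1_gen_ideal[OF \<iota> pbw_lift_span \<iota>_rel])
  from gen_ideal_add[OF retract[of p] this]
  have "p - pbw_lift XXm HH XXp (abs_usl2 (\<pi> p)) \<in> gen_ideal ?S"
    by (simp add: ring_hom1_diff[OF \<iota>] \<iota>_lift)
  hence "\<exists>j\<in>gen_ideal (Uhh'_relators g). p - pbw_lift XXm HH XXp (abs_usl2 (\<pi> p)) = j $ 0 $ 0"
  proof (rule gen_ideal_lift[OF ring_hom1_comp[OF fps_nth_0_hom fps_nth_0_hom], rotated])
    show "fps_const2 a $ 0 $ 0 = a" for a :: "sl2C_gen free_alg" by simp
    show "\<exists>j\<in>gen_ideal (Uhh'_relators g). s = j $ 0 $ 0" if "s \<in> ?S" for s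
      using that by (auto intro: gen_ideal_gen)
  qed
  thus ?thesis by blast
qed

lemma Uhh'_span: "\<exists>u. x - map_fps (map_fps (pbw_lift XXm HH XXp)) u \<in> adic_closure2 (gen_ideal (Uhh'_relators g))"
  by (rule fps_span_closure2[OF pbw_lift_additive Uhh'_span_constant_term])

section \<open>The module identifications\<close>

lemma inv_usl2_pbw_single:
  "inv_into UNIV usl2_pbw (usl2_unit d * (Uy ^ a * UH ^ b * Ux ^ c)) = Poly_Mapping.single (a, b, c) d"
  unfolding usl2_pbw_single[symmetric] using usl2_pbw_bij by (simp add: bij_is_inj)

lemma pbw_lift_single:
  "pbw_lift y z x (usl2_unit d * (Uy ^ a * UH ^ b * Ux ^ c)) =
    free_unit d * (free_gen y ^ a * free_gen z ^ b * free_gen x ^ c)"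
  unfolding pbw_lift_def inv_usl2_pbw_single free_scale_eq by (rule pbw_comb_single[OF free_alg_unit])

lemma pbw_lift_scale: "pbw_lift y z x (usl2_unit c * u) = free_unit c * pbw_lift y z x u"
proof -
  note L = pbw_lift_additive[of y z x]
  note P = usl2_pbw_additive
  have "pbw_lift y z x (usl2_unit c * usl2_pbw f) = free_unit c * pbw_lift y z x (usl2_pbw f)" for f
  proof (induction f rule: pm_induct)
    case zero
    show ?case by (simp add: additive.zero[OF P] additive.zero[OF L])
  next
    case (add f f')
    thus ?case by (simp add: additive.add[OF P] additive.add[OF L] distrib_left)
  next
    case (single k d)
    obtain a b e where k: "k = (a, b, e)" by (cases k)
    have e: "usl2_unit c * (usl2_unit d * (Uy ^ a * UH ^ b * Ux ^ e)) =
        usl2_unit (c * d) * (Uy ^ a * UH ^ b * Ux ^ e)"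
      by (simp only: ring_hom1_mult[OF usl2_unit_hom] mult.assoc)
    thus ?case
      unfolding k usl2_pbw_single e pbw_lift_single
      by (simp only: ring_hom1_mult[OF alg_unitD(1)[OF free_alg_unit]] mult.assoc)
  qed
  thus ?thesis using usl2_pbw_bij by (metis bij_is_surj surj_def)
qed

lemma pbw_lift_1: "pbw_lift y z x 1 = 1"
  using pbw_lift_single[of y z x 1 0 0 0] by (simp add: ring_hom1_1[OF usl2_unit_hom])

text \<open>The composition of the identification of modules with the homomorphism to the constant deformation,
  restricted to \<open>U(sl\<^sub>2)\<close>. Its extension to power series is the trivialisation.\<close>

definition Uh_base_map :: "nat \<Rightarrow> usl2 \<Rightarrow> usl2 fps" where
  "Uh_base_map g u = Uh_eval g (pbw_lift Xm Hg Xp u)"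

definition Uhh'_base_map :: "nat \<Rightarrow> usl2 \<Rightarrow> usl2 fps fps" where
  "Uhh'_base_map g u = Uhh'_eval g (pbw_lift XXm HH XXp u)"

definition Uh_trivialisation :: "nat \<Rightarrow> usl2 fps \<Rightarrow> usl2 fps" where
  "Uh_trivialisation g = fps_extend1 (Uh_base_map g)"

definition Uhh'_trivialisation :: "nat \<Rightarrow> usl2 fps fps \<Rightarrow> usl2 fps fps" where
  "Uhh'_trivialisation g = fps_extend2 (Uhh'_base_map g)"

lemma Uh_base_map_eq: "Uh_base_map g u = pbw_comb (\<lambda>c v. Uh_unit c * v)
    (fps_const Uy) (fps_const UH) (rel_unit_image g $ 0 * fps_const Ux) (inv_into UNIV usl2_pbw u)"
  unfolding Uh_base_map_def Uh_eval_def pbw_lift_eval[OF Uh_unit] by (simp add: Uh_gen_value_def)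

lemma Uhh'_base_map_eq: "Uhh'_base_map g u = pbw_comb (\<lambda>c v. Uhh'_unit c * v)
    (fps_const2 Uy) (fps_const2 UH) (rel_unit_image g * fps_const2 Ux) (inv_into UNIV usl2_pbw u)"
  unfolding Uhh'_base_map_def Uhh'_eval_def pbw_lift_eval[OF Uhh'_unit] by (simp add: Uhh'_gen_value_def)

lemma Uhh'_base_map_at_0: "Uhh'_base_map g u $ 0 = Uh_base_map g u"
  unfolding Uhh'_base_map_eq Uh_base_map_eq
  by (subst ring_hom1_pbw_comb[OF fps_nth_0_hom, of Uhh'_unit Uh_unit])
    (simp_all add: Uhh'_unit_def Uh_unit_def)

text \<open>The specialisation at \<open>h = 0\<close> agrees with the one at \<open>h' = 0\<close> because that of \<open>w\<close> does.\<close>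

lemma Uhh'_base_map_swap_at_0:
  assumes "g \<ge> 1"
  shows "fps_swap (Uhh'_base_map g u) $ 0 = Uh_base_map g u"
proof -
  have s: "fps_swap (fps_const2 v) = fps_const2 v" for v :: usl2
    by (rule fps2_eqI) auto
  have "fps_swap (rel_unit_image g) = map_fps (map_fps HC_eval) (fps_swap (rel_unit g 1))"
    by (rule fps2_eqI) (simp add: rel_unit_image_def)
  hence "fps_swap (rel_unit_image g) $ 0 = rel_unit_image g $ 0"
    by (simp add: rel_unit_image_def rel_unit_swap_at_0[OF assms])
  thus ?thesis
    unfolding Uhh'_base_map_eq Uh_base_map_eq
    by (subst ring_hom1_pbw_comb[OF ring_hom1_comp[OF fps_nth_0_hom fps_swap_hom], of Uhh'_unit Uh_unit])
      (simp_all add: Uhh'_unit_def Uh_unit_def s ring_hom1_mult[OF fps_swap_hom])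
qed

lemma Uh_base_map_0: "Uh_base_map g u $ 0 = u"
proof -
  have "Uh_base_map g u $ 0 = usl2_pbw (inv_into UNIV usl2_pbw u)"
    unfolding Uh_base_map_eq usl2_pbw_eq
    by (subst ring_hom1_pbw_comb[OF fps_nth_0_hom, of Uh_unit usl2_unit])
      (simp_all add: Uh_unit_def rel_unit_image_def rel_unit_0 HC_eval_1)
  thus ?thesis using usl2_pbw_bij by (simp add: bij_is_surj surj_f_inv_f)
qed

lemma Uh_base_map_additive: "additive (Uh_base_map g)"
  by (simp add: additive_def Uh_base_map_def additive.add[OF pbw_lift_additive] ring_hom1_add[OF Uh_eval_hom])

lemma Uhh'_base_map_additive: "additive (Uhh'_base_map g)"
  by (simp add: additive_def Uhh'_base_map_def additive.add[OF pbw_lift_additive] ring_hom1_add[OF Uhh'_eval_hom])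

lemma Uh_trivialisation_additive: "additive (Uh_trivialisation g)"
  unfolding Uh_trivialisation_def by (rule fps_extend1_additive[OF Uh_base_map_additive])

lemma Uhh'_trivialisation_additive: "additive (Uhh'_trivialisation g)"
  unfolding Uhh'_trivialisation_def by (rule fps_extend2_additive[OF Uhh'_base_map_additive])

lemma Uh_trivialisation_bij: "bij (Uh_trivialisation g)"
  unfolding Uh_trivialisation_def by (rule fps_extend1_bij[OF Uh_base_map_additive Uh_base_map_0])

lemma Uhh'_trivialisation_bij: "bij (Uhh'_trivialisation g)"
  unfolding Uhh'_trivialisation_def
  by (rule fps_extend2_bij[OF Uhh'_base_map_additive]) (simp only: Uhh'_base_map_at_0 Uh_base_map_0)

lemma Uh_trivialisation_lift: "Uh_trivialisation g x = fps_extend1 (Uh_eval g) (map_fps (pbw_lift Xm Hg Xp) x)"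
  unfolding Uh_trivialisation_def fps_extend1_map Uh_base_map_def[abs_def] ..

lemma Uhh'_trivialisation_lift:
  "Uhh'_trivialisation g x = fps_extend2 (Uhh'_eval g) (map_fps (map_fps (pbw_lift XXm HH XXp)) x)"
  unfolding Uhh'_trivialisation_def fps_extend2_map Uhh'_base_map_def[abs_def] ..

lemma
  assumes "g \<ge> 1"
  shows ident_Uh_bij: "bij_betw ident_Uh UNIV (carrier Uh)"
    and Uh_trivialisation_mult: "Uh_trivialisation g (mult_Uh x y) = Uh_trivialisation g x * Uh_trivialisation g y"
proof -
  have kill: "fps_extend1 (Uh_eval g) z = 0" if "z \<in> adic_closure1 (gen_ideal Uh_relators)" for z
    by (rule fps_extend1_closure[OF Uh_eval_hom _ that]) (rule Uh_relators_kernel[OF assms])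
  have inj: "inj (\<lambda>u. fps_extend1 (Uh_eval g) (map_fps (pbw_lift Xm Hg Xp) u))"
    using bij_is_inj[OF Uh_trivialisation_bij[of g]] by (simp only: Uh_trivialisation_lift[abs_def])
  note T = transport_mult_quotient[OF two_sided_adic_closure1 fps_extend1_hom[OF Uh_eval_hom] kill inj Uh_span]
  show "bij_betw (ident_Uh) UNIV (carrier (Uh))"
    unfolding ident_Uh_def[abs_def] Uh_def top_presented1_def by (rule T(1))
  show "Uh_trivialisation g (mult_Uh x y) = Uh_trivialisation g x * Uh_trivialisation g y"
    unfolding Uh_trivialisation_lift mult_Uh_def ident_Uh_def[abs_def] Uh_def top_presented1_def by (rule T(2))
qed

lemma
  assumes "g \<ge> 1"
  shows ident_Uhh'_bij: "bij_betw (ident_Uhh' g) UNIV (carrier (Uhh' g))"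
    and Uhh'_trivialisation_mult: "Uhh'_trivialisation g (mult_Uhh' g x y) = Uhh'_trivialisation g x * Uhh'_trivialisation g y"
proof -
  have kill: "fps_extend2 (Uhh'_eval g) z = 0" if "z \<in> adic_closure2 (gen_ideal (Uhh'_relators g))" for z
    by (rule fps_extend2_closure[OF Uhh'_eval_hom _ that]) (rule Uhh'_relators_kernel[OF assms])
  have inj: "inj (\<lambda>u. fps_extend2 (Uhh'_eval g) (map_fps (map_fps (pbw_lift XXm HH XXp)) u))"
    using bij_is_inj[OF Uhh'_trivialisation_bij[of g]] by (simp only: Uhh'_trivialisation_lift[abs_def])
  note T = transport_mult_quotient[OF two_sided_adic_closure2 fps_extend2_hom[OF Uhh'_eval_hom] kill inj Uhh'_span]
  show "bij_betw (ident_Uhh' g) UNIV (carrier (Uhh' g))"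
    unfolding ident_Uhh'_def[abs_def] Uhh'_def top_presented2_def by (rule T(1))
  show "Uhh'_trivialisation g (mult_Uhh' g x y) = Uhh'_trivialisation g x * Uhh'_trivialisation g y"
    unfolding Uhh'_trivialisation_lift mult_Uhh'_def ident_Uhh'_def[abs_def] Uhh'_def top_presented2_def by (rule T(2))
qed

section \<open>Linearity over the power series ring\<close>

lemma fps_bilin_mult: "fps_bilin (*) = ((*) :: 'a::ring_1 fps \<Rightarrow> _)"
  by (simp add: fun_eq_iff fps_eq_iff fps_bilin_def fps_mult_nth)

definition scalar1 :: "complex fps \<Rightarrow> usl2 fps" where "scalar1 c = map_fps usl2_unit c"
definition scalar2 :: "complex fps fps \<Rightarrow> usl2 fps fps" where "scalar2 c = map_fps scalar1 c"

lemma fps_bilin_scalar1: "fps_bilin usl2_scale = (\<lambda>c x. scalar1 c * x)"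
  by (simp add: fun_eq_iff fps_eq_iff fps_bilin_def fps_mult_nth scalar1_def usl2_scale_eq)

lemma fps_bilin_scalar2: "fps_bilin (fps_bilin usl2_scale) = (\<lambda>c x. scalar2 c * x)"
  unfolding fps_bilin_scalar1
  by (simp add: fun_eq_iff fps_eq_iff[where 'a = "usl2 fps"] fps_bilin_def fps_mult_nth[where 'a = "usl2 fps"] scalar2_def)

lemma fps_central: "(\<And>n. central (z $ n)) \<Longrightarrow> central z" for z :: "'a::ring_1 fps"
proof (unfold central_def[of z], intro allI fps_ext)
  fix y :: "'a fps" and n
  assume "\<And>n. central (z $ n)"
  hence "(z * y) $ n = (\<Sum>i=0..n. y $ (n - i) * z $ i)"
    by (simp add: fps_mult_nth central_def)
  also have "\<dots> = (y * z) $ n"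
    unfolding fps_mult_nth by (rule sum.reindex_bij_witness[of _ "\<lambda>i. n - i" "\<lambda>i. n - i"]) auto
  finally show "(z * y) $ n = (y * z) $ n" .
qed

lemma scalar1_central: "central (scalar1 c)"
  using usl2_unit by (intro fps_central) (simp add: scalar1_def alg_unit_def)

lemma scalar2_central: "central (scalar2 c)"
  by (rule fps_central) (simp add: scalar2_def scalar1_central)

lemma Uh_trivialisation_scalar: "Uh_trivialisation g (scalar1 c * x) = scalar1 c * Uh_trivialisation g x"
proof -
  note E = fps_extend1_hom[OF Uh_eval_hom[of g]]
  have "map_fps (pbw_lift Xm Hg Xp) (scalar1 c * x) = map_fps free_unit c * map_fps (pbw_lift Xm Hg Xp) x"
    by (simp add: fps_eq_iff fps_mult_nth additive.sum[OF pbw_lift_additive] scalar1_def pbw_lift_scale)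
  moreover have "fps_extend1 (Uh_eval g) (map_fps free_unit c) = scalar1 c"
    by (simp add: fps_extend1_map Uh_eval_def free_eval_scalar[OF Uh_unit] Uh_unit_def
        fps_extend1_const_values scalar1_def)
  ultimately show ?thesis by (simp add: Uh_trivialisation_lift ring_hom1_mult[OF E])
qed

lemma Uhh'_trivialisation_scalar: "Uhh'_trivialisation g (scalar2 c * x) = scalar2 c * Uhh'_trivialisation g x"
proof -
  note E = fps_extend2_hom[OF Uhh'_eval_hom[of g]]
  let ?L = "map_fps (map_fps (pbw_lift XXm HH XXp))"
  have "?L (scalar2 c * x) = map_fps (map_fps free_unit) c * ?L x"
    by (rule fps2_eqI)
      (simp add: fps2_mult_nth additive.sum[OF pbw_lift_additive] scalar1_def scalar2_def pbw_lift_scale)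
  moreover have "fps_extend2 (Uhh'_eval g) (map_fps (map_fps free_unit) c) = scalar2 c"
    by (simp add: fps_extend2_map Uhh'_eval_def free_eval_scalar[OF Uhh'_unit] Uhh'_unit_def
        fps_extend2_const_values scalar2_def scalar1_def[abs_def])
  ultimately show ?thesis by (simp add: Uhh'_trivialisation_lift ring_hom1_mult[OF E])
qed

lemma Uhh'_trivialisation_1: "Uhh'_trivialisation g 1 = 1"
proof -
  have "?thesis \<longleftrightarrow> Uhh'_trivialisation g (fps_const2 1) = 1" by simp
  also have "\<dots> \<longleftrightarrow> Uhh'_base_map g 1 = 1"
    unfolding Uhh'_trivialisation_def fps_extend2_const[OF Uhh'_base_map_additive] ..
  finally show ?thesis
    by (simp add: Uhh'_base_map_def pbw_lift_1 ring_hom1_1[OF Uhh'_eval_hom])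
qed

lemma Uhh'_trivialisation_at_0: "Uhh'_trivialisation g x $ 0 = Uh_trivialisation g (x $ 0)"
  unfolding Uhh'_trivialisation_def Uh_trivialisation_def fps_extend2_at_0 Uhh'_base_map_at_0 ..

lemma Uhh'_trivialisation_swap_at_0: "g \<ge> 1 \<Longrightarrow> fps_swap (Uhh'_trivialisation g x) $ 0 = Uh_trivialisation g (fps_swap x $ 0)"
  unfolding Uhh'_trivialisation_def Uh_trivialisation_def fps_extend2_swap fps_extend2_at_0
  by (simp only: Uhh'_base_map_swap_at_0)

lemma Uh_trivialisation_0: "Uh_trivialisation g x $ 0 = x $ 0"
  by (simp add: Uh_trivialisation_def fps_extend1_nth Uh_base_map_0)

section \<open>Triviality\<close>

lemma algebra_structure_transport:
  fixes \<Theta> :: "'m::ring_1 \<Rightarrow> 'm"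
  assumes \<Theta>: "inj \<Theta>" "additive \<Theta>" "\<Theta> 1 = 1" "\<And>x y. \<Theta> (mul x y) = \<Theta> x * \<Theta> y"
    and s: "\<And>c x. \<Theta> (s c * x) = s c * \<Theta> x" "\<And>c. central (s c)"
  shows "algebra_structure (\<lambda>c x. s c * x) mul 1"
proof -
  have eqI: "x = y" if "\<Theta> x = \<Theta> y" for x y
    using \<Theta>(1) that by (simp add: inj_def)
  have c: "x * (s c * y) = s c * (x * y)" for c x y
    by (metis s(2)[unfolded central_def] mult.assoc)
  show ?thesis
    unfolding algebra_structure_def
    by (intro conjI allI; rule eqI)
      (simp_all add: \<Theta>(3,4) additive.add[OF \<Theta>(2)] s(1) c distrib_left distrib_right mult.assoc)
qed

lemma fps_bilin_additive_transport:
  assumes "additive \<Theta>" "\<And>x y. \<Theta> (m x y) = \<Theta> x * \<Theta> y"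
  shows "map_fps \<Theta> (fps_bilin m x y) = map_fps \<Theta> x * map_fps \<Theta> (y :: 'a::ring_1 fps)"
  by (simp add: fps_eq_iff fps_bilin_def fps_mult_nth additive.sum[OF assms(1)] assms(2))

lemma bij_map_fps:
  assumes "bij f" shows "bij (map_fps f)"
proof (rule bijI)
  show "inj (map_fps f)"
    using assms by (auto simp: inj_def fps_eq_iff bij_def)
  show "surj (map_fps f)"
    by (rule surjI[where f = "map_fps (inv_into UNIV f)"])
      (use assms in \<open>simp add: fps_eq_iff bij_is_surj surj_f_inv_f\<close>)
qed

text \<open>\<open>\<Theta>\<close> is the identity modulo both parameters only. Modulo \<open>h'\<close> it is \<open>\<Theta>\<^sub>0\<close>, which compares the
  undeformed product \<open>mul0\<close> with that of \<open>U(sl\<^sub>2)[[h]]\<close>; so the equivalence with the constant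
  deformation of \<open>mul0\<close> is \<open>\<Theta>\<close> followed by the coefficientwise inverse of \<open>\<Theta>\<^sub>0\<close>.\<close>

lemma trivial_formal_deformation1_transport:
  fixes \<Theta> :: "usl2 fps fps \<Rightarrow> usl2 fps fps"
  assumes \<Theta>: "bij \<Theta>" "additive \<Theta>" "\<Theta> 1 = 1" "\<And>x y. \<Theta> (mul x y) = \<Theta> x * \<Theta> y"
      "\<And>c x. \<Theta> (scalar2 c * x) = scalar2 c * \<Theta> x"
    and \<Theta>0: "bij \<Theta>0" "additive \<Theta>0" "\<And>x y. \<Theta>0 (mul0 x y) = \<Theta>0 x * \<Theta>0 y"
      "\<And>c x. \<Theta>0 (scalar1 c * x) = scalar1 c * \<Theta>0 x"
    and at0: "\<And>x. \<Theta> x $ 0 = \<Theta>0 (x $ 0)"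
  shows "trivial_formal_deformation1 (fps_bilin usl2_scale) mul0 1 mul"
proof -
  let ?T = "map_fps \<Theta>0"
  define \<phi> where "\<phi> x = inv_into UNIV ?T (\<Theta> x)" for x
  have bT: "bij ?T" by (rule bij_map_fps[OF \<Theta>0(1)])
  have T\<phi>: "?T (\<phi> x) = \<Theta> x" for x
    using bT by (simp add: \<phi>_def bij_is_surj surj_f_inv_f)
  have eqI: "x = y" if "?T x = ?T y" for x y
    using bT that by (simp add: bij_def inj_def)
  have eqI0: "x = y" if "\<Theta>0 x = \<Theta>0 y" for x y
    using \<Theta>0(1) that by (simp add: bij_def inj_def)
  note Tadd = map_fps_additive[OF \<Theta>0(2)]
  have Tscalar: "?T (scalar2 c * x) = scalar2 c * ?T x" for c x
    by (simp add: fps_eq_iff[where 'a = "usl2 fps"] fps_mult_nth[where 'a = "usl2 fps"]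
        additive.sum[OF \<Theta>0(2)] scalar2_def \<Theta>0(4))
  have alg: "algebra_structure (\<lambda>c x. scalar2 c * x) mul 1"
    by (rule algebra_structure_transport[of \<Theta>]) (use \<Theta> scalar2_central in \<open>auto intro: bij_is_inj\<close>)
  have ct: "mul x y $ 0 = mul0 (x $ 0) (y $ 0)" for x y
    by (rule eqI0) (simp add: at0[symmetric] \<Theta>(4) \<Theta>0(3))
  have "bij (\<lambda>x. inv_into UNIV ?T (\<Theta> x))"
    using bij_comp[OF \<Theta>(1) bij_imp_bij_inv[OF bT]] by (simp add: o_def)
  hence "bij \<phi>" by (simp add: \<phi>_def[abs_def])
  moreover have "\<phi> (x + y) = \<phi> x + \<phi> y" for x y
    by (rule eqI) (simp add: T\<phi> additive.add[OF Tadd] additive.add[OF \<Theta>(2)])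
  moreover have "\<phi> (scalar2 c * x) = scalar2 c * \<phi> x" for c x
    by (rule eqI) (simp add: T\<phi> Tscalar \<Theta>(5))
  moreover have "\<phi> (mul x y) = fps_bilin mul0 (\<phi> x) (\<phi> y)" for x y
    by (rule eqI) (simp add: T\<phi> \<Theta>(4) fps_bilin_additive_transport[OF \<Theta>0(2,3)])
  moreover have "\<phi> 1 = 1"
  proof (rule eqI)
    have "\<Theta>0 1 = 1" using at0[of 1] by (simp add: \<Theta>(3))
    hence "?T 1 = 1" by (simp add: fps_eq_iff[where 'a = "usl2 fps"] additive.zero[OF \<Theta>0(2)])
    thus "?T (\<phi> 1) = ?T 1" by (simp add: T\<phi> \<Theta>(3))
  qed
  moreover have "\<phi> x $ 0 = x $ 0" for x
  proof (rule eqI0)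
    have "\<Theta>0 (\<phi> x $ 0) = ?T (\<phi> x) $ 0" by simp
    thus "\<Theta>0 (\<phi> x $ 0) = \<Theta>0 (x $ 0)" unfolding T\<phi> at0 .
  qed
  ultimately show ?thesis
    unfolding trivial_formal_deformation1_def Let_def formal_deformation_def equivalent_deformations_def
      fps_bilin_scalar2 fps_const_1_eq_1
    using alg ct by blast
qed

theorem mainTheorem1:
  fixes g :: nat
  assumes "g \<ge> 1"
  shows
    "bij usl2_pbw \<and>
     bij_betw ident_Uh UNIV (carrier Uh) \<and>
     bij_betw (ident_Uhh' g) UNIV (carrier (Uhh' g)) \<and>
     trivial_formal_deformation2 usl2_scale (*) 1 (mult_Uhh' g) \<and>
     trivial_formal_deformation1 (fps_bilin usl2_scale) mult_Uh 1 (mult_Uhh' g) \<and>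
     trivial_formal_deformation1 (fps_bilin usl2_scale) mult_Uh 1
       (\<lambda>x y. fps_swap (mult_Uhh' g (fps_swap x) (fps_swap y)))"
proof (intro conjI)
  let ?F = "Uhh'_trivialisation g" and ?G = "Uh_trivialisation g"
  note \<Theta> = Uhh'_trivialisation_bij[of g] Uhh'_trivialisation_additive[of g] Uhh'_trivialisation_1[of g]
    Uhh'_trivialisation_mult[OF assms] Uhh'_trivialisation_scalar[of g]
  note \<Theta>0 = Uh_trivialisation_bij[of g] Uh_trivialisation_additive[of g] Uh_trivialisation_mult[OF assms] Uh_trivialisation_scalar[of g]
  show "bij usl2_pbw" by (rule usl2_pbw_bij)
  show "bij_betw ident_Uh UNIV (carrier Uh)" by (rule ident_Uh_bij[OF assms])
  show "bij_betw (ident_Uhh' g) UNIV (carrier (Uhh' g))" by (rule ident_Uhh'_bij[OF assms])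
  show "trivial_formal_deformation1 (fps_bilin usl2_scale) mult_Uh 1 (mult_Uhh' g)"
    by (rule trivial_formal_deformation1_transport[OF \<Theta> \<Theta>0 Uhh'_trivialisation_at_0])
  show "trivial_formal_deformation1 (fps_bilin usl2_scale) mult_Uh 1
       (\<lambda>x y. fps_swap (mult_Uhh' g (fps_swap x) (fps_swap y)))"
  proof (rule trivial_formal_deformation1_transport[where \<Theta> = "\<lambda>x. fps_swap (?F (fps_swap x))", OF _ _ _ _ _ \<Theta>0])
    have "bij (fps_swap :: usl2 fps fps \<Rightarrow> _)"
      by (rule involuntory_imp_bij) simp
    from bij_comp[OF bij_comp[OF this \<Theta>(1)] this] show "bij (\<lambda>x. fps_swap (?F (fps_swap x)))"
      by (simp add: o_def)
    show "additive (\<lambda>x. fps_swap (?F (fps_swap x)))"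
      by (simp add: additive_def ring_hom1_add[OF fps_swap_hom] additive.add[OF \<Theta>(2)])
    show "fps_swap (?F (fps_swap 1)) = 1"
      by (simp add: ring_hom1_1[OF fps_swap_hom] \<Theta>(3))
    show "fps_swap (?F (fps_swap (fps_swap (mult_Uhh' g (fps_swap x) (fps_swap y))))) =
        fps_swap (?F (fps_swap x)) * fps_swap (?F (fps_swap y))" for x y
      by (simp add: \<Theta>(4) ring_hom1_mult[OF fps_swap_hom])
    have sc: "fps_swap (scalar2 c) = scalar2 (fps_swap c)" for c
      by (rule fps2_eqI) (simp add: scalar2_def scalar1_def)
    show "fps_swap (?F (fps_swap (scalar2 c * x))) = scalar2 c * fps_swap (?F (fps_swap x))" for c x
      by (simp add: ring_hom1_mult[OF fps_swap_hom] sc \<Theta>(5))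
    show "fps_swap (?F (fps_swap x)) $ 0 = ?G (x $ 0)" for x
      by (simp add: Uhh'_trivialisation_swap_at_0[OF assms] del: fps_swap_nth)
  qed
  show "trivial_formal_deformation2 usl2_scale (*) 1 (mult_Uhh' g)"
  proof -
    have "algebra_structure (\<lambda>c x. scalar2 c * x) (mult_Uhh' g) 1"
      by (rule algebra_structure_transport[of ?F]) (use \<Theta> scalar2_central in \<open>auto intro: bij_is_inj\<close>)
    moreover have c: "?F x $ 0 $ 0 = x $ 0 $ 0" for x
      by (simp only: Uhh'_trivialisation_at_0 Uh_trivialisation_0)
    moreover have "mult_Uhh' g x y $ 0 $ 0 = x $ 0 $ 0 * y $ 0 $ 0" for x y
      unfolding c[of "mult_Uhh' g x y", symmetric] \<Theta>(4) by (simp add: c)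
    ultimately show ?thesis
      unfolding trivial_formal_deformation2_def Let_def formal_deformation_def equivalent_deformations_def
        fps_bilin_scalar2 fps_bilin_mult fps_const_1_eq_1
      using \<Theta>(1,3,4,5) additive.add[OF \<Theta>(2)] by blast
  qed
qed

end
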